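(* Let $k \ge 3$ be an integer. Every connected $n$-vertex $r$-regular graph $G$ with $r \ge \frac{n}{k+1}$ satisfies $$c_k(G)^{1/n} \ge (1-o_n(1))\, r \cdot z_k,$$ where $o_n(1)$ denotes a quantity (depending only on $n$ and $k$) that tends to $0$ as $n \to \infty$ with $k$ fixed.
   Context: For a graph $G$, $c_k(G)$ denotes the number of spanning trees of $G$ with maximum degree at most $k$. Define $f_k = 1-\frac{1}{e}\sum_{i=0}^{k-3}\frac{1}{i!}$, $g_k = \frac{2}{e(k-1)!}$, and $z_3 = 0.0494$, $z_4 = 0.1527$, and for $k \ge 5$, $z_k = (1-(k+1)(f_k+g_k))^{g_k}(1-g_k)^{1-g_k} g_k^{g_k}$. *)

theory Defs
  imports Complex_Main
begin

text \<open>
  A finite simple undirected graph is given by a vertex set \<open>V\<close> and a set \<open>E\<close> of edges, where an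
  edge is a two-element subset of \<open>V\<close>.
\<close>

definition simple_graph :: "'a set \<Rightarrow> 'a set set \<Rightarrow> bool" where
  "simple_graph V E \<longleftrightarrow> finite V \<and> (\<forall>e\<in>E. e \<subseteq> V \<and> card e = 2)"

definition graph_degree :: "'a set set \<Rightarrow> 'a \<Rightarrow> nat" where
  "graph_degree E v = card {e \<in> E. v \<in> e}"

definition regular_graph :: "'a set \<Rightarrow> 'a set set \<Rightarrow> nat \<Rightarrow> bool" where
  "regular_graph V E r \<longleftrightarrow> (\<forall>v\<in>V. graph_degree E v = r)"

definition connected_graph :: "'a set \<Rightarrow> 'a set set \<Rightarrow> bool" where
  "connected_graph V E \<longleftrightarrow>
     V \<noteq> {} \<and> (\<forall>u\<in>V. \<forall>v\<in>V. (u, v) \<in> {(x, y). {x, y} \<in> E}\<^sup>*)"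

text \<open>A cycle is the list of its distinct vertices; the edge closing it up is left implicit.\<close>

definition graph_cycle :: "'a set set \<Rightarrow> 'a list \<Rightarrow> bool" where
  "graph_cycle E xs \<longleftrightarrow> length xs \<ge> 3 \<and> distinct xs \<and>
     (\<forall>i < length xs. {xs ! i, xs ! (Suc i mod length xs)} \<in> E)"

definition tree_graph :: "'a set \<Rightarrow> 'a set set \<Rightarrow> bool" where
  "tree_graph V E \<longleftrightarrow> simple_graph V E \<and> connected_graph V E \<and> (\<nexists>xs. graph_cycle E xs)"

text \<open>A spanning tree is identified with its edge set, its vertex set being all of \<open>V\<close>.\<close>

definition spanning_trees :: "'a set \<Rightarrow> 'a set set \<Rightarrow> 'a set set set" where
  "spanning_trees V E = {T. T \<subseteq> E \<and> tree_graph V T}"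

definition bounded_tree_count :: "nat \<Rightarrow> 'a set \<Rightarrow> 'a set set \<Rightarrow> nat" where
  "bounded_tree_count k V E = card {T \<in> spanning_trees V E. \<forall>v\<in>V. graph_degree T v \<le> k}"

definition f_const :: "nat \<Rightarrow> real" where
  "f_const k = 1 - 1 / exp 1 * (\<Sum>i=0..k-3. 1 / fact i)"

definition g_const :: "nat \<Rightarrow> real" where
  "g_const k = 2 / (exp 1 * fact (k - 1))"

text \<open>Only the values for \<open>k \<ge> 3\<close> are meaningful.\<close>

definition z_const :: "nat \<Rightarrow> real" where
  "z_const k =
     (if k = 3 then 0.0494
      else if k = 4 then 0.1527
      else (1 - (real k + 1) * (f_const k + g_const k)) powr g_const k
           * (1 - g_const k) powr (1 - g_const k) * g_const k powr g_const k)"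

end

theory Submission
  imports Defs "HOL-Library.FuncSet" "HOL-Real_Asymp.Real_Asymp"
begin

text \<open>
  A spanning tree is built from a small fixed tree \<open>K\<close> of \<open>G\<close> and a map \<open>F\<close> sending each vertex
  outside \<open>K\<close> to a neighbour. The vertex set of \<open>K\<close> has only \<open>O(log n)\<close> elements, yet every vertex
  has many neighbours in \<open>K\<close> whose degree in \<open>K\<close> is below \<open>k\<close>. Such a \<open>K\<close> exists because deleting
  few vertices of \<open>G\<close> leaves at most \<open>k\<close> components, so that the robustly connected parts of \<open>G\<close> can
  be joined by a tree on the parts, in which every degree is at most \<open>k - 1\<close>.

  The maps \<open>F\<close> are counted with all in-degrees at most \<open>k - 1\<close>. A uniformly random map has in-degrees
  at most \<open>k - 2\<close> after the values of about \<open>g_k n\<close> vertices are dropped, and those vertices then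
  choose new, pairwise distinct values; this yields the entropy factor in \<open>z_k\<close>. For \<open>k = 3\<close> the
  uniform map is replaced by ten random proposals per vertex, from which Hall's theorem selects
  an almost injective map.

  Finally the cycles of \<open>F\<close> are broken one at a time. A vertex \<open>v\<close> on a cycle of a small component is
  redirected out of that component. There are linearly many choices for the new value, while the old
  value is one of the few vertices from which \<open>v\<close> is reachable, so this loses only a factor
  \<open>(1 + \<theta>)^n\<close> with \<open>\<theta>\<close> arbitrarily small. The boundedly many remaining cycles lie in large components
  and are broken by sending one vertex of each to its own vertex of \<open>K\<close>.
\<close>

section \<open>Graphs and trees\<close>

text \<open>The degree budget: a vertex outside \<open>K\<close> spends one edge on its own value,
  which leaves in-degree \<open>k - 1\<close>; the first stage is held to \<open>k - 2\<close>
  because distinct replacement values add at most one more. The obstacle is that a redirection needs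
  linearly many targets that are not yet at the cap. A degree may be as small as
  \<open>n / (k + 1)\<close>, so the number of vertices at the cap, bounded through the number of
  dropped values, must stay below this by a linear margin. For \<open>g_k n\<close> dropped values
  that means \<open>(k + 1) * g_k < 1\<close>, which holds from \<open>k = 4\<close> on, whereas
  \<open>g_3 = 1/e\<close> exceeds \<open>1/4\<close>. Ten proposals lower the number of dropped
  values to \<open>n/7\<close> at the price of a factor 10 per vertex; the two numbers fit together
  because \<open>4 < exp (10/7)\<close>, where \<open>4^n\<close> counts the pairs of sets that may
  violate Hall's condition. If \<open>x n\<close> values are dropped, a fraction of about
  \<open>1 - (k + 1) x\<close> of a neighbourhood remains free for a replacement. Its power
  \<open>x\<close> is the first factor of the bound, and division by the number of possible dropped
  sets gives the factors \<open>(1 - x) powr (1 - x)\<close> and \<open>x powr x\<close>.\<close>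

definition nbrs :: "'a set set \<Rightarrow> 'a \<Rightarrow> 'a set" where
  "nbrs E v = {u. {v, u} \<in> E}"

lemma nbrs_sym: "u \<in> nbrs E v \<longleftrightarrow> v \<in> nbrs E u"
  by (simp add: nbrs_def insert_commute)

lemma edge_cases:
  assumes "simple_graph V E" "e \<in> E"
  obtains u v where "e = {u, v}" "u \<noteq> v" "u \<in> V" "v \<in> V"
proof -
  have "card e = 2" "e \<subseteq> V" using assms by (auto simp: simple_graph_def)
  then show ?thesis using that by (auto simp: card_2_iff)
qed

lemma finite_edges: "simple_graph V E \<Longrightarrow> finite E"
  by (rule finite_subset[of _ "Pow V"]) (auto simp: simple_graph_def)

lemma nbrs_subset: "simple_graph V E \<Longrightarrow> nbrs E v \<subseteq> V - {v}"
proof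
  fix u assume "simple_graph V E" "u \<in> nbrs E v"
  then have "{v, u} \<subseteq> V" "card {v, u} = 2" by (auto simp: simple_graph_def nbrs_def)
  then show "u \<in> V - {v}" by (cases "u = v") auto
qed

lemma finite_nbrs: "simple_graph V E \<Longrightarrow> finite (nbrs E v)"
  using nbrs_subset finite_subset by (metis finite_Diff simple_graph_def)

lemma graph_degree_nbrs:
  assumes "simple_graph V E"
  shows "graph_degree E v = card (nbrs E v)"
proof -
  have "{e \<in> E. v \<in> e} = (\<lambda>u. {v, u}) ` nbrs E v"
  proof (intro set_eqI iffI)
    fix e assume "e \<in> {e \<in> E. v \<in> e}"
    then have e: "e \<in> E" "v \<in> e" by auto
    then obtain a b where "e = {a, b}" using edge_cases[OF assms] by metis
    then have "e = {v, a} \<or> e = {v, b}" using e by auto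
    then show "e \<in> (\<lambda>u. {v, u}) ` nbrs E v" using e by (auto simp: nbrs_def)
  qed (auto simp: nbrs_def)
  moreover have "inj_on (\<lambda>u. {v, u}) (nbrs E v)"
    by (auto simp: inj_on_def doubleton_eq_iff)
  ultimately show ?thesis by (simp add: graph_degree_def card_image)
qed

lemma graph_degree_mono: "finite F \<Longrightarrow> E \<subseteq> F \<Longrightarrow> graph_degree E v \<le> graph_degree F v"
  unfolding graph_degree_def by (rule card_mono) auto

lemma graph_degree_zero: "(\<And>e. e \<in> E \<Longrightarrow> v \<notin> e) \<Longrightarrow> graph_degree E v = 0"
  unfolding graph_degree_def by (metis (no_types, lifting) Collect_empty_eq card.empty)

lemma graph_degree_insert_le: "graph_degree (insert e E) v \<le> Suc (graph_degree E v)"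
proof -
  have "{f \<in> insert e E. v \<in> f} = (if v \<in> e then insert e {f \<in> E. v \<in> f} else {f \<in> E. v \<in> f})"
    by auto
  then show ?thesis unfolding graph_degree_def
    by (cases "finite {f \<in> E. v \<in> f}") (auto simp: card_insert_if)
qed

lemma graph_degree_insert_other: "v \<notin> e \<Longrightarrow> graph_degree (insert e E) v = graph_degree E v"
  unfolding graph_degree_def by (metis (no_types, lifting) insert_iff)

definition adj :: "'a set set \<Rightarrow> ('a \<times> 'a) set" where
  "adj E = {(x, y). {x, y} \<in> E}"

lemma connected_graph_adj:
  "connected_graph V E \<longleftrightarrow> V \<noteq> {} \<and> (\<forall>u\<in>V. \<forall>v\<in>V. (u, v) \<in> (adj E)\<^sup>*)"
  by (simp add: connected_graph_def adj_def)

lemma sym_adj: "sym (adj E)"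
  by (auto simp: sym_def adj_def insert_commute)

lemma adj_rtrancl_sym: "(u, v) \<in> (adj E)\<^sup>* \<Longrightarrow> (v, u) \<in> (adj E)\<^sup>*"
  using sym_adj sym_rtrancl by (metis symD)

lemma adj_mono: "E \<subseteq> F \<Longrightarrow> (adj E)\<^sup>* \<subseteq> (adj F)\<^sup>*"
  by (rule rtrancl_mono) (auto simp: adj_def)

lemma connected_graphI_root:
  assumes "x \<in> V" "\<And>v. v \<in> V \<Longrightarrow> (x, v) \<in> (adj E)\<^sup>*"
  shows "connected_graph V E"
  unfolding connected_graph_adj using assms by (blast intro: rtrancl_trans adj_rtrancl_sym)

text \<open>Used to keep cycles away from vertices with a single neighbour.\<close>

lemma graph_cycle_two_nbrs:
  assumes "graph_cycle E xs" "v \<in> set xs"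
  obtains a b where "a \<in> set xs" "b \<in> set xs" "a \<noteq> b" "{v, a} \<in> E" "{v, b} \<in> E"
proof -
  define n where "n = length xs"
  have n: "n \<ge> 3" and d: "distinct xs" and
    c: "\<And>i. i < n \<Longrightarrow> {xs ! i, xs ! (Suc i mod n)} \<in> E"
    using assms by (auto simp: graph_cycle_def n_def)
  obtain i where i: "i < n" "v = xs ! i" using assms by (auto simp: in_set_conv_nth n_def)
  define j where "j = (if i = 0 then n - 1 else i - 1)"
  have j: "j < n" "Suc j mod n = i" using i n by (auto simp: j_def)
  have s: "Suc i mod n < n" using n by auto
  \<comment> \<open>Successor and predecessor on the cycle differ because its length is at least
    3.\<close>
  have ne: "Suc i mod n \<noteq> j"
  proof (cases "Suc i < n")
    case True then show ?thesis using n by (auto simp: j_def)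
  next
    case False then have "Suc i = n" using i by auto
    then show ?thesis using n by (auto simp: j_def)
  qed
  show ?thesis
  proof (rule that[of "xs ! (Suc i mod n)" "xs ! j"])
    show "xs ! (Suc i mod n) \<noteq> xs ! j" using ne s j d by (simp add: nth_eq_iff_index_eq n_def)
    show "{v, xs ! j} \<in> E" using c[OF j(1)] j i by (simp add: insert_commute)
    show "{v, xs ! (Suc i mod n)} \<in> E" using c i by simp
    show "xs ! (Suc i mod n) \<in> set xs" "xs ! j \<in> set xs" using s j by (auto simp: n_def)
  qed
qed

lemma tree_graph_singleton: "tree_graph {x} {}"
proof -
  have "\<not> graph_cycle {} xs" for xs :: "'a list"
    by (cases xs) (auto simp: graph_cycle_def)
  then show ?thesis by (auto simp: tree_graph_def simple_graph_def connected_graph_def)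
qed

text \<open>A cycle cannot pass through \<open>v\<close>, whose only neighbour is \<open>u\<close>,
  so it would already be a cycle of \<open>T\<close>. All trees below arise by repeating this
  operation.\<close>

lemma tree_graph_pendant:
  assumes T: "tree_graph X T" and u: "u \<in> X" and v: "v \<notin> X"
  shows "tree_graph (insert v X) (insert {u, v} T)"
proof -
  let ?T = "insert {u, v} T"
  have s: "simple_graph X T" and c: "connected_graph X T" and nc: "\<nexists>xs. graph_cycle T xs"
    using T by (auto simp: tree_graph_def)
  have uv: "u \<noteq> v" using u v by auto
  have "simple_graph (insert v X) ?T"
    using s u uv by (auto simp: simple_graph_def)
  moreover have "connected_graph (insert v X) ?T"
  proof (rule connected_graphI_root[of u])
    fix w assume w: "w \<in> insert v X"
    show "(u, w) \<in> (adj ?T)\<^sup>*"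
    proof (cases "w = v")
      case True then show ?thesis by (auto simp: adj_def)
    next
      case False
      then have "(u, w) \<in> (adj T)\<^sup>*" using c w u by (auto simp: connected_graph_adj)
      then show ?thesis using adj_mono[of T ?T] by auto
    qed
  qed (use u in auto)
  moreover have "\<not> graph_cycle ?T xs" for xs
  proof
    assume cy: "graph_cycle ?T xs"
    have only: "{v, a} \<in> ?T \<Longrightarrow> a = u" for a
      using v s by (auto simp: simple_graph_def doubleton_eq_iff)
    have "v \<notin> set xs" using graph_cycle_two_nbrs[OF cy] only by metis
    then have nv: "xs ! i \<noteq> v" if "i < length xs" for i
      using that by auto
    have "{xs ! i, xs ! (Suc i mod length xs)} \<in> T" if i: "i < length xs" for i
    proof -
      have "Suc i mod length xs < length xs" using i by (intro mod_less_divisor) auto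
      then have "{xs ! i, xs ! (Suc i mod length xs)} \<noteq> {u, v}"
        using nv i by (auto simp: doubleton_eq_iff)
      then show ?thesis using cy i by (auto simp: graph_cycle_def)
    qed
    then have "graph_cycle T xs" using cy by (simp add: graph_cycle_def)
    then show False using nc by auto
  qed
  ultimately show ?thesis by (auto simp: tree_graph_def)
qed

lemma connected_cut_edge:
  assumes c: "(x, y) \<in> (adj E)\<^sup>*" and "x \<in> Y" "y \<notin> Y"
  obtains a b where "{a, b} \<in> E" "a \<in> Y" "b \<notin> Y"
proof -
  have "\<exists>a b. {a, b} \<in> E \<and> a \<in> Y \<and> b \<notin> Y"
    using assms
  proof (induction rule: rtrancl_induct)
    case (step b c)
    then show ?case by (cases "b \<in> Y") (auto simp: adj_def)
  qed auto
  then show ?thesis using that by auto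
qed

text \<open>Greedy growth: connectedness supplies an edge leaving the vertices reached so
  far.\<close>

lemma spanning_tree_exists:
  assumes s: "simple_graph X H" and c: "connected_graph X H"
  shows "\<exists>T \<subseteq> H. tree_graph X T"
proof -
  have fin: "finite X" using s by (simp add: simple_graph_def)
  obtain x where x: "x \<in> X" using c by (auto simp: connected_graph_def)
  have "\<exists>Y T. Y \<subseteq> X \<and> T \<subseteq> H \<and> tree_graph Y T \<and> card Y = Suc n \<and> x \<in> Y" if "n < card X" for n
    using that
  proof (induction n)
    case 0
    show ?case
      by (rule exI[of _ "{x}"], rule exI[of _ "{}"]) (use x tree_graph_singleton in auto)
  next
    case (Suc n)
    then obtain Y T where Y: "Y \<subseteq> X" "T \<subseteq> H" "tree_graph Y T" "card Y = Suc n" "x \<in> Y" by auto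
    then obtain y where y: "y \<in> X" "y \<notin> Y" using Suc by (metis less_irrefl subsetI subset_antisym)
    have "(x, y) \<in> (adj H)\<^sup>*" using c x y by (auto simp: connected_graph_adj)
    then obtain a b where ab: "{a, b} \<in> H" "a \<in> Y" "b \<notin> Y"
      using connected_cut_edge Y y by metis
    have "b \<in> X" using ab s by (auto simp: simple_graph_def)
    moreover have "card (insert b Y) = Suc (Suc n)"
      using ab Y fin by (metis card_insert_disjoint finite_subset)
    ultimately show ?case
      by (intro exI[of _ "insert b Y"] exI[of _ "insert {a, b} T"])
        (use ab Y tree_graph_pendant in auto)
  qed
  from this[of "card X - 1"] obtain Y T where "Y \<subseteq> X" "T \<subseteq> H" "tree_graph Y T" "card Y = card X"
    using x fin by (metis Suc_diff_1 card_gt_0_iff diff_less empty_iff less_numeral_extra(1))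
  then show ?thesis using fin by (metis card_subset_eq)
qed

section \<open>Breaking cycles by redirection\<close>

definition indeg :: "'a set \<Rightarrow> ('a \<Rightarrow> 'b) \<Rightarrow> 'b \<Rightarrow> nat" where
  "indeg U F u = card {v \<in> U. F v = u}"

text \<open>For cyclic \<open>v\<close> this is the whole component of \<open>v\<close> in the
  functional graph of \<open>F\<close> on \<open>U\<close>.\<close>

definition into :: "'a set \<Rightarrow> ('a \<Rightarrow> 'a) \<Rightarrow> 'a \<Rightarrow> 'a set" where
  "into U F v = {u \<in> U. \<exists>l. (F ^^ l) u = v}"

definition cyclic :: "('a \<Rightarrow> 'a) \<Rightarrow> 'a \<Rightarrow> bool" where
  "cyclic F v \<longleftrightarrow> (\<exists>l>0. (F ^^ l) v = v)"

lemma funpow_in: "(\<And>x. x \<in> U \<Longrightarrow> F x \<in> U) \<Longrightarrow> v \<in> U \<Longrightarrow> (F ^^ l) v \<in> U"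
  by (induction l) auto

lemma funpow_agree:
  assumes "\<And>i. i < l \<Longrightarrow> (F ^^ i) u \<noteq> v" "\<And>x. x \<noteq> v \<Longrightarrow> G x = F x"
  shows "(G ^^ l) u = (F ^^ l) u"
  using assms(1) by (induction l) (auto simp: assms(2))

text \<open>Up to its first visit to \<open>v\<close>, an orbit never consults the value at
  \<open>v\<close>.\<close>

lemma funpow_reach_agree:
  assumes "(F ^^ l) u = v" "\<And>x. x \<noteq> v \<Longrightarrow> G x = F x"
  shows "\<exists>l. (G ^^ l) u = v"
proof -
  define m where "m = (LEAST l. (F ^^ l) u = v)"
  have "(F ^^ m) u = v" unfolding m_def using assms(1) by (rule LeastI)
  moreover have "(F ^^ i) u \<noteq> v" if "i < m" for i
    using that not_less_Least unfolding m_def by blast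
  ultimately have "(G ^^ m) u = v" using funpow_agree[where F = F and G = G and v = v and u = u and l = m] assms(2) by auto
  then show ?thesis ..
qed

lemma into_upd: "into U (F(v := w)) v = into U F v"
proof -
  have "(\<exists>l. (F(v := w) ^^ l) u = v) \<longleftrightarrow> (\<exists>l. (F ^^ l) u = v)" for u
  proof
    assume "\<exists>l. (F(v := w) ^^ l) u = v"
    then obtain l where "(F(v := w) ^^ l) u = v" ..
    then show "\<exists>l. (F ^^ l) u = v" by (rule funpow_reach_agree) simp
  next
    assume "\<exists>l. (F ^^ l) u = v"
    then obtain l where "(F ^^ l) u = v" ..
    then show "\<exists>l. (F(v := w) ^^ l) u = v" by (rule funpow_reach_agree) simp
  qed
  then show ?thesis by (simp add: into_def)
qed

lemma cyclic_mult: "(F ^^ l) v = v \<Longrightarrow> (F ^^ (n * l)) v = v"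
  by (induction n) (auto simp: funpow_add)

lemma cyclic_return:
  assumes "cyclic F v" "(F ^^ a) v = u"
  shows "\<exists>j. (F ^^ j) u = v"
proof -
  obtain l where l: "l > 0" "(F ^^ l) v = v" using assms(1) by (auto simp: cyclic_def)
  \<comment> \<open>\<open>a * l\<close> is a multiple of the period and at least \<open>a\<close>,
    so walking on from step \<open>a\<close> leads back to \<open>v\<close>.\<close>
  have "a \<le> a * l" using l by simp
  then have "(F ^^ (a * l - a)) ((F ^^ a) v) = (F ^^ (a * l)) v"
    by (metis comp_apply funpow_add le_add_diff_inverse2)
  then show ?thesis using cyclic_mult[OF l(2)] assms(2) by metis
qed

lemma cyclic_orbit:
  assumes "cyclic F v" "(F ^^ a) v = u"
  shows "cyclic F u"
proof -
  obtain l where l: "l > 0" "(F ^^ l) v = v" using assms(1) by (auto simp: cyclic_def)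
  have "(F ^^ l) u = (F ^^ a) ((F ^^ l) v)"
    using assms(2) by (metis add.commute comp_apply funpow_add)
  then show ?thesis using l assms(2) by (auto simp: cyclic_def)
qed

text \<open>A cycle through \<open>v\<close> would lead from \<open>w\<close> back to
  \<open>v\<close>, and reaching \<open>v\<close> does not depend on the value at
  \<open>v\<close>.\<close>

lemma not_cyclic_upd:
  assumes "w \<in> U" "w \<notin> into U F v"
  shows "\<not> cyclic (F(v := w)) v"
proof
  assume "cyclic (F(v := w)) v"
  then obtain l where "((F(v := w)) ^^ Suc l) v = v" by (auto simp: cyclic_def gr0_conv_Suc)
  then have "((F(v := w)) ^^ l) w = v" by (simp add: funpow_Suc_right del: funpow.simps)
  then have "w \<in> into U (F(v := w)) v" using assms(1) by (auto simp: into_def)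
  then show False using assms(2) into_upd by metis
qed

text \<open>Cycles of \<open>G\<close> avoid \<open>v\<close>, the only place where \<open>G\<close>
  and \<open>F\<close> may differ. Hence a redirection destroys one cycle and creates none.\<close>

lemma cyclic_upd:
  assumes nc: "\<not> cyclic G v" and eq: "\<And>x. x \<noteq> v \<Longrightarrow> G x = F x" and u: "cyclic G u"
  shows "cyclic F u" "(F ^^ i) u \<noteq> v"
proof -
  have G: "(G ^^ i) u \<noteq> v" for i using cyclic_orbit[OF u] nc by blast
  then have FG: "(F ^^ i) u = (G ^^ i) u" for i by (rule funpow_agree) (simp add: eq)
  show "cyclic F u" using u by (simp add: cyclic_def FG)
  show "(F ^^ i) u \<noteq> v" using G FG by simp
qed

text \<open>Components that are already large stay large. If an \<open>F\<close>-path to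
  \<open>u\<close> met \<open>v\<close>, then \<open>u\<close> would lie on the
  \<open>F\<close>-cycle of \<open>v\<close> and lead back to \<open>v\<close>, which
  \<open>cyclic_upd\<close> excludes.\<close>

lemma into_mono_upd:
  assumes nc: "\<not> cyclic G v" and c: "cyclic F v" and eq: "\<And>x. x \<noteq> v \<Longrightarrow> G x = F x" and u: "cyclic G u"
  shows "into U F u \<subseteq> into U G u"
proof
  fix y assume "y \<in> into U F u"
  then obtain l where y: "y \<in> U" "(F ^^ l) y = u" by (auto simp: into_def)
  have "(F ^^ i) y \<noteq> v" if "i < l" for i
  proof
    assume "(F ^^ i) y = v"
    then have "(F ^^ (l - i)) v = u" using y that
      by (metis comp_apply funpow_add le_add_diff_inverse2 less_imp_le)
    then obtain j where "(F ^^ j) u = v" using cyclic_return[OF c] by blast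
    then show False using cyclic_upd(2)[OF nc eq u] by blast
  qed
  then have "(G ^^ l) y = u" using funpow_agree[where F = F and G = G and v = v and u = y and l = l] eq y by auto
  then show "y \<in> into U G u" using y by (auto simp: into_def)
qed

lemma sum_Pow_card:
  fixes t :: real assumes "finite U"
  shows "(\<Sum>B\<in>Pow U. t ^ card B) = (1 + t) ^ card U"
  using assms
proof (induction U rule: finite_induct)
  case (insert x U)
  have "(\<Sum>B\<in>Pow (insert x U). t ^ card B) = (\<Sum>B\<in>Pow U. t ^ card B) + (\<Sum>B\<in>insert x ` Pow U. t ^ card B)"
    unfolding Pow_insert using insert by (intro sum.union_disjoint) auto
  also have "(\<Sum>B\<in>insert x ` Pow U. t ^ card B) = (\<Sum>B\<in>Pow U. t ^ card (insert x B))"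
    using insert by (subst sum.reindex) (auto simp: inj_on_def)
  also have "\<dots> = (\<Sum>B\<in>Pow U. t * t ^ card B)"
  proof (rule sum.cong)
    fix B assume "B \<in> Pow U"
    then show "t ^ card (insert x B) = t * t ^ card B"
      using insert by (subst card_insert_disjoint) (auto intro: finite_subset)
  qed simp
  finally show ?case using insert by (simp add: sum_distrib_left[symmetric] algebra_simps)
qed simp

lemma indeg_upd_le:
  assumes "finite U"
  shows "indeg U (F(v := w)) u \<le> indeg U F u + (if u = w then 1 else 0)"
proof -
  have "{x \<in> U. (F(v := w)) x = u} \<subseteq> {x \<in> U. F x = u} \<union> (if u = w then {v} else {})" by auto
  moreover have "finite ({x \<in> U. F x = u} \<union> (if u = w then {v} else {}))" using assms by auto
  ultimately have "indeg U (F(v := w)) u \<le> card ({x \<in> U. F x = u} \<union> (if u = w then {v} else {}))"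
    unfolding indeg_def by (rule card_mono[rotated])
  also have "\<dots> \<le> indeg U F u + (if u = w then 1 else 0)"
    unfolding indeg_def using card_Un_le[of "{x \<in> U. F x = u}" "if u = w then {v} else {}"] by auto
  finally show ?thesis .
qed

text \<open>\<open>c\<close> caps the in-degrees, \<open>d\<close> vertices may be at the cap
  initially, at most \<open>m\<close> redirections are made, and a component with fewer than
  \<open>s\<close> vertices counts as small. After exclusion of a small component and of the at most
  \<open>d + m\<close> vertices at the cap, \<open>h\<close> targets remain.\<close>

locale redirection =
  fixes U :: "'a set" and N :: "'a \<Rightarrow> 'a set" and c d m s h :: nat
  assumes fin: "finite U" and N: "\<And>v. v \<in> U \<Longrightarrow> N v \<subseteq> U"
    and big: "\<And>v. v \<in> U \<Longrightarrow> card (N v) \<ge> h + s + d + m" and h: "h > 0"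
begin

definition full :: "('a \<Rightarrow> 'a) \<Rightarrow> 'a set" where
  "full F = {u \<in> U. indeg U F u \<ge> c}"

text \<open>In a pair \<open>(F, B)\<close>, the set \<open>B\<close> records which vertices have been redirected so far.\<close>

definition state :: "'a set \<Rightarrow> (('a \<Rightarrow> 'a) \<times> 'a set) set" where
  "state Z = {(F, B). F \<in> PiE U N \<and> B \<subseteq> Z \<and> card B \<le> m \<and> (\<forall>u\<in>U. indeg U F u \<le> c) \<and>
     card (full F) \<le> d + card B \<and>
     (card B < m \<longrightarrow> (\<forall>u\<in>Z. cyclic F u \<longrightarrow> card (into U F u) \<ge> s))}"

definition choices :: "'a \<Rightarrow> ('a \<Rightarrow> 'a) \<Rightarrow> 'a set" where
  "choices v F = {w \<in> N v. w \<notin> into U F v \<and> w \<notin> full F}"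

lemma finite_PiE_N: "finite (PiE U N)"
  using fin N by (intro finite_PiE) (auto intro: finite_subset)

lemma finite_state: "Z \<subseteq> U \<Longrightarrow> finite (state Z)"
  by (rule finite_subset[of _ "PiE U N \<times> Pow U"]) (use finite_PiE_N fin in \<open>auto simp: state_def\<close>)

lemma choices_card:
  assumes "v \<in> U" "(F, B) \<in> state Z" "card (into U F v) < s"
  shows "h \<le> card (choices v F)"
proof -
  have "choices v F = N v - (into U F v \<union> full F)" by (auto simp: choices_def)
  moreover have "card (into U F v \<union> full F) \<le> s + d + m"
    using card_Un_le[of "into U F v" "full F"] assms by (auto simp: state_def)
  ultimately show ?thesis
    using big[OF assms(1)] diff_card_le_card_Diff[of "into U F v \<union> full F" "N v"] fin
    by (auto simp: into_def full_def)
qed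

text \<open>Only \<open>w\<close> gains in-degree, and it was below the cap. So at most one further
  vertex becomes full, which the growth of \<open>B\<close> pays for.\<close>

lemma redirect_state:
  assumes Z: "Z \<subseteq> U" "v \<in> U" "v \<notin> Z" and F: "(F, B) \<in> state Z" "card B < m"
    and cy: "cyclic F v" and w: "w \<in> choices v F"
  shows "(F(v := w), insert v B) \<in> state (insert v Z)"
proof -
  let ?G = "F(v := w)"
  have B: "finite B" "v \<notin> B" using F Z fin by (auto simp: state_def intro: finite_subset)
  have wU: "w \<in> U" using w N Z by (auto simp: choices_def)
  have nc: "\<not> cyclic ?G v" using not_cyclic_upd[OF wU] w by (auto simp: choices_def)
  have "?G \<in> PiE U N" using F w Z by (auto simp: state_def choices_def PiE_def extensional_def)
  moreover have "indeg U ?G u \<le> c" if "u \<in> U" for u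
    using indeg_upd_le[OF fin, of F v w u] F w wU that by (auto simp: state_def choices_def full_def split: if_splits)
  moreover have "card (full ?G) \<le> d + card (insert v B)"
  proof -
    have "full ?G \<subseteq> insert w (full F)"
    proof
      fix u assume u: "u \<in> full ?G"
      show "u \<in> insert w (full F)"
        using indeg_upd_le[OF fin, of F v w u] u by (auto simp: full_def split: if_splits)
    qed
    then have "card (full ?G) \<le> card (insert w (full F))"
      using fin by (intro card_mono) (auto simp: full_def)
    also have "\<dots> \<le> Suc (card (full F))" by (rule card_insert_le_m1) auto
    finally show ?thesis using F B by (auto simp: state_def)
  qed
  moreover have "s \<le> card (into U ?G u)" if u: "u \<in> insert v Z" "cyclic ?G u" for u
  proof -
    have "u \<noteq> v" using nc u by auto
    then have "u \<in> Z" using u by auto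
    moreover have "cyclic F u" using cyclic_upd(1)[OF nc _ u(2), of F] by auto
    ultimately have "s \<le> card (into U F u)" using F by (auto simp: state_def)
    also have "\<dots> \<le> card (into U ?G u)"
      using into_mono_upd[OF nc cy _ u(2)] fin by (intro card_mono) (auto simp: into_def)
    finally show ?thesis .
  qed
  ultimately show ?thesis using F B by (auto simp: state_def)
qed

definition \<theta> :: real where "\<theta> = real s / real h"

text \<open>Each bad map has at least \<open>h\<close> redirections at \<open>v\<close>, and a redirected map has at most \<open>s\<close>
  preimages: since \<open>v\<close> was cyclic, its old value lies in \<open>into U F v\<close>, a set that the redirection
  does not change.\<close>

lemma step:
  assumes Z: "Z \<subseteq> U" "v \<in> U" "v \<notin> Z" and S: "S \<subseteq> state Z"
  obtains S' where "S' \<subseteq> state (insert v Z)" "(\<Sum>(F,B)\<in>S. \<theta> ^ card B) \<le> (\<Sum>(F,B)\<in>S'. \<theta> ^ card B)"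
proof -
  have finS: "finite S" using S finite_state Z finite_subset by metis
  define bad where "bad = {(F, B) \<in> S. card B < m \<and> cyclic F v \<and> card (into U F v) < s}"
  define trip where "trip = (SIGMA x:bad. choices v (fst x))"
  define g where "g = (\<lambda>((F :: 'a \<Rightarrow> 'a, B :: 'a set), w). (F(v := w), insert v B))"
  define new where "new = g ` trip"
  have chfin: "finite (choices v F)" for F
    using N[OF Z(2)] fin by (auto simp: choices_def intro: finite_subset)
  have fb: "finite bad" using finS by (rule finite_subset[rotated]) (auto simp: bad_def)
  have ft: "finite trip" unfolding trip_def using fb chfin by auto
  have fn: "finite new" unfolding new_def using ft by auto
  have new_state: "new \<subseteq> state (insert v Z)"
    using redirect_state[OF Z] S by (auto simp: new_def trip_def g_def bad_def)
  have ok_state: "S - bad \<subseteq> state (insert v Z)"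
  proof
    fix x assume x: "x \<in> S - bad"
    obtain F B where FB: "x = (F, B)" by (cases x)
    have "(F, B) \<in> state Z" using x S FB by auto
    moreover have "card B < m \<longrightarrow> cyclic F v \<longrightarrow> s \<le> card (into U F v)"
      using x FB by (auto simp: bad_def not_less)
    ultimately show "x \<in> state (insert v Z)" by (auto simp: FB state_def)
  qed
  \<comment> \<open>\<open>v\<close> belongs to the second component of every new pair and of no old
    one.\<close>
  have disj: "(S - bad) \<inter> new = {}"
    using S Z by (auto simp: new_def g_def trip_def state_def)
  have B: "finite B" "v \<notin> B" "B \<subseteq> Z" if "(F, B) \<in> bad" for F B
  proof -
    have "(F, B) \<in> state Z" using that S by (auto simp: bad_def)
    then show "B \<subseteq> Z" by (auto simp: state_def)
    then show "finite B" "v \<notin> B" using Z fin by (auto intro: finite_subset)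
  qed
  have fibre: "card {t \<in> trip. g t = y} \<le> s" if y: "y \<in> new" for y
  proof -
    obtain F B w where t: "((F, B), w) \<in> trip" "y = (F(v := w), insert v B)"
      using y by (auto simp: new_def g_def)
    have bd: "(F, B) \<in> bad" using t by (auto simp: trip_def)
    \<comment> \<open>\<open>y\<close> determines \<open>w\<close>, \<open>B\<close> and the map
      away from \<open>v\<close>; only the old value at \<open>v\<close> is free.\<close>
    have "{t \<in> trip. g t = y} \<subseteq> (\<lambda>z. ((F(v := z), B), w)) ` into U F v"
    proof
      fix t' assume "t' \<in> {t \<in> trip. g t = y}"
      then obtain F' B' w' where t': "t' = ((F', B'), w')" "t' \<in> trip" "g t' = y"
        by (metis (mono_tags, lifting) mem_Collect_eq surj_pair)
      have bd': "(F', B') \<in> bad" using t' by (auto simp: trip_def)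
      have eq: "F'(v := w') = F(v := w)" "insert v B' = insert v B" using t' t by (auto simp: g_def)
      have "w' = w" using eq(1) by (metis fun_upd_same)
      moreover have "B' = B" using eq(2) B[OF bd] B[OF bd'] by auto
      moreover have F': "F' = F(v := F' v)" using eq(1) by (metis fun_upd_triv fun_upd_upd)
      moreover have "F' v \<in> into U F v"
      proof -
        obtain l where l: "(F' ^^ Suc l) v = v" using bd' by (auto simp: bad_def cyclic_def gr0_conv_Suc)
        have "F' \<in> PiE U N" using bd' S by (auto simp: bad_def state_def)
        then have "F' v \<in> U" using N Z by auto
        moreover have "(F' ^^ l) (F' v) = v" using l by (simp add: funpow_swap1)
        ultimately have "F' v \<in> into U F' v" by (auto simp: into_def)
        then show ?thesis using into_upd[of U F v "F' v"] F' by metis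
      qed
      ultimately show "t' \<in> (\<lambda>z. ((F(v := z), B), w)) ` into U F v" using t' by auto
    qed
    then have "card {t \<in> trip. g t = y} \<le> card ((\<lambda>z. ((F(v := z), B), w)) ` into U F v)"
      using fin by (intro card_mono) (auto simp: into_def)
    also have "\<dots> \<le> card (into U F v)" using fin by (intro card_image_le) (auto simp: into_def)
    also have "\<dots> \<le> s" using bd by (auto simp: bad_def)
    finally show ?thesis .
  qed
  have th0: "\<theta> \<ge> 0" by (simp add: \<theta>_def)
  have "real h * (\<Sum>(F,B)\<in>bad. \<theta> ^ Suc (card B)) = (\<Sum>x\<in>bad. real h * \<theta> ^ Suc (card (snd x)))"
    by (simp add: sum_distrib_left case_prod_unfold)
  also have "\<dots> \<le> (\<Sum>x\<in>bad. real (card (choices v (fst x))) * \<theta> ^ Suc (card (snd x)))"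
  proof (rule sum_mono)
    fix x assume x: "x \<in> bad"
    then have "h \<le> card (choices v (fst x))"
      using choices_card[OF Z(2), of "fst x" "snd x" Z] S by (auto simp: bad_def)
    then show "real h * \<theta> ^ Suc (card (snd x)) \<le> real (card (choices v (fst x))) * \<theta> ^ Suc (card (snd x))"
      using th0 by (intro mult_right_mono) auto
  qed
  also have "\<dots> = (\<Sum>x\<in>bad. \<Sum>w\<in>choices v (fst x). \<theta> ^ Suc (card (snd x)))" by simp
  also have "\<dots> = (\<Sum>(x,w)\<in>trip. \<theta> ^ Suc (card (snd x)))"
    unfolding trip_def using fb chfin by (subst sum.Sigma) auto
  also have "\<dots> = (\<Sum>t\<in>trip. \<theta> ^ card (snd (g t)))"
    using B by (intro sum.cong) (auto simp: g_def trip_def)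
  also have "\<dots> = (\<Sum>y\<in>new. \<Sum>t\<in>{t \<in> trip. g t = y}. \<theta> ^ card (snd (g t)))"
    unfolding new_def using ft by (rule sum.image_gen)
  also have "\<dots> = (\<Sum>y\<in>new. real (card {t \<in> trip. g t = y}) * \<theta> ^ card (snd y))"
    by (intro sum.cong) auto
  also have "\<dots> \<le> (\<Sum>y\<in>new. real s * \<theta> ^ card (snd y))"
    using fibre th0 by (intro sum_mono mult_right_mono) auto
  finally have le: "real h * (\<Sum>(F,B)\<in>bad. \<theta> ^ Suc (card B)) \<le> real s * (\<Sum>(F,B)\<in>new. \<theta> ^ card B)"
    by (simp add: sum_distrib_left case_prod_unfold)
  have hth: "real h * \<theta> = real s" using h by (simp add: \<theta>_def)
  have "real s * (\<Sum>(F,B)\<in>bad. \<theta> ^ card B) = real h * (\<Sum>(F,B)\<in>bad. \<theta> ^ Suc (card B))"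
    by (simp add: sum_distrib_left case_prod_unfold hth[symmetric] mult_ac)
  with le have "real s * (\<Sum>(F,B)\<in>bad. \<theta> ^ card B) \<le> real s * (\<Sum>(F,B)\<in>new. \<theta> ^ card B)" by simp
  \<comment> \<open>For \<open>s = 0\<close> the factor \<open>real s\<close> cannot be cancelled,
    but then no component is small.\<close>
  moreover have "bad = {}" if "s = 0" using that by (auto simp: bad_def)
  ultimately have "(\<Sum>(F,B)\<in>bad. \<theta> ^ card B) \<le> (\<Sum>(F,B)\<in>new. \<theta> ^ card B)"
    by (cases "s = 0") (auto simp: new_def trip_def)
  moreover have "(\<Sum>(F,B)\<in>S. \<theta> ^ card B) = (\<Sum>(F,B)\<in>S - bad. \<theta> ^ card B) + (\<Sum>(F,B)\<in>bad. \<theta> ^ card B)"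
    using finS by (intro sum.subset_diff) (auto simp: bad_def)
  moreover have "(\<Sum>(F,B)\<in>(S - bad) \<union> new. \<theta> ^ card B) = (\<Sum>(F,B)\<in>S - bad. \<theta> ^ card B) + (\<Sum>(F,B)\<in>new. \<theta> ^ card B)"
    using finS fn disj by (intro sum.union_disjoint) auto
  ultimately show ?thesis using that[of "(S - bad) \<union> new"] new_state ok_state by auto
qed

definition good :: "('a \<Rightarrow> 'a) set" where
  "good = {F \<in> PiE U N. (\<forall>u\<in>U. indeg U F u \<le> c) \<and> (\<forall>u\<in>U. cyclic F u \<longrightarrow> card (into U F u) \<ge> s)}"

definition start :: "('a \<Rightarrow> 'a) set" where
  "start = {F \<in> PiE U N. (\<forall>u\<in>U. indeg U F u \<le> c) \<and> card (full F) \<le> d}"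

lemma finite_good: "finite good"
  using finite_PiE_N by (rule finite_subset[rotated]) (auto simp: good_def)

text \<open>The vertices are processed one at a time and the weighted count never drops. In the end
  a pair either has a good map, and all sets \<open>B\<close> together weigh
  \<open>(1 + \<theta>) ^ card U\<close>, or it has used up its \<open>m\<close> redirections, and
  such pairs are bounded trivially by means of their weight \<open>\<theta> ^ m\<close>.\<close>

lemma start_le_good:
  "real (card start) \<le> (1 + \<theta>) ^ card U * real (card good) + 2 ^ card U * \<theta> ^ m * real (card (PiE U N))"
proof -
  have "\<exists>S \<subseteq> state Z. real (card start) \<le> (\<Sum>(F,B)\<in>S. \<theta> ^ card B)" if "Z \<subseteq> U" for Z
    using finite_subset[OF that fin] that
  proof (induction Z rule: finite_induct)
    case empty
    have eq: "(\<Sum>(F,B)\<in>start \<times> {{}}. \<theta> ^ card B) = real (card start)"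
      by (simp add: sum.cartesian_product[symmetric])
    have st: "start \<times> {{}} \<subseteq> state {}" by (auto simp: start_def state_def)
    show ?case by (intro exI[of _ "start \<times> {{}}"] conjI st) (simp only: eq order_refl)
  next
    case (insert v Z)
    then obtain S where S: "S \<subseteq> state Z" "real (card start) \<le> (\<Sum>(F,B)\<in>S. \<theta> ^ card B)" by auto
    from step[OF _ _ _ S(1), of v] insert obtain S' where
      "S' \<subseteq> state (insert v Z)" "(\<Sum>(F,B)\<in>S. \<theta> ^ card B) \<le> (\<Sum>(F,B)\<in>S'. \<theta> ^ card B)" by auto
    then show ?case using S by (meson order_trans)
  qed
  from this[of U] obtain S where S: "S \<subseteq> state U" "real (card start) \<le> (\<Sum>(F,B)\<in>S. \<theta> ^ card B)" by auto
  have th0: "\<theta> \<ge> 0" by (simp add: \<theta>_def)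
  have finS: "finite S" using S finite_state finite_subset by blast
  have "S \<subseteq> good \<times> Pow U \<union> PiE U N \<times> {B \<in> Pow U. card B = m}"
    using S(1) by (fastforce simp: state_def good_def)
  then have "(\<Sum>(F,B)\<in>S. \<theta> ^ card B) \<le> (\<Sum>(F,B)\<in>good \<times> Pow U \<union> PiE U N \<times> {B \<in> Pow U. card B = m}. \<theta> ^ card B)"
    using th0 finite_good finite_PiE_N fin by (intro sum_mono2) auto
  also have "\<dots> \<le> (\<Sum>(F,B)\<in>good \<times> Pow U. \<theta> ^ card B) + (\<Sum>(F,B)\<in>PiE U N \<times> {B \<in> Pow U. card B = m}. \<theta> ^ card B)"
    using th0 finite_good finite_PiE_N fin by (subst sum_Un) (auto intro!: sum_nonneg)
  also have "(\<Sum>(F,B)\<in>good \<times> Pow U. \<theta> ^ card B) = real (card good) * (1 + \<theta>) ^ card U"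
    using fin by (simp add: sum.cartesian_product[symmetric] sum_Pow_card)
  also have "(\<Sum>(F,B)\<in>PiE U N \<times> {B \<in> Pow U. card B = m}. \<theta> ^ card B)
      = real (card (PiE U N)) * (real (card {B \<in> Pow U. card B = m}) * \<theta> ^ m)"
    by (simp add: sum.cartesian_product[symmetric])
  also have "\<dots> \<le> real (card (PiE U N)) * (2 ^ card U * \<theta> ^ m)"
  proof -
    have "card {B \<in> Pow U. card B = m} \<le> card (Pow U)" using fin by (intro card_mono) auto
    then have "real (card {B \<in> Pow U. card B = m}) \<le> 2 ^ card U" using fin
      by (metis card_Pow of_nat_le_iff of_nat_numeral of_nat_power)
    then show ?thesis using th0 by (intro mult_left_mono mult_right_mono) auto
  qed
  finally show ?thesis using S by (simp add: algebra_simps)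
qed

end

section \<open>From few cycles to forests\<close>

text \<open>One vertex per cycle: the choice depends only on the orbit as a set, which all vertices
  of a cycle share.\<close>

definition reps :: "'a set \<Rightarrow> ('a \<Rightarrow> 'a) \<Rightarrow> 'a set" where
  "reps U F = (\<lambda>u. SOME x. x \<in> range (\<lambda>l. (F ^^ l) u)) ` {u \<in> U. cyclic F u}"

lemma orbit_cyclic:
  assumes "cyclic F u" "(F ^^ a) u = x"
  shows "range (\<lambda>l. (F ^^ l) x) = range (\<lambda>l. (F ^^ l) u)"
proof -
  obtain j where j: "(F ^^ j) x = u" using cyclic_return[OF assms] by blast
  have 1: "(F ^^ l) x = (F ^^ (l + a)) u" for l using assms(2) by (simp add: funpow_add)
  have 2: "(F ^^ l) u = (F ^^ (l + j)) x" for l using j by (simp add: funpow_add)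
  show ?thesis
  proof (intro equalityI image_subsetI)
    fix l
    show "(F ^^ l) x \<in> range (\<lambda>l. (F ^^ l) u)" unfolding 1[of l] by blast
    show "(F ^^ l) u \<in> range (\<lambda>l. (F ^^ l) x)" unfolding 2[of l] by blast
  qed
qed

lemma reps_in_orbit:
  assumes "u \<in> U" "cyclic F u"
  shows "\<exists>l. (F ^^ l) u \<in> reps U F"
proof -
  have "(SOME x. x \<in> range (\<lambda>l. (F ^^ l) u)) \<in> range (\<lambda>l. (F ^^ l) u)"
    by (rule someI[of _ u]) (auto intro: range_eqI[of _ _ 0])
  then obtain l where l: "(SOME x. x \<in> range (\<lambda>l. (F ^^ l) u)) = (F ^^ l) u" by blast
  have "(SOME x. x \<in> range (\<lambda>l. (F ^^ l) u)) \<in> reps U F"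
    unfolding reps_def using assms by (intro imageI) simp
  then show ?thesis unfolding l ..
qed

lemma reps_cyclic:
  assumes "x \<in> reps U F" "\<And>v. v \<in> U \<Longrightarrow> F v \<in> U"
  shows "x \<in> U" "cyclic F x" "(SOME y. y \<in> range (\<lambda>l. (F ^^ l) x)) = x"
proof -
  obtain u where u: "u \<in> U" "cyclic F u" and x: "x = (SOME y. y \<in> range (\<lambda>l. (F ^^ l) u))"
    using assms by (auto simp: reps_def)
  have "x \<in> range (\<lambda>l. (F ^^ l) u)"
    unfolding x by (rule someI[of _ u]) (auto intro: range_eqI[of _ _ 0])
  then obtain l where l: "(F ^^ l) u = x" by auto
  show "x \<in> U" using l u funpow_in[of U F] assms by metis
  show "cyclic F x" using cyclic_orbit[OF u(2) l] .
  show "(SOME y. y \<in> range (\<lambda>l. (F ^^ l) x)) = x" using orbit_cyclic[OF u(2) l] x by simp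
qed

lemma funpow_diff: "a \<le> b \<Longrightarrow> (F ^^ (b - a)) ((F ^^ a) z) = (F ^^ b) z"
  using funpow_add[of "b - a" a F] by (simp add: fun_eq_iff)

text \<open>A vertex that reaches both \<open>x\<close> and \<open>y\<close> puts one of them on the
  orbit of the other, hence both on the same cycle.\<close>

lemma reps_disjoint:
  assumes "x \<in> reps U F" "y \<in> reps U F" "\<And>v. v \<in> U \<Longrightarrow> F v \<in> U" "x \<noteq> y"
  shows "into U F x \<inter> into U F y = {}"
proof (rule ccontr)
  have key: "x' = y'" if "x' \<in> reps U F" "y' \<in> reps U F" "(F ^^ a) z = x'" "(F ^^ b) z = y'" "a \<le> b" for x' y' a b z
  proof -
    have "(F ^^ (b - a)) x' = y'" using funpow_diff[OF that(5), of F z] that(3,4) by simp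
    then have "range (\<lambda>l. (F ^^ l) y') = range (\<lambda>l. (F ^^ l) x')"
      using orbit_cyclic[OF reps_cyclic(2)[OF that(1) assms(3)]] by blast
    then show ?thesis using reps_cyclic(3)[OF that(1) assms(3)] reps_cyclic(3)[OF that(2) assms(3)] by simp
  qed
  assume "into U F x \<inter> into U F y \<noteq> {}"
  then obtain z a b where z: "(F ^^ a) z = x" "(F ^^ b) z = y" by (auto simp: into_def)
  show False
  proof (cases "a \<le> b")
    case True then show False using key[OF assms(1,2) z] assms(4) by auto
  next
    case False then show False using key[OF assms(2,1) z(2,1)] assms(4) by auto
  qed
qed

lemma eventually_cyclic:
  assumes fin: "finite U" and F: "\<And>v. v \<in> U \<Longrightarrow> F v \<in> U" and u: "u \<in> U"
  shows "\<exists>i. (F ^^ i) u \<in> U \<and> cyclic F ((F ^^ i) u)"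
proof -
  have "\<not> inj (\<lambda>i. (F ^^ i) u)"
  proof
    assume "inj (\<lambda>i. (F ^^ i) u)"
    moreover have "range (\<lambda>i. (F ^^ i) u) \<subseteq> U" using funpow_in[of U F, OF F u] by auto
    ultimately have "finite (UNIV :: nat set)" using fin by (meson finite_imageD finite_subset)
    then show False by simp
  qed
  then obtain a b where ab: "a \<noteq> b" "(F ^^ a) u = (F ^^ b) u" by (auto simp: inj_def)
  obtain i j where ij: "i < j" "(F ^^ i) u = (F ^^ j) u"
  proof (cases "a < b")
    case True then show ?thesis using ab that by blast
  next
    case False then show ?thesis using ab that[of b a] by simp
  qed
  have "(F ^^ (j - i)) ((F ^^ i) u) = (F ^^ i) u" using funpow_diff[of i j F u] ij by simp
  then have "cyclic F ((F ^^ i) u)" using ij by (auto simp: cyclic_def intro!: exI[of _ "j - i"])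
  then show ?thesis using funpow_in[of U F, OF F u] by blast
qed

lemma card_reps:
  assumes fin: "finite U" and F: "\<And>v. v \<in> U \<Longrightarrow> F v \<in> U"
    and s: "\<And>u. u \<in> U \<Longrightarrow> cyclic F u \<Longrightarrow> s \<le> card (into U F u)"
  shows "finite (reps U F)" "card (reps U F) * s \<le> card U"
proof -
  show f: "finite (reps U F)" using fin by (simp add: reps_def)
  have "card (reps U F) * s = (\<Sum>x\<in>reps U F. s)" by simp
  also have "\<dots> \<le> (\<Sum>x\<in>reps U F. card (into U F x))"
    using s reps_cyclic[of _ U F] F by (intro sum_mono) auto
  also have "\<dots> = card (\<Union>x\<in>reps U F. into U F x)"
    using f fin reps_disjoint[of _ U F] F by (intro card_UN_disjoint[symmetric]) (auto simp: into_def)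
  also have "\<dots> \<le> card U" using fin by (intro card_mono) (auto simp: into_def)
  finally show "card (reps U F) * s \<le> card U" .
qed

text \<open>Values are chosen one after the other, and at most \<open>card R - 1\<close> of them are
  taken already; this is the \<open>+ 1\<close>, placed so as to avoid subtraction. With
  \<open>q = 1\<close> the lemma serves as an existence statement.\<close>

lemma card_inj_PiE_ge:
  assumes "finite R" "\<And>v. v \<in> R \<Longrightarrow> finite (C v)" "\<And>v. v \<in> R \<Longrightarrow> q + card R \<le> card (C v) + 1"
  shows "q ^ card R \<le> card {g \<in> PiE R C. inj_on g R}"
  using assms
proof (induction R rule: finite_induct)
  case (insert x R)
  let ?A = "{g \<in> PiE R C. inj_on g R}" and ?B = "{g \<in> PiE (insert x R) C. inj_on g (insert x R)}"
  have fA: "finite ?A" using insert by (intro finite_subset[OF _ finite_PiE[of R C]]) auto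
  have fB: "finite ?B" using insert by (intro finite_subset[OF _ finite_PiE[of "insert x R" C]]) auto
  let ?S = "SIGMA g:?A. C x - g ` R"
  have "q * card ?A \<le> card ?S"
  proof -
    have "q \<le> card (C x - g ` R)" if "g \<in> ?A" for g
    proof -
      have "card (g ` R) \<le> card R" using insert by (intro card_image_le)
      then show ?thesis using insert.prems(2)[of x] insert.hyps diff_card_le_card_Diff[of "g ` R" "C x"] by simp
    qed
    then have "(\<Sum>g\<in>?A. q) \<le> (\<Sum>g\<in>?A. card (C x - g ` R))" by (intro sum_mono) auto
    then show ?thesis using fA insert.prems by (simp add: card_SigmaI mult.commute)
  qed
  also have "card ?S \<le> card ?B"
  proof (rule card_inj_on_le[of "\<lambda>(g, y). g(x := y)"])
    show "inj_on (\<lambda>(g, y). g(x := y)) ?S"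
    proof (rule inj_onI, clarify)
      fix g y g' y' assume g: "g \<in> PiE R C" "g' \<in> PiE R C" and eq: "g(x := y) = g'(x := y')"
      have "g x = undefined" "g' x = undefined" using g insert.hyps by (auto dest: PiE_arb)
      moreover have "(g(x := y))(x := undefined) = (g'(x := y'))(x := undefined)" by (simp only: eq)
      ultimately have "g = g'" by (metis fun_upd_triv fun_upd_upd)
      moreover have "y = y'" using fun_cong[OF eq, of x] by simp
      ultimately show "g = g' \<and> y = y'" by simp
    qed
    show "(\<lambda>(g, y). g(x := y)) ` ?S \<subseteq> ?B"
    proof (clarify, intro conjI)
      fix g y assume g: "g \<in> PiE R C" "inj_on g R" and y: "y \<in> C x" "y \<notin> g ` R"
      show "g(x := y) \<in> PiE (insert x R) C" using g y by (intro PiE_fun_upd)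
      have eq: "(g(x := y)) ` R = g ` R" using insert.hyps by auto
      have "inj_on (g(x := y)) R" using g y by (intro inj_on_fun_updI) auto
      then show "inj_on (g(x := y)) (insert x R)"
        unfolding inj_on_insert using insert.hyps y eq by simp
    qed
  qed (use fB in auto)
  finally have "q * card ?A \<le> card ?B" .
  moreover have "q ^ card R \<le> card ?A"
    using insert.prems insert.hyps by (intro insert.IH) force+
  ultimately show ?case using insert.hyps
    by (simp add: order_trans[OF mult_le_mono2])
qed auto

text \<open>The rooted forests on \<open>U\<close> whose roots are attached to distinct elements of \<open>A\<close>, coded by
  their parent maps; acyclicity is witnessed by a rank.\<close>

definition attached_forests :: "'a set \<Rightarrow> ('a \<Rightarrow> 'a set) \<Rightarrow> 'a set \<Rightarrow> ('a \<Rightarrow> 'a set) \<Rightarrow> nat \<Rightarrow> ('a \<Rightarrow> 'a) set" where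
  "attached_forests U N A NA c = {H \<in> PiE U (\<lambda>v. N v \<union> NA v). (\<forall>u\<in>U. indeg U H u \<le> c) \<and>
     inj_on H {v \<in> U. H v \<in> A} \<and> (\<exists>d :: 'a \<Rightarrow> nat. \<forall>v\<in>U. d (H v) < d v)}"

context redirection
begin

text \<open>The cycles lie in disjoint sets of size at least \<open>s\<close>, so there are at most
  \<open>M\<close> of them. Each is cut at its representative, which is sent to an element of
  \<open>A\<close> of its own.\<close>

lemma attach_reps:
  assumes F: "F \<in> good" and AU: "A \<inter> U = {}" and NA: "\<And>v. v \<in> U \<Longrightarrow> NA v \<subseteq> A \<and> finite (NA v)"
    and M: "card U < s * Suc M" "\<And>v. v \<in> U \<Longrightarrow> M \<le> card (NA v)"
  obtains H where "H \<in> attached_forests U N A NA c" "\<And>v. v \<in> U \<Longrightarrow> H v \<notin> A \<Longrightarrow> F v = H v"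
    "card {v \<in> U. H v \<in> A} \<le> M"
proof -
  have FP: "F \<in> PiE U N" using F by (simp add: good_def)
  then have FU: "F v \<in> U" if "v \<in> U" for v using N that by blast
  define R where "R = reps U F"
  have RU: "R \<subseteq> U" using reps_cyclic(1)[of _ U F] FU by (auto simp: R_def)
  have fR: "finite R" and "card R * s \<le> card U"
    using card_reps[OF fin FU, where s = s] F by (auto simp: R_def good_def)
  then have "s * card R < s * Suc M" using M(1) by (simp add: mult.commute)
  then have RM: "card R \<le> M" by (metis less_Suc_eq_le nat_mult_less_cancel_disj)
  have "1 ^ card R \<le> card {g \<in> PiE R NA. inj_on g R}"
  proof (rule card_inj_PiE_ge[OF fR])
    fix v assume "v \<in> R" then show "finite (NA v)" "1 + card R \<le> card (NA v) + 1"
      using NA[of v] M(2)[of v] RM RU by auto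
  qed
  then have "{g \<in> PiE R NA. inj_on g R} \<noteq> {}" by (metis card.empty not_one_le_zero power_one)
  then obtain g where g: "g \<in> PiE R NA" "inj_on g R" by auto
  define H where "H = (\<lambda>v. if v \<in> R then g v else F v)"
  have gA: "g v \<in> A" "g v \<in> NA v" if "v \<in> R" for v using g NA RU that by blast+
  have HA: "{v \<in> U. H v \<in> A} = R"
    using gA RU FU AU by (auto simp: H_def)
  have "H \<in> PiE U (\<lambda>v. N v \<union> NA v)"
    using FP gA RU by (auto simp: H_def PiE_def extensional_def)
  moreover have "indeg U H u \<le> c" if u: "u \<in> U" for u
  proof -
    have "indeg U H u \<le> indeg U F u" unfolding indeg_def
      using gA AU u fin by (intro card_mono) (auto simp: H_def split: if_splits)
    then show ?thesis using F u by (auto simp: good_def intro: order_trans)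
  qed
  moreover have "inj_on H {v \<in> U. H v \<in> A}" unfolding HA using g(2) by (auto simp: H_def inj_on_def)
  moreover have "\<exists>d :: 'a \<Rightarrow> nat. \<forall>v\<in>U. d (H v) < d v"
  proof -
    \<comment> \<open>The rank is one more than the number of steps to the first representative. It
      is 0 outside \<open>U\<close>, so the rank also drops where a representative is sent into
      \<open>A\<close>.\<close>
    define d where "d = (\<lambda>v. if v \<in> U then Suc (LEAST l. (F ^^ l) v \<in> R) else 0)"
    have ex: "\<exists>l. (F ^^ l) v \<in> R" if v: "v \<in> U" for v
    proof -
      obtain i where i: "(F ^^ i) v \<in> U" "cyclic F ((F ^^ i) v)"
        using eventually_cyclic[where F = F, OF fin FU v] by blast
      obtain l where "(F ^^ l) ((F ^^ i) v) \<in> R" using reps_in_orbit[OF i] by (auto simp: R_def)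
      then show ?thesis by (metis comp_apply funpow_add)
    qed
    have "d (H v) < d v" if v: "v \<in> U" for v
    proof (cases "v \<in> R")
      case True
      then have "H v \<notin> U" using gA AU by (auto simp: H_def)
      then show ?thesis using v by (simp add: d_def)
    next
      case False
      obtain l where "(F ^^ l) v \<in> R" using ex[OF v] ..
      then have "(LEAST l. (F ^^ l) v \<in> R) = Suc (LEAST l. (F ^^ Suc l) v \<in> R)"
        using False by (intro Least_Suc) auto
      then show ?thesis using v False FU[OF v] by (simp add: d_def H_def funpow_swap1)
    qed
    then show ?thesis by blast
  qed
  ultimately have "H \<in> attached_forests U N A NA c" by (simp add: attached_forests_def)
  moreover have "F v = H v" if "v \<in> U" "H v \<notin> A" for v
    using that gA by (auto simp: H_def split: if_splits)
  ultimately show ?thesis using that[of H] HA RM by auto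
qed

text \<open>Passing from \<open>F\<close> to \<open>H\<close> forgets only the values of
  \<open>F\<close> at the at most \<open>M\<close> vertices that \<open>H\<close> sends into
  \<open>A\<close>.\<close>

lemma card_good_le:
  assumes AU: "A \<inter> U = {}" and NA: "\<And>v. v \<in> U \<Longrightarrow> NA v \<subseteq> A \<and> finite (NA v)"
    and M: "card U < s * Suc M" "\<And>v. v \<in> U \<Longrightarrow> M \<le> card (NA v)"
    and r: "\<And>v. v \<in> U \<Longrightarrow> card (N v) \<le> r" "r \<ge> 1"
  shows "card good \<le> card (attached_forests U N A NA c) * r ^ M"
proof -
  let ?AF = "attached_forests U N A NA c"
  have fN: "finite (N v)" if "v \<in> U" for v using finite_subset[OF N[OF that] fin] .
  have "finite (PiE U (\<lambda>v. N v \<union> NA v))" using fin fN NA by (intro finite_PiE) auto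
  then have fAF: "finite ?AF" by (rule finite_subset[rotated]) (simp add: attached_forests_def Collect_mono)
  have "\<forall>F\<in>good. \<exists>H. H \<in> ?AF \<and> (\<forall>v\<in>U. H v \<notin> A \<longrightarrow> F v = H v) \<and> card {v \<in> U. H v \<in> A} \<le> M"
  proof
    fix F assume F: "F \<in> good"
    show "\<exists>H. H \<in> ?AF \<and> (\<forall>v\<in>U. H v \<notin> A \<longrightarrow> F v = H v) \<and> card {v \<in> U. H v \<in> A} \<le> M"
      by (rule attach_reps[OF F AU NA M]) blast+
  qed
  then obtain h where h: "\<And>F. F \<in> good \<Longrightarrow> h F \<in> ?AF \<and> (\<forall>v\<in>U. h F v \<notin> A \<longrightarrow> F v = h F v) \<and> card {v \<in> U. h F v \<in> A} \<le> M"
    by metis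
  have fib: "card {F \<in> good. h F = H} \<le> r ^ M" for H
  proof (cases "\<exists>F \<in> good. h F = H")
    case True
    let ?R = "{v \<in> U. H v \<in> A}"
    have RM: "card ?R \<le> M" using True h by auto
    have fP: "finite (PiE ?R N)" using fin fN by (intro finite_PiE) auto
    have "card {F \<in> good. h F = H} \<le> card (PiE ?R N)"
    proof (rule card_inj_on_le[of "\<lambda>F. restrict F ?R"])
      show "inj_on (\<lambda>F. restrict F ?R) {F \<in> good. h F = H}"
      proof (rule inj_onI)
        fix F G assume F: "F \<in> {F \<in> good. h F = H}" and G: "G \<in> {F \<in> good. h F = H}"
          and eq: "restrict F ?R = restrict G ?R"
        show "F = G"
        proof
          fix x
          consider "x \<notin> U" | "x \<in> ?R" | "x \<in> U" "H x \<notin> A" by auto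
          then show "F x = G x"
          proof cases
            case 1
            have "F \<in> PiE U N" "G \<in> PiE U N" using F G by (auto simp: good_def)
            then show ?thesis using PiE_arb[OF _ 1] by metis
          next
            case 2 then show ?thesis using fun_cong[OF eq, of x] by simp
          next
            case 3
            have FG: "F \<in> good" "G \<in> good" "h F = H" "h G = H" using F G by auto
            have "\<forall>v\<in>U. H v \<notin> A \<longrightarrow> F v = H v" "\<forall>v\<in>U. H v \<notin> A \<longrightarrow> G v = H v"
              using h[OF FG(1)] h[OF FG(2)] FG(3,4) by simp_all
            then show ?thesis using 3 by simp
          qed
        qed
      qed
      show "(\<lambda>F. restrict F ?R) ` {F \<in> good. h F = H} \<subseteq> PiE ?R N"
      proof (rule image_subsetI)
        fix F assume "F \<in> {F \<in> good. h F = H}"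
        then have "F \<in> PiE U N" by (simp add: good_def)
        then show "restrict F ?R \<in> PiE ?R N" unfolding restrict_PiE_iff by (auto dest: PiE_mem)
      qed
    qed (rule fP)
    also have "card (PiE ?R N) = (\<Prod>v\<in>?R. card (N v))" using fin by (intro card_PiE) auto
    also have "\<dots> \<le> (\<Prod>v\<in>?R. r)" using r by (intro prod_mono) auto
    also have "\<dots> \<le> r ^ M" using RM r by (simp add: power_increasing)
    finally show ?thesis .
  next
    case False
    then have eq: "{F \<in> good. h F = H} = {}" by auto
    show ?thesis unfolding eq by simp
  qed
  have "good \<subseteq> (\<Union>H\<in>?AF. {F \<in> good. h F = H})"
  proof
    fix F assume F: "F \<in> good"
    have "h F \<in> ?AF" using h[OF F] by (rule conjunct1)
    then show "F \<in> (\<Union>H\<in>?AF. {F \<in> good. h F = H})" using F by (intro UN_I[of "h F"]) simp_all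
  qed
  then have "card good \<le> card (\<Union>H\<in>?AF. {F \<in> good. h F = H})"
    by (rule card_mono[rotated]) (rule finite_UN_I[OF fAF], rule finite_subset[OF _ finite_good], rule Collect_restrict)
  also have "\<dots> \<le> (\<Sum>H\<in>?AF. card {F \<in> good. h F = H})" by (rule card_UN_le[OF fAF])
  also have "\<dots> \<le> (\<Sum>H\<in>?AF. r ^ M)" using fib by (intro sum_mono)
  finally show ?thesis by simp
qed

end

section \<open>From parent maps to spanning trees of bounded degree\<close>

definition forest_edges :: "'a set \<Rightarrow> ('a \<Rightarrow> 'a) \<Rightarrow> 'a set set" where
  "forest_edges U H = (\<lambda>v. {v, H v}) ` U"

text \<open>A vertex of maximal rank is nobody's parent, hence it can be attached last, as a
  leaf.\<close>

lemma tree_graph_attach: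
  assumes K: "tree_graph X K" and fin: "finite Y" and YX: "Y \<inter> X = {}"
    and cl: "\<And>v. v \<in> Y \<Longrightarrow> H v \<in> Y \<union> X" and d: "\<And>v. v \<in> Y \<Longrightarrow> d (H v) < (d v :: nat)"
  shows "tree_graph (X \<union> Y) (K \<union> forest_edges Y H)"
  using fin YX cl d
proof (induction "card Y" arbitrary: Y)
  case 0
  then show ?case using K by (simp add: forest_edges_def)
next
  case (Suc n)
  have ne: "d ` Y \<noteq> {}" "finite (d ` Y)" using Suc by auto
  obtain y where y: "y \<in> Y" "d y = Max (d ` Y)" using Max_in[OF ne(2,1)] by auto
  have max: "d z \<le> d y" if "z \<in> Y" for z using y that ne by simp
  have Hy: "H z \<noteq> y" if "z \<in> Y" for z using Suc.prems(4)[OF that] max[OF that] by auto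
  let ?Z = "Y - {y}"
  have "tree_graph (X \<union> ?Z) (K \<union> forest_edges ?Z H)"
  proof (rule Suc.hyps(1))
    show "n = card ?Z" using Suc.hyps(2) Suc.prems(1) y by simp
    fix v assume "v \<in> ?Z" then show "H v \<in> ?Z \<union> X" using Hy[of v] Suc.prems(3)[of v] by auto
  qed (use Suc.prems in auto)
  moreover have "H y \<in> X \<union> ?Z" using Suc.prems(3)[OF y(1)] Hy[OF y(1)] by auto
  ultimately have "tree_graph (insert y (X \<union> ?Z)) (insert {H y, y} (K \<union> forest_edges ?Z H))"
    using y Suc.prems(2) by (intro tree_graph_pendant) auto
  moreover have "insert y (X \<union> ?Z) = X \<union> Y" using y by auto
  moreover have "insert {H y, y} (K \<union> forest_edges ?Z H) = K \<union> forest_edges Y H"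
    using y by (auto simp: forest_edges_def insert_commute)
  ultimately show ?case by simp
qed

text \<open>If the edge from \<open>v\<close> to \<open>H v\<close> came from the other end, then
  \<open>H'\<close> would send \<open>H v\<close> to \<open>v\<close>. As \<open>H v\<close> has
  smaller rank, \<open>H\<close> would do the same by induction, and the rank would drop along a
  2-cycle. No rank is assumed for \<open>H'\<close>.\<close>

lemma forest_edges_inj:
  assumes H: "\<And>v. v \<in> U \<Longrightarrow> H v \<in> U \<union> A" and AU: "A \<inter> U = {}"
    and d: "\<And>v. v \<in> U \<Longrightarrow> d (H v) < (d v :: nat)"
    and eq: "forest_edges U H = forest_edges U H'" and v: "v \<in> U"
  shows "H' v = H v"
  using v
proof (induction "d v" arbitrary: v rule: less_induct)
  case less
  have "{v, H v} \<in> forest_edges U H'" using less.prems eq by (auto simp: forest_edges_def)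
  then obtain w where w: "w \<in> U" "{v, H v} = {w, H' w}" by (auto simp: forest_edges_def)
  show ?case
  proof (cases "w = v")
    case True then show ?thesis using w by (auto simp: doubleton_eq_iff)
  next
    case False
    then have w': "w = H v" "H' w = v" using w by (auto simp: doubleton_eq_iff)
    have "d w < d v" using d[OF less.prems] w' by simp
    then have "H w = v" using less.hyps[of w] w w' by simp
    then show ?thesis using d[OF w(1)] \<open>d w < d v\<close> by simp
  qed
qed

text \<open>A vertex outside \<open>X\<close> has its own edge and at most \<open>k - 1\<close>
  incoming ones; a vertex of \<open>A\<close> gains at most one edge because \<open>H\<close> is
  injective on the roots; the rest of \<open>X\<close> gains none.\<close>

lemma card_attached_forests_le:
  assumes G: "simple_graph V E" and X: "X \<subseteq> V" "K \<subseteq> E" "tree_graph X K" "A \<subseteq> X" and k: "k \<ge> 1"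
    and deg: "\<And>x. x \<in> X \<Longrightarrow> graph_degree K x \<le> k" "\<And>x. x \<in> A \<Longrightarrow> Suc (graph_degree K x) \<le> k"
    and N: "\<And>v. v \<in> V - X \<Longrightarrow> N v \<subseteq> nbrs E v - X" "\<And>v. v \<in> V - X \<Longrightarrow> NA v \<subseteq> nbrs E v \<inter> A"
  shows "card (attached_forests (V - X) N A NA (k - 1)) \<le> bounded_tree_count k V E"
proof -
  define U where "U = V - X"
  let ?AF = "attached_forests U N A NA (k - 1)"
  have finV: "finite V" using G by (simp add: simple_graph_def)
  then have finU: "finite U" by (simp add: U_def)
  have AU: "A \<inter> U = {}" using X by (auto simp: U_def)
  have H: "H v \<in> U \<union> A" "{v, H v} \<in> E" if "H \<in> ?AF" "v \<in> U" for H v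
  proof -
    have "H v \<in> N v \<union> NA v" using that by (auto simp: attached_forests_def)
    then have "H v \<in> nbrs E v" "H v \<notin> X \<or> H v \<in> A" using N[of v] that by (auto simp: U_def)
    then show "H v \<in> U \<union> A" "{v, H v} \<in> E" using nbrs_subset[OF G, of v] by (auto simp: U_def nbrs_def)
  qed
  have KX: "e \<subseteq> X" if "e \<in> K" for e using that X by (auto simp: tree_graph_def simple_graph_def)
  have finK: "finite K" using X by (auto simp: tree_graph_def intro: finite_edges)
  let ?T = "\<lambda>H. K \<union> forest_edges U H"
  have "inj_on ?T ?AF"
  proof (rule inj_onI)
    fix H H' assume HH: "H \<in> ?AF" "H' \<in> ?AF" and eq: "?T H = ?T H'"
    \<comment> \<open>Each forest edge has an end outside \<open>X\<close>, so the tree determines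
      which of its edges come from \<open>K\<close>.\<close>
    have nK: "forest_edges U H'' \<inter> K = {}" for H'' using KX by (fastforce simp: forest_edges_def U_def)
    then have eq': "forest_edges U H = forest_edges U H'" using eq by blast
    have "\<exists>d :: 'a \<Rightarrow> nat. \<forall>v\<in>U. d (H v) < d v"
      using HH by (simp add: attached_forests_def)
    then obtain d :: "'a \<Rightarrow> nat" where d: "\<And>v. v \<in> U \<Longrightarrow> d (H v) < d v" by blast
    show "H = H'"
    proof
      fix x
      show "H x = H' x"
      proof (cases "x \<in> U")
        case True
        then show ?thesis using forest_edges_inj[where H = H and d = d and A = A, OF H(1)[OF HH(1)] AU d eq'] by simp
      next
        case False
        have "H \<in> PiE U (\<lambda>v. N v \<union> NA v)" "H' \<in> PiE U (\<lambda>v. N v \<union> NA v)"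
          using HH by (auto simp: attached_forests_def)
        then show ?thesis using PiE_arb[OF _ False] by metis
      qed
    qed
  qed
  moreover have "?T ` ?AF \<subseteq> {T \<in> spanning_trees V E. \<forall>v\<in>V. graph_degree T v \<le> k}"
  proof (rule image_subsetI, rule CollectI, intro conjI ballI)
    fix H assume HA: "H \<in> ?AF"
    obtain d :: "'a \<Rightarrow> nat" where d: "\<And>v. v \<in> U \<Longrightarrow> d (H v) < d v"
      using HA by (auto simp: attached_forests_def)
    have "tree_graph (X \<union> U) (?T H)"
    proof (rule tree_graph_attach[where d = d, OF X(3) finU])
      fix v assume "v \<in> U"
      then show "H v \<in> U \<union> X" using H(1)[OF HA, of v] X(4) by blast
    qed (auto simp: U_def intro: d[unfolded U_def])
    moreover have "X \<union> U = V" using X by (auto simp: U_def)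
    moreover have "?T H \<subseteq> E" using X H(2)[OF HA] by (auto simp: forest_edges_def)
    ultimately show "?T H \<in> spanning_trees V E" by (simp add: spanning_trees_def)
    fix v assume v: "v \<in> V"
    have fin: "finite {w \<in> U. H w = v}" using finU by simp
    have ci: "card ((\<lambda>w. {w, H w}) ` {w \<in> U. H w = v}) \<le> indeg U H v"
      unfolding indeg_def by (rule card_image_le[OF fin])
    show "graph_degree (?T H) v \<le> k"
    proof (cases "v \<in> U")
      case True
      have "{e \<in> ?T H. v \<in> e} \<subseteq> insert {v, H v} ((\<lambda>w. {w, H w}) ` {w \<in> U. H w = v})"
        using KX True by (auto simp: forest_edges_def U_def)
      then have "graph_degree (?T H) v \<le> card (insert {v, H v} ((\<lambda>w. {w, H w}) ` {w \<in> U. H w = v}))"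
        unfolding graph_degree_def using fin by (intro card_mono) auto
      also have "\<dots> \<le> Suc (card ((\<lambda>w. {w, H w}) ` {w \<in> U. H w = v}))" by (rule card_insert_le_m1) auto
      also have "\<dots> \<le> Suc (k - 1)" using ci True HA by (auto simp: attached_forests_def intro: order_trans)
      finally show ?thesis using k by simp
    next
      case False
      then have vX: "v \<in> X" using v by (auto simp: U_def)
      have "{e \<in> ?T H. v \<in> e} \<subseteq> {e \<in> K. v \<in> e} \<union> (\<lambda>w. {w, H w}) ` {w \<in> U. H w = v}"
        using False by (auto simp: forest_edges_def)
      then have "graph_degree (?T H) v \<le> card ({e \<in> K. v \<in> e} \<union> (\<lambda>w. {w, H w}) ` {w \<in> U. H w = v})"
        unfolding graph_degree_def using fin finK by (intro card_mono) auto
      also have "\<dots> \<le> graph_degree K v + indeg U H v"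
        unfolding graph_degree_def using ci by (intro order_trans[OF card_Un_le]) simp
      finally have le: "graph_degree (?T H) v \<le> graph_degree K v + indeg U H v" .
      show ?thesis
      proof (cases "v \<in> A")
        case True
        have "inj_on H {w \<in> U. H w \<in> A}" using HA by (simp add: attached_forests_def)
        then have "inj_on H {w \<in> U. H w = v}" using True by (auto intro: inj_on_subset)
        then have "indeg U H v = card (H ` {w \<in> U. H w = v})" unfolding indeg_def by (simp only: card_image)
        also have "\<dots> \<le> card {v}" by (intro card_mono) auto
        finally show ?thesis using le deg(2)[OF True] by simp
      next
        case nA: False
        have "{w \<in> U. H w = v} = {}" using H(1)[OF HA] False nA by auto
        then have "indeg U H v = 0" unfolding indeg_def by (simp only: card.empty)
        then show ?thesis using le deg(1)[OF vX] by simp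
      qed
    qed
  qed
  moreover have "finite {T \<in> spanning_trees V E. \<forall>v\<in>V. graph_degree T v \<le> k}"
    by (rule finite_subset[of _ "Pow E"]) (use finite_edges[OF G] in \<open>auto simp: spanning_trees_def\<close>)
  ultimately have "card ?AF \<le> card {T \<in> spanning_trees V E. \<forall>v\<in>V. graph_degree T v \<le> k}"
    by (rule card_inj_on_le)
  then show ?thesis by (simp add: bounded_tree_count_def U_def)
qed

section \<open>Partial choices of bounded in-degree\<close>

text \<open>\<open>D\<close> is the set of vertices whose value has been dropped. Its size is fixed
  exactly, so that all partial maps have the same guaranteed number of completions.\<close>

definition partials :: "'a set \<Rightarrow> ('a \<Rightarrow> 'a set) \<Rightarrow> nat \<Rightarrow> nat \<Rightarrow> ('a set \<times> ('a \<Rightarrow> 'a)) set" where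
  "partials U N j d = {(D, f). D \<subseteq> U \<and> card D = d \<and> f \<in> PiE (U - D) N \<and> (\<forall>u\<in>U. indeg (U - D) f u \<le> j)}"

lemma finite_partials:
  assumes "finite U" "\<And>v. v \<in> U \<Longrightarrow> finite (N v)"
  shows "finite (partials U N j d)"
proof -
  have "finite (SIGMA D:Pow U. PiE (U - D) N)"
    using assms by (intro finite_SigmaI finite_PiE) auto
  then show ?thesis by (rule finite_subset[rotated]) (auto simp: partials_def)
qed

text \<open>Filling \<open>D\<close> injectively raises in-degrees by at most one, and only the
  \<open>d\<close> new values can reach the cap \<open>Suc j\<close>. A completed map together with
  \<open>D\<close> reveals the partial map, whence the binomial coefficient.\<close>

lemma partials_le_start:
  assumes "redirection U N d m s h" and q: "\<And>v. v \<in> U \<Longrightarrow> q + d \<le> card (N v) + 1"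
  shows "card (partials U N j d) * q ^ d \<le> card (redirection.start U N (Suc j) d) * (card U choose d)"
proof -
  interpret redirection U N "Suc j" d m s h by (rule assms)
  have fN: "finite (N v)" if "v \<in> U" for v using finite_subset[OF N[OF that] fin] .
  define P where "P = partials U N j d"
  have fP: "finite P" unfolding P_def by (rule finite_partials) (use fin fN in auto)
  define I where "I = (\<lambda>D. {g \<in> PiE D N. inj_on g D})"
  have fI: "finite (I D)" if "D \<subseteq> U" for D
  proof -
    have "finite (PiE D N)" using that fN finite_subset[OF that fin] by (intro finite_PiE) auto
    then show ?thesis by (rule finite_subset[rotated]) (auto simp: I_def)
  qed
  have cI: "q ^ d \<le> card (I (fst x))" if "x \<in> P" for x
  proof -
    have x: "fst x \<subseteq> U" "card (fst x) = d" using that by (auto simp: P_def partials_def)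
    have "q ^ card (fst x) \<le> card {g \<in> PiE (fst x) N. inj_on g (fst x)}"
      using x fN q finite_subset[OF x(1) fin] by (intro card_inj_PiE_ge) auto
    then show ?thesis using x by (simp add: I_def)
  qed
  let ?S = "SIGMA x:P. I (fst x)"
  let ?m = "\<lambda>((D, f), g). (\<lambda>v. if v \<in> D then g v else f v, D)"
  have "card P * q ^ d = (\<Sum>x\<in>P. q ^ d)" by simp
  also have "\<dots> \<le> (\<Sum>x\<in>P. card (I (fst x)))" using cI by (rule sum_mono)
  also have "\<dots> = card ?S" using fP fI by (intro card_SigmaI[symmetric]) (auto simp: P_def partials_def)
  also have "\<dots> \<le> card (start \<times> {D. D \<subseteq> U \<and> card D = d})"
  proof (rule card_inj_on_le)
    show "inj_on ?m ?S"
    proof (rule inj_onI)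
      fix x y assume x: "x \<in> ?S" and y: "y \<in> ?S" and m: "?m x = ?m y"
      obtain D f g where xD: "x = ((D, f), g)" by (metis surj_pair)
      obtain D' f' g' where yD: "y = ((D', f'), g')" by (metis surj_pair)
      have f: "(D, f) \<in> P" "(D', f') \<in> P" and g: "g \<in> I D" "g' \<in> I D'"
        using x y xD yD by auto
      have D: "D = D'" and eq: "(\<lambda>v. if v \<in> D then g v else f v) = (\<lambda>v. if v \<in> D' then g' v else f' v)"
        using m xD yD by auto
      have e: "f \<in> PiE (U - D) N" "f' \<in> PiE (U - D) N" "g \<in> PiE D N" "g' \<in> PiE D N"
        using f g D by (auto simp: P_def partials_def I_def)
      have "f v = f' v" for v
      proof (cases "v \<in> D")
        case True then show ?thesis using PiE_arb[OF e(1), of v] PiE_arb[OF e(2), of v] by simp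
      next
        case False then show ?thesis using fun_cong[OF eq, of v] D by simp
      qed
      moreover have "g v = g' v" for v
      proof (cases "v \<in> D")
        case False then show ?thesis using PiE_arb[OF e(3), of v] PiE_arb[OF e(4), of v] by simp
      next
        case True then show ?thesis using fun_cong[OF eq, of v] D by simp
      qed
      ultimately show "x = y" using D xD yD by (simp add: fun_eq_iff)
    qed
    show "?m ` ?S \<subseteq> start \<times> {D. D \<subseteq> U \<and> card D = d}"
    proof (rule image_subsetI)
      fix x assume x: "x \<in> ?S"
      obtain D f g where xD: "x = ((D, f), g)" by (metis surj_pair)
      have f: "(D, f) \<in> P" and g: "g \<in> I D" using x xD by auto
      have D: "D \<subseteq> U" "card D = d" and fP: "f \<in> PiE (U - D) N" and dg: "\<And>u. u \<in> U \<Longrightarrow> indeg (U - D) f u \<le> j"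
        using f by (auto simp: P_def partials_def)
      have gP: "g \<in> PiE D N" "inj_on g D" using g by (auto simp: I_def)
      have fD: "finite D" using finite_subset[OF D(1) fin] .
      let ?F = "\<lambda>v. if v \<in> D then g v else f v"
      have "?F \<in> PiE U N" using fP gP D by (auto simp: PiE_def Pi_def extensional_def)
      moreover have le: "indeg U ?F u \<le> indeg (U - D) f u + (if u \<in> g ` D then 1 else 0)" for u
      proof -
        have "{v \<in> U. ?F v = u} = {v \<in> U - D. f v = u} \<union> {v \<in> D. g v = u}" using D by auto
        then have "indeg U ?F u \<le> indeg (U - D) f u + card {v \<in> D. g v = u}"
          unfolding indeg_def by (metis card_Un_le)
        moreover have "card {v \<in> D. g v = u} \<le> (if u \<in> g ` D then 1 else 0)"
        proof (cases "u \<in> g ` D")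
          case True
          then obtain x where "x \<in> D" "u = g x" by auto
          then have "{v \<in> D. g v = u} = {x}" using gP(2) by (auto simp: inj_on_def)
          then show ?thesis using True by simp
        next
          case False then have "{v \<in> D. g v = u} = {}" by auto
          then show ?thesis by (metis card.empty le0)
        qed
        ultimately show ?thesis by linarith
      qed
      moreover have "indeg U ?F u \<le> Suc j" if "u \<in> U" for u
        using le[of u] dg[OF that] by (auto split: if_splits)
      moreover have "card (full ?F) \<le> d"
      proof -
        have "full ?F \<subseteq> g ` D"
        proof
          fix u assume "u \<in> full ?F"
          then have "u \<in> U" "Suc j \<le> indeg U ?F u" by (auto simp: full_def)
          then show "u \<in> g ` D" using le[of u] dg[of u] by (auto split: if_splits)
        qed
        then have "card (full ?F) \<le> card (g ` D)" using fD by (intro card_mono) auto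
        also have "\<dots> \<le> d" using card_image_le[OF fD, of g] D by simp
        finally show ?thesis .
      qed
      ultimately have "?F \<in> start" by (simp add: start_def)
      then show "?m x \<in> start \<times> {D. D \<subseteq> U \<and> card D = d}" using D xD by simp
    qed
    have "finite start" using finite_PiE_N by (rule finite_subset[rotated]) (auto simp: start_def)
    then show "finite (start \<times> {D. D \<subseteq> U \<and> card D = d})"
      using fin by auto
  qed
  also have "\<dots> = card start * (card U choose d)" using n_subsets[OF fin] by (simp add: card_cartesian_product)
  finally show ?thesis by (simp add: P_def)
qed

section \<open>Proposals and the partial maps selected from them\<close>

definition configs :: "'a set \<Rightarrow> ('a \<Rightarrow> 'a set) \<Rightarrow> nat \<Rightarrow> ('a \<Rightarrow> nat \<Rightarrow> 'a) set" where
  "configs V N t = PiE V (\<lambda>v. PiE {..<t} (\<lambda>_. N v))"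

text \<open>Shared by both regimes: with \<open>t = 1\<close> the values are forced and
  \<open>D\<close> collects the surplus of a random map, while for \<open>t = 10\<close> and
  \<open>j = 1\<close> this is a matching with at most \<open>d\<close> unmatched vertices.\<close>

definition solvable :: "'a set \<Rightarrow> nat \<Rightarrow> nat \<Rightarrow> nat \<Rightarrow> ('a \<Rightarrow> nat \<Rightarrow> 'a) \<Rightarrow> bool" where
  "solvable V t j d h \<longleftrightarrow> (\<exists>D f. D \<subseteq> V \<and> card D \<le> d \<and> (\<forall>v\<in>V - D. \<exists>i<t. f v = h v i) \<and>
     (\<forall>u. indeg (V - D) f u \<le> j))"

lemma card_PiE_hit:
  assumes S: "finite S" "x \<in> S"
  shows "card {a \<in> PiE {..<t} (\<lambda>_. S). \<exists>i<t. a i = x} \<le> t * card S ^ (t - 1)"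
proof -
  have fin: "finite (PiE {..<t} (\<lambda>_. S))" using S by (intro finite_PiE) auto
  have eq: "{a \<in> PiE {..<t} (\<lambda>_. S). \<exists>i<t. a i = x} = (\<Union>i\<in>{..<t}. {a \<in> PiE {..<t} (\<lambda>_. S). a i = x})"
    by auto
  have "card {a \<in> PiE {..<t} (\<lambda>_. S). \<exists>i<t. a i = x} \<le> (\<Sum>i\<in>{..<t}. card {a \<in> PiE {..<t} (\<lambda>_. S). a i = x})"
    unfolding eq by (rule card_UN_le) simp
  also have "\<dots> \<le> (\<Sum>i\<in>{..<t}. card S ^ (t - 1))"
  proof (rule sum_mono)
    fix i assume i: "i \<in> {..<t}"
    have "{a \<in> PiE {..<t} (\<lambda>_. S). a i = x} \<subseteq> PiE {..<t} (\<lambda>k. if k = i then {x} else S)"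
      by (auto simp: PiE_def Pi_def)
    then have "card {a \<in> PiE {..<t} (\<lambda>_. S). a i = x} \<le> card (PiE {..<t} (\<lambda>k. if k = i then {x} else S))"
      using S by (intro card_mono finite_PiE) auto
    also have "\<dots> = (\<Prod>k<t. if k = i then 1 else card S)"
      by (subst card_PiE) (auto intro!: prod.cong)
    also have "\<dots> = (\<Prod>k\<in>{..<t} - {i}. card S)"
      using i by (subst prod.remove[of _ i]) (auto intro!: prod.cong)
    also have "\<dots> = card S ^ (t - 1)" using i by simp
    finally show "card {a \<in> PiE {..<t} (\<lambda>_. S). a i = x} \<le> card S ^ (t - 1)" .
  qed
  finally show ?thesis by simp
qed

text \<open>The skeleton \<open>X\<close> must be neither source nor value. Vertices whose value
  lies in \<open>X\<close>, at most \<open>j\<close> for each element of \<open>X\<close>, are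
  dropped as well, and the dropped set is then padded to size exactly \<open>d\<close>.\<close>

lemma solvable_partial:
  assumes fin: "finite V" and h: "h \<in> configs V N t" "solvable V t j d0 h"
    and X: "X \<subseteq> V" and d: "d0 + j * card X \<le> d" "d \<le> card (V - X)"
  obtains D f where "(D, f) \<in> partials (V - X) (\<lambda>v. N v - X) j d" "\<And>v. v \<in> V - X - D \<Longrightarrow> \<exists>i<t. h v i = f v"
proof -
  obtain D0 f where D0: "D0 \<subseteq> V" "card D0 \<le> d0" and f: "\<And>v. v \<in> V - D0 \<Longrightarrow> \<exists>i<t. f v = h v i"
    and dg: "\<And>u. indeg (V - D0) f u \<le> j"
    using h(2) unfolding solvable_def by blast
  have fX: "finite X" using X fin finite_subset by blast
  have fD0: "finite D0" using D0 fin finite_subset by blast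
  define D1 where "D1 = (D0 - X) \<union> {v \<in> V - D0 - X. f v \<in> X}"
  have "{v \<in> V - D0 - X. f v \<in> X} \<subseteq> (\<Union>x\<in>X. {v \<in> V - D0. f v = x})" by auto
  then have "card {v \<in> V - D0 - X. f v \<in> X} \<le> card (\<Union>x\<in>X. {v \<in> V - D0. f v = x})"
    using fX fin by (intro card_mono) auto
  also have "\<dots> \<le> (\<Sum>x\<in>X. card {v \<in> V - D0. f v = x})" by (rule card_UN_le[OF fX])
  also have "\<dots> \<le> (\<Sum>x\<in>X. j)" using dg by (intro sum_mono) (simp add: indeg_def)
  finally have "card {v \<in> V - D0 - X. f v \<in> X} \<le> j * card X" by (simp add: mult.commute)
  moreover have "card (D0 - X) \<le> d0" using D0 fD0 by (meson Diff_subset card_mono order_trans)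
  ultimately have "card D1 \<le> d0 + j * card X" unfolding D1_def
    using card_Un_le[of "D0 - X" "{v \<in> V - D0 - X. f v \<in> X}"] by linarith
  moreover have "D1 \<subseteq> V - X" using D0 by (auto simp: D1_def)
  ultimately obtain D where D: "D1 \<subseteq> D" "D \<subseteq> V - X" "card D = d"
    using exists_subset_between[of D1 d "V - X"] d fin by auto
  let ?f = "restrict f (V - X - D)"
  have sub: "V - X - D \<subseteq> V - D0" using D(1) by (auto simp: D1_def)
  have hN: "f v \<in> N v - X" if "v \<in> V - X - D" for v
  proof -
    have "v \<in> V - D0" using that sub by blast
    then obtain i where "i < t" "f v = h v i" using f by blast
    then have "f v \<in> N v" using h(1) that by (auto simp: configs_def dest!: PiE_mem[of h V _ v])
    moreover have "f v \<notin> X" using that D(1) sub by (auto simp: D1_def)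
    ultimately show ?thesis by simp
  qed
  have "indeg (V - X - D) ?f u \<le> j" for u
  proof -
    have "indeg (V - X - D) ?f u \<le> indeg (V - D0) f u"
      unfolding indeg_def using sub fin by (intro card_mono) auto
    then show ?thesis using dg[of u] by linarith
  qed
  then have "(D, ?f) \<in> partials (V - X) (\<lambda>v. N v - X) j d" using D hN by (auto simp: partials_def)
  moreover have "\<exists>i<t. h v i = ?f v" if "v \<in> V - X - D" for v
  proof -
    have "v \<in> V - D0" using sub that by blast
    then obtain i where "i < t" "f v = h v i" using f by blast
    then show ?thesis using that by (intro exI[of _ i]) simp
  qed
  ultimately show ?thesis using that by blast
qed

text \<open>Few configurations lead to a given partial map: where it is defined, one of the
  \<open>t\<close> proposals is prescribed, and on \<open>X\<close> and \<open>D\<close> all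
  \<open>t\<close> are free, which costs a further factor \<open>r\<close> per vertex.\<close>

lemma card_solvable_le:
  assumes fin: "finite V" and N: "\<And>v. v \<in> V \<Longrightarrow> finite (N v) \<and> card (N v) = r"
    and X: "X \<subseteq> V" and d: "d0 + j * card X \<le> d" "d \<le> card (V - X)" and t: "t \<ge> 1"
  shows "card {h \<in> configs V N t. solvable V t j d0 h}
    \<le> card (partials (V - X) (\<lambda>v. N v - X) j d) * ((t * r ^ (t - 1)) ^ card V * r ^ (card X + d))"
proof -
  let ?P = "partials (V - X) (\<lambda>v. N v - X) j d"
  let ?fib = "\<lambda>(D, f). {h \<in> configs V N t. \<forall>v\<in>V - X - D. \<exists>i<t. h v i = f v}"
  have fP: "finite ?P" by (rule finite_partials) (use fin N in auto)
  have "{h \<in> configs V N t. solvable V t j d0 h} \<subseteq> (\<Union>x\<in>?P. ?fib x)"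
  proof
    fix h assume h: "h \<in> {h \<in> configs V N t. solvable V t j d0 h}"
    obtain D f where "(D, f) \<in> ?P" "\<And>v. v \<in> V - X - D \<Longrightarrow> \<exists>i<t. h v i = f v"
      using solvable_partial[OF fin _ _ X d, of h N t] h by auto
    then show "h \<in> (\<Union>x\<in>?P. ?fib x)" using h by (intro UN_I[of "(D, f)"]) auto
  qed
  moreover have fc: "finite (configs V N t)" unfolding configs_def using fin N by (intro finite_PiE) auto
  ultimately have "card {h \<in> configs V N t. solvable V t j d0 h} \<le> card (\<Union>x\<in>?P. ?fib x)"
    using fP by (intro card_mono finite_UN_I) auto
  also have "\<dots> \<le> (\<Sum>x\<in>?P. card (?fib x))" by (rule card_UN_le[OF fP])
  also have "\<dots> \<le> (\<Sum>x\<in>?P. (t * r ^ (t - 1)) ^ card V * r ^ (card X + d))"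
  proof (rule sum_mono)
    fix x assume x: "x \<in> ?P"
    obtain D f where xD: "x = (D, f)" by (cases x)
    have Df: "(D, f) \<in> ?P" using x xD by simp
    then have D: "D \<subseteq> V - X" "card D = d" and f: "f \<in> PiE (V - X - D) (\<lambda>v. N v - X)"
      by (auto simp: partials_def)
    define W where "W = (\<lambda>v. if v \<in> V - X - D then {a \<in> PiE {..<t} (\<lambda>_. N v). \<exists>i<t. a i = f v} else PiE {..<t} (\<lambda>_. N v))"
    have fW: "finite (W v)" if "v \<in> V" for v
    proof -
      have "finite (PiE {..<t} (\<lambda>_. N v))" using N that by (intro finite_PiE) auto
      then show ?thesis by (rule finite_subset[rotated]) (auto simp: W_def)
    qed
    have cW: "card (W v) \<le> (t * r ^ (t - 1)) * (if v \<in> X \<union> D then r else 1)" if v: "v \<in> V" for v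
    proof (cases "v \<in> V - X - D")
      case True
      then have "f v \<in> N v" using f by (auto dest!: PiE_mem[of f _ _ v])
      then show ?thesis using True card_PiE_hit[of "N v" "f v" t] N[OF v] by (simp add: W_def)
    next
      case False
      then have "W v = PiE {..<t} (\<lambda>_. N v)" unfolding W_def by (simp only: if_False)
      then have "card (W v) = r ^ t" using N[OF v] by (simp add: card_PiE)
      also have "r ^ t = r ^ (t - 1) * r" using t by (metis power_minus_mult zero_less_one less_le_trans)
      also have "\<dots> \<le> (t * r ^ (t - 1)) * r" using t by simp
      finally show ?thesis using False v by simp
    qed
    have "?fib (D, f) \<subseteq> PiE V W"
      by (auto simp: configs_def W_def PiE_def Pi_def)
    then have "card (?fib (D, f)) \<le> card (PiE V W)" using fin fW by (intro card_mono finite_PiE) auto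
    also have "\<dots> = (\<Prod>v\<in>V. card (W v))" by (rule card_PiE[OF fin])
    also have "\<dots> \<le> (\<Prod>v\<in>V. (t * r ^ (t - 1)) * (if v \<in> X \<union> D then r else 1))"
      using cW by (intro prod_mono) auto
    also have "\<dots> = (t * r ^ (t - 1)) ^ card V * (\<Prod>v\<in>V. if v \<in> X \<union> D then r else 1)"
      by (simp add: prod.distrib)
    also have "(\<Prod>v\<in>V. if v \<in> X \<union> D then r else 1) = (\<Prod>v\<in>V \<inter> (X \<union> D). r)"
      by (rule prod.inter_restrict[OF fin, symmetric])
    also have "V \<inter> (X \<union> D) = X \<union> D" using X D by auto
    also have "(\<Prod>v\<in>X \<union> D. r) = r ^ card (X \<union> D)" by simp
    also have "card (X \<union> D) = card X + card D"
    proof (rule card_Un_disjoint)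
      show "finite X" "finite D" using fin X D by (auto intro: finite_subset)
      show "X \<inter> D = {}" using D by auto
    qed
    also have "card D = d" by (rule D)
    finally show "card (?fib x) \<le> (t * r ^ (t - 1)) ^ card V * r ^ (card X + d)"
      unfolding xD .
  qed
  finally show ?thesis by simp
qed

section \<open>Solvable configurations: Hall's condition\<close>

text \<open>Rado's shrinking argument: by submodularity, from a set with two elements one of them can be
  discarded without violating the condition.\<close>

lemma hall_defect:
  assumes "finite I" "\<And>i. i \<in> I \<Longrightarrow> finite (S i)"
    and "\<And>J. J \<subseteq> I \<Longrightarrow> card J \<le> card (\<Union>i\<in>J. S i) + d"
  shows "\<exists>D f. D \<subseteq> I \<and> card D \<le> d \<and> inj_on f (I - D) \<and> (\<forall>i\<in>I - D. f i \<in> S i)"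
  using assms
proof (induction "\<Sum>i\<in>I. card (S i)" arbitrary: S rule: less_induct)
  case less
  show ?case
  proof (cases "\<exists>i\<in>I. card (S i) \<ge> 2")
    case False
    \<comment> \<open>No set has two elements, so one index for each element of \<open>W\<close> can
      be served, and \<open>W\<close> has at least \<open>card I - d\<close> elements.\<close>
    define W where "W = (\<Union>i\<in>I. S i)"
    have "\<forall>w\<in>W. \<exists>i\<in>I. w \<in> S i" by (auto simp: W_def)
    then obtain g where g: "\<And>w. w \<in> W \<Longrightarrow> g w \<in> I \<and> w \<in> S (g w)" by metis
    have single: "x = y" if "i \<in> I" "x \<in> S i" "y \<in> S i" for i x y
    proof -
      have "card (S i) \<le> Suc 0" using False that(1) by force
      then show ?thesis using that card_le_Suc0_iff_eq[OF less.prems(2)[OF that(1)]] by blast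
    qed
    have ig: "inj_on g W" using single g by (intro inj_onI) metis
    let ?D = "I - g ` W"
    have gI: "g ` W \<subseteq> I" using g by auto
    have "card ?D = card I - card (g ` W)" using gI less.prems(1) finite_subset by (intro card_Diff_subset) auto
    moreover have "card I \<le> card W + d" unfolding W_def by (rule less.prems(3)) simp
    ultimately have "card ?D \<le> d" using card_image[OF ig] by simp
    moreover have ID: "I - ?D = g ` W" using gI by auto
    moreover have "inj_on (the_inv_into W g) (g ` W)" using inj_on_the_inv_into[OF ig] .
    moreover have "the_inv_into W g i \<in> S i" if "i \<in> g ` W" for i
      using that g the_inv_into_f_f[OF ig] by auto
    ultimately show ?thesis by (intro exI[of _ ?D] exI[of _ "the_inv_into W g"]) auto
  next
    case True
    then obtain i0 where i0: "i0 \<in> I" "card (S i0) \<ge> 2" by auto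
    have "\<exists>x y. x \<in> S i0 \<and> y \<in> S i0 \<and> x \<noteq> y"
    proof (rule ccontr)
      assume "\<not> ?thesis"
      then have "card (S i0) \<le> Suc 0" using card_le_Suc0_iff_eq[OF less.prems(2)[OF i0(1)]] by blast
      then show False using i0 by simp
    qed
    then obtain x y where xy: "x \<in> S i0" "y \<in> S i0" "x \<noteq> y" by auto
    let ?P = "\<lambda>S. \<forall>J\<subseteq>I. card J \<le> card (\<Union>i\<in>J. S i) + d"
    have reduce: ?thesis if z: "z \<in> S i0" and P: "?P (S(i0 := S i0 - {z}))" for z
    proof -
      let ?S = "S(i0 := S i0 - {z})"
      have "(\<Sum>i\<in>I. card (?S i)) < (\<Sum>i\<in>I. card (S i))"
      proof (rule sum_strict_mono_ex1[OF less.prems(1)])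
        have fi: "finite (S i0)" using less.prems(2) i0 by auto
        show "\<forall>i\<in>I. card (?S i) \<le> card (S i)" using fi by (auto intro!: card_mono)
        have "card (S i0 - {z}) < card (S i0)" using fi z by (rule card_Diff1_less)
        then show "\<exists>i\<in>I. card (?S i) < card (S i)" using i0 by (intro bexI[of _ i0]) auto
      qed
      then have "\<exists>D f. D \<subseteq> I \<and> card D \<le> d \<and> inj_on f (I - D) \<and> (\<forall>i\<in>I - D. f i \<in> ?S i)"
      proof (rule less.hyps[OF _ less.prems(1)])
        show "finite (?S i)" if "i \<in> I" for i using less.prems(2)[OF that] less.prems(2)[OF i0(1)] by simp
        show "card J \<le> card (\<Union>i\<in>J. ?S i) + d" if "J \<subseteq> I" for J using P that by blast
      qed
      then obtain D f where D: "D \<subseteq> I" "card D \<le> d" "inj_on f (I - D)" and f: "\<forall>i\<in>I - D. f i \<in> ?S i" by blast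
      have "f i \<in> S i" if "i \<in> I - D" for i using bspec[OF f that] by (simp split: if_splits)
      then show ?thesis using D by blast
    qed
    have "?P (S(i0 := S i0 - {x})) \<or> ?P (S(i0 := S i0 - {y}))"
    proof (rule ccontr)
      assume "\<not> ?thesis"
      then obtain J1 J2 where J: "J1 \<subseteq> I" "\<not> card J1 \<le> card (\<Union>i\<in>J1. (S(i0 := S i0 - {x})) i) + d"
        "J2 \<subseteq> I" "\<not> card J2 \<le> card (\<Union>i\<in>J2. (S(i0 := S i0 - {y})) i) + d" by blast
      have in1: "i0 \<in> J" if "J \<subseteq> I" "\<not> card J \<le> card (\<Union>i\<in>J. (S(i0 := Z)) i) + d" for J Z
      proof (rule ccontr)
        assume "i0 \<notin> J"
        then have "(\<Union>i\<in>J. (S(i0 := Z)) i) = (\<Union>i\<in>J. S i)" by auto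
        then show False using that less.prems(3)[of J] by simp
      qed
      have iJ: "i0 \<in> J1" "i0 \<in> J2" using in1 J by blast+
      define A B where "A = J1 - {i0}" and "B = J2 - {i0}"
      have AB: "A \<subseteq> I" "B \<subseteq> I" "i0 \<notin> A" "i0 \<notin> B" using J by (auto simp: A_def B_def)
      have fin: "finite A" "finite B" using AB less.prems(1) finite_subset by auto
      have J': "J1 = insert i0 A" "J2 = insert i0 B" using iJ by (auto simp: A_def B_def)
      define U1 U2 where "U1 = (\<Union>i\<in>A. S i) \<union> (S i0 - {x})" and "U2 = (\<Union>i\<in>B. S i) \<union> (S i0 - {y})"
      have "(\<Union>i\<in>J1. (S(i0 := S i0 - {x})) i) = U1" "(\<Union>i\<in>J2. (S(i0 := S i0 - {y})) i) = U2"
        using AB by (auto simp: J' U1_def U2_def)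
      then have c: "card U1 + d \<le> card A" "card U2 + d \<le> card B"
        using J J' AB fin by simp_all
      have finS: "finite (\<Union>i\<in>C. S i)" if "C \<subseteq> I" for C
        using that less.prems(1,2) finite_subset by (intro finite_UN_I) auto
      have finU: "finite U1" "finite U2" using finS AB i0 less.prems(2) by (auto simp: U1_def U2_def)
      have "card (insert i0 (A \<union> B)) \<le> card (\<Union>i\<in>insert i0 (A \<union> B). S i) + d"
        using AB i0 by (intro less.prems(3)) auto
      \<comment> \<open>As \<open>x\<close> and \<open>y\<close> differ, the two truncated copies of
        \<open>S i0\<close> together still cover it.\<close>
      also have "(\<Union>i\<in>insert i0 (A \<union> B). S i) \<subseteq> U1 \<union> U2" using xy by (auto simp: U1_def U2_def)
      then have "card (\<Union>i\<in>insert i0 (A \<union> B). S i) \<le> card (U1 \<union> U2)" using finU by (intro card_mono) auto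
      finally have 1: "Suc (card (A \<union> B)) \<le> card (U1 \<union> U2) + d" using AB fin by simp
      have "card (A \<inter> B) \<le> card (\<Union>i\<in>A \<inter> B. S i) + d" using AB by (intro less.prems(3)) auto
      moreover have "card (\<Union>i\<in>A \<inter> B. S i) \<le> card (U1 \<inter> U2)"
        using finU by (intro card_mono) (auto simp: U1_def U2_def)
      ultimately have 2: "card (A \<inter> B) \<le> card (U1 \<inter> U2) + d" by simp
      \<comment> \<open>The sum of \<open>1\<close> and \<open>2\<close> is
        \<open>card A + card B + 1 \<le> card U1 + card U2 + 2 * d\<close>, against
        \<open>c\<close>.\<close>
      show False using 1 2 c card_Un_Int[OF finU] card_Un_Int[OF fin] by linarith
    qed
    then show ?thesis using reduce xy by blast
  qed
qed

lemma solvable_one: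
  assumes fin: "finite V"
    and hall: "\<And>J. J \<subseteq> V \<Longrightarrow> card J \<le> card (\<Union>v\<in>J. h v ` {..<t}) + d"
  shows "solvable V t 1 d h"
proof -
  obtain D f where D: "D \<subseteq> V" "card D \<le> d" "inj_on f (V - D)" and f: "\<And>v. v \<in> V - D \<Longrightarrow> f v \<in> h v ` {..<t}"
    using hall_defect[of V "\<lambda>v. h v ` {..<t}" d] fin hall by (metis finite_imageI finite_lessThan)
  have "indeg (V - D) f u \<le> 1" for u
  proof -
    have "x = y" if "x \<in> {v \<in> V - D. f v = u}" "y \<in> {v \<in> V - D. f v = u}" for x y
      using that D(3) by (auto simp: inj_on_def)
    then show ?thesis using card_le_Suc0_iff_eq[of "{v \<in> V - D. f v = u}"] fin by (simp add: indeg_def)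
  qed
  moreover have "\<exists>i<t. f v = h v i" if "v \<in> V - D" for v using f[OF that] by auto
  ultimately show ?thesis unfolding solvable_def using D by blast
qed

lemma card_configs:
  assumes "finite V" "\<And>v. v \<in> V \<Longrightarrow> card (N v) = r"
  shows "card (configs V N t) = (r ^ t) ^ card V"
  using assms by (simp add: configs_def card_PiE)

text \<open>Union bound over the violated Hall conditions, at most \<open>4 ^ card V\<close> pairs
  \<open>(J, W)\<close>. All proposals of \<open>v\<close> fall into \<open>W\<close> with
  probability \<open>a v ^ t\<close>, where \<open>a v \<le> exp (a v - 1)\<close>. Since each
  \<open>w\<close> is a possible value of at most \<open>r\<close> vertices, the \<open>a v\<close>
  with \<open>v\<close> in \<open>J\<close> sum to at most \<open>card W\<close>, so the product is
  at most \<open>exp (- real (t * d))\<close>.\<close>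

lemma card_solvable_one_ge:
  assumes fin: "finite V" and N: "\<And>v. v \<in> V \<Longrightarrow> N v \<subseteq> V \<and> card (N v) = r"
    and sym: "\<And>w. w \<in> V \<Longrightarrow> card {v \<in> V. w \<in> N v} \<le> r" and r: "r \<ge> 1"
  shows "real (card {h \<in> configs V N t. solvable V t 1 d h})
    \<ge> (1 - 4 ^ card V * exp (- real (t * d))) * real r ^ (t * card V)"
proof -
  have fN: "finite (N v)" if "v \<in> V" for v using N[OF that] fin finite_subset by blast
  have fc: "finite (configs V N t)" unfolding configs_def using fin fN by (intro finite_PiE) auto
  let ?T = "{(J, W). J \<subseteq> V \<and> W \<subseteq> V \<and> card W + d < card J}"
  let ?C = "\<lambda>(J, W). PiE V (\<lambda>v. PiE {..<t} (\<lambda>_. if v \<in> J then N v \<inter> W else N v))"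
  have fT: "finite ?T" by (rule finite_subset[of _ "Pow V \<times> Pow V"]) (use fin in auto)
  have sub: "{h \<in> configs V N t. \<not> solvable V t 1 d h} \<subseteq> (\<Union>x\<in>?T. ?C x)"
  proof
    fix h assume h: "h \<in> {h \<in> configs V N t. \<not> solvable V t 1 d h}"
    then obtain J where J: "J \<subseteq> V" "\<not> card J \<le> card (\<Union>v\<in>J. h v ` {..<t}) + d"
      using solvable_one[OF fin] by blast
    let ?W = "\<Union>v\<in>J. h v ` {..<t}"
    have hN: "h v i \<in> N v" if "v \<in> V" "i < t" for v i
      using h that by (auto simp: configs_def dest!: PiE_mem[of h V _ v] PiE_mem[of "h v" _ _ i])
    have "?W \<subseteq> V" using hN J N by fastforce
    then have "(J, ?W) \<in> ?T" using J by auto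
    moreover have "h \<in> ?C (J, ?W)"
    proof (simp only: prod.case, rule PiE_I)
      fix v assume v: "v \<in> V"
      have "h v \<in> PiE {..<t} (\<lambda>_. N v)" using h v by (auto simp: configs_def)
      then show "h v \<in> PiE {..<t} (\<lambda>_. if v \<in> J then N v \<inter> ?W else N v)"
        by (auto simp: PiE_def Pi_def)
    next
      fix v assume "v \<notin> V"
      then show "h v = undefined" using h by (auto simp: configs_def dest: PiE_arb)
    qed
    ultimately show "h \<in> (\<Union>x\<in>?T. ?C x)" by blast
  qed
  have bound: "real (card (?C x)) \<le> real r ^ (t * card V) * exp (- real (t * d))" if x: "x \<in> ?T" for x
  proof -
    obtain J W where xJ: "x = (J, W)" by (cases x)
    have J: "J \<subseteq> V" "W \<subseteq> V" "card W + d < card J" using x xJ by auto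
    have fJ: "finite J" "finite W" using J fin finite_subset by auto
    define a where "a = (\<lambda>v. real (card (N v \<inter> W)) / real r)"
    have "real (card (?C x)) = (\<Prod>v\<in>V. real (card (if v \<in> J then N v \<inter> W else N v)) ^ t)"
      using fin by (simp add: xJ card_PiE)
    also have "\<dots> \<le> (\<Prod>v\<in>V. (real r * (if v \<in> J then exp (a v - 1) else 1)) ^ t)"
    proof (rule prod_mono, intro conjI power_mono)
      fix v assume v: "v \<in> V"
      have "a v \<le> exp (a v - 1)" using exp_ge_add_one_self[of "a v - 1"] by simp
      then have "real r * a v \<le> real r * exp (a v - 1)" by (intro mult_left_mono) auto
      moreover have "real r * a v = real (card (N v \<inter> W))" using r by (simp add: a_def)
      ultimately show "real (card (if v \<in> J then N v \<inter> W else N v)) \<le> real r * (if v \<in> J then exp (a v - 1) else 1)"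
        using N[OF v] by simp
    qed auto
    also have "\<dots> = (real r ^ card V * (\<Prod>v\<in>V. if v \<in> J then exp (a v - 1) else 1)) ^ t"
      by (simp add: prod_power_distrib[symmetric] prod.distrib)
    also have "(\<Prod>v\<in>V. if v \<in> J then exp (a v - 1) else 1) = (\<Prod>v\<in>V \<inter> J. exp (a v - 1))"
      by (rule prod.inter_restrict[OF fin, symmetric])
    also have "V \<inter> J = J" using J by auto
    also have "(\<Prod>v\<in>J. exp (a v - 1)) = exp ((\<Sum>v\<in>J. a v) - real (card J))"
      by (simp add: exp_sum[OF fJ(1), symmetric] sum_subtractf)
    also have "(real r ^ card V * exp ((\<Sum>v\<in>J. a v) - real (card J))) ^ t \<le> (real r ^ card V * exp (- real d)) ^ t"
    proof (intro power_mono mult_left_mono)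
      have "(\<Sum>v\<in>J. card (N v \<inter> W)) = card (SIGMA v:J. N v \<inter> W)"
        using fJ by (intro card_SigmaI[symmetric]) auto
      also have "\<dots> = card (SIGMA w:W. {v \<in> J. w \<in> N v})"
        by (rule bij_betw_same_card[of "\<lambda>(v, w). (w, v)"]) (auto simp: bij_betw_def inj_on_def image_def)
      also have "\<dots> = (\<Sum>w\<in>W. card {v \<in> J. w \<in> N v})" using fJ by (intro card_SigmaI) auto
      also have "\<dots> \<le> (\<Sum>w\<in>W. r)"
      proof (rule sum_mono)
        fix w assume "w \<in> W"
        then have "card {v \<in> V. w \<in> N v} \<le> r" using sym J by auto
        moreover have "card {v \<in> J. w \<in> N v} \<le> card {v \<in> V. w \<in> N v}" using J fin by (intro card_mono) auto
        ultimately show "card {v \<in> J. w \<in> N v} \<le> r" by simp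
      qed
      finally have "(\<Sum>v\<in>J. card (N v \<inter> W)) \<le> card W * r" by simp
      then have "real (\<Sum>v\<in>J. card (N v \<inter> W)) \<le> real (card W * r)" by (rule of_nat_mono)
      then have "(\<Sum>v\<in>J. a v) \<le> real (card W)"
        using r by (simp add: a_def sum_divide_distrib[symmetric] divide_le_eq)
      then show "exp ((\<Sum>v\<in>J. a v) - real (card J)) \<le> exp (- real d)" using J(3) by simp
    qed auto
    also have "\<dots> = real r ^ (t * card V) * exp (- real (t * d))"
      by (simp add: power_mult_distrib power_mult[symmetric] exp_of_nat_mult[symmetric] mult.commute)
    finally show ?thesis .
  qed
  have "card {h \<in> configs V N t. \<not> solvable V t 1 d h} \<le> card (\<Union>x\<in>?T. ?C x)"
  proof (rule card_mono[OF _ sub])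
    show "finite (\<Union>x\<in>?T. ?C x)" using fin fN by (intro finite_UN_I fT) (auto intro!: finite_PiE)
  qed
  also have "\<dots> \<le> (\<Sum>x\<in>?T. card (?C x))" by (rule card_UN_le[OF fT])
  finally have "real (card {h \<in> configs V N t. \<not> solvable V t 1 d h}) \<le> real (\<Sum>x\<in>?T. card (?C x))"
    by (rule of_nat_mono)
  also have "\<dots> = (\<Sum>x\<in>?T. real (card (?C x)))" by (rule of_nat_sum)
  also have "\<dots> \<le> (\<Sum>x\<in>?T. real r ^ (t * card V) * exp (- real (t * d)))" by (rule sum_mono[OF bound])
  also have "\<dots> = real (card ?T) * (real r ^ (t * card V) * exp (- real (t * d)))" by simp
  also have "\<dots> \<le> 4 ^ card V * (real r ^ (t * card V) * exp (- real (t * d)))"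
  proof (rule mult_right_mono)
    have "card ?T \<le> card (Pow V \<times> Pow V)" using fin by (intro card_mono) auto
    also have "\<dots> = 4 ^ card V" using fin by (simp add: card_cartesian_product card_Pow power_mult_distrib[symmetric])
    finally have "real (card ?T) \<le> real (4 ^ card V)" by (rule of_nat_mono)
    then show "real (card ?T) \<le> 4 ^ card V" by (simp only: of_nat_power of_nat_numeral)
  qed auto
  finally have bad: "real (card {h \<in> configs V N t. \<not> solvable V t 1 d h})
    \<le> 4 ^ card V * (real r ^ (t * card V) * exp (- real (t * d)))" .
  let ?A = "{h \<in> configs V N t. solvable V t 1 d h}" and ?B = "{h \<in> configs V N t. \<not> solvable V t 1 d h}"
  have "configs V N t = ?A \<union> ?B" by blast
  then have "card (configs V N t) = card (?A \<union> ?B)" by (rule arg_cong)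
  also have "\<dots> \<le> card ?A + card ?B" by (rule card_Un_le)
  finally have "real (card (configs V N t)) \<le> real (card ?A + card ?B)" by (rule of_nat_mono)
  moreover have "card (configs V N t) = r ^ (t * card V)"
    using card_configs[OF fin, of N r t] N by (simp add: power_mult)
  ultimately have "real r ^ (t * card V) \<le> real (card ?A) + real (card ?B)" by simp
  then show ?thesis using bad by (simp add: algebra_simps)
qed

section \<open>Solvable configurations: the excess of a random choice\<close>

lemma binomial_absorb_Suc: "Suc m * (n choose Suc m) = (n - m) * (n choose m)"
proof (cases n)
  case (Suc n')
  have "Suc m * (Suc n' choose Suc m) = Suc n' * (n' choose m)" by (rule Suc_times_binomial)
  also have "\<dots> = (Suc n' - m) * (Suc n' choose m)"
    using binomial_absorb_comp[of "Suc n'" m] by simp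
  finally show ?thesis using Suc by simp
qed simp

lemma pascal_real: "real (Suc x choose Suc m) = real (x choose m) + real (x choose Suc m)"
  by simp

text \<open>For consecutive binomial coefficients \<open>w\<close>, \<open>p\<close>,
  \<open>q\<close>, \<open>s\<close>, Pascal's rule turns the conclusion into the same expansion
  with the upper index raised by one.\<close>

lemma pascal_add:
  fixes a c e e' w p q s :: real
  assumes "e \<le> p - a * q + c * s" "e' \<le> w - a * p + c * q"
  shows "e + e' \<le> (w + p) - a * (p + q) + c * (q + s)"
  using assms by (simp add: algebra_simps)

text \<open>Truncated inclusion-exclusion for the indicator of \<open>x \<ge> Suc i\<close>. When
  \<open>x\<close> grows by one, the right side grows by
  \<open>(y - 1) * (y - 2) / 2 * (x choose i)\<close> with \<open>y = x - i\<close>, which is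
  nonnegative for integers \<open>y\<close>.\<close>

lemma bonferroni_step:
  assumes "x \<ge> Suc i"
  shows "1 \<le> real (x choose Suc i) - real (Suc i) * real (x choose Suc (Suc i))
    + real (Suc i) * real (Suc (Suc i)) / 2 * real (x choose Suc (Suc (Suc i)))"
  using assms
proof (induction x rule: dec_induct)
  case (step x)
  define y where "y = x - i"
  have y: "y \<ge> 1" "x - Suc i = y - 1" using step by (auto simp: y_def)
  have a1: "real (Suc i) * real (x choose Suc i) = real y * real (x choose i)"
    unfolding y_def of_nat_mult[symmetric] by (simp only: binomial_absorb_Suc)
  have "real (Suc (Suc i)) * real (x choose Suc (Suc i)) = real (x - Suc i) * real (x choose Suc i)"
    unfolding of_nat_mult[symmetric] by (simp only: binomial_absorb_Suc)
  then have a2: "real (Suc (Suc i)) * real (x choose Suc (Suc i)) = (real y - 1) * real (x choose Suc i)"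
    using y by (simp only: of_nat_diff) simp
  have "real (Suc i) * real (Suc (Suc i)) / 2 * real (x choose Suc (Suc i))
      = real (Suc i) / 2 * (real (Suc (Suc i)) * real (x choose Suc (Suc i)))" by simp
  also have "\<dots> = (real y - 1) / 2 * (real (Suc i) * real (x choose Suc i))"
    unfolding a2 by simp
  also have "\<dots> = (real y - 1) / 2 * (real y * real (x choose i))" unfolding a1 ..
  finally have "real (x choose i) - real (Suc i) * real (x choose Suc i)
      + real (Suc i) * real (Suc (Suc i)) / 2 * real (x choose Suc (Suc i))
    = (1 - real y + (real y - 1) / 2 * real y) * real (x choose i)"
    unfolding a1 by (simp add: algebra_simps)
  also have "(1 - real y + (real y - 1) / 2 * real y) = (real y - 1) * (real y - 2) / 2"
    by (simp add: field_simps)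
  also have "(real y - 1) * (real y - 2) / 2 * real (x choose i) \<ge> 0"
  proof (cases "y = 1")
    case False
    then have "real y \<ge> 2" using y by simp
    then show ?thesis by simp
  qed simp
  finally show ?case unfolding pascal_real
    using pascal_add[OF step.IH, of 0 "real (x choose i)"] by simp
qed (simp add: binomial_eq_0)

text \<open>The first three terms of the alternating expansion of \<open>max 0 (x - j)\<close> in binomial
  coefficients, truncated after a positive term.\<close>

lemma bonferroni_excess:
  assumes "j \<ge> 1"
  shows "real (x - j) \<le> real (x choose Suc j) - real j * real (x choose Suc (Suc j))
    + real j * real (Suc j) / 2 * real (x choose Suc (Suc (Suc j)))"
proof (cases "x \<ge> j")
  case True
  obtain i where j: "j = Suc i" using assms by (cases j) auto
  show ?thesis using True
  proof (induction x rule: dec_induct)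
    case (step x)
    have "real (Suc x - j) = real (x - j) + 1" using step by (simp add: Suc_diff_le)
    \<comment> \<open>The excess grows by one with \<open>x\<close>, and the right side by at least
      one according to \<open>bonferroni_step\<close>.\<close>
    moreover have "real (x - j) + 1 \<le> (real (x choose j) + real (x choose Suc j))
      - real j * (real (x choose Suc j) + real (x choose Suc (Suc j)))
      + real j * real (Suc j) / 2 * (real (x choose Suc (Suc j)) + real (x choose Suc (Suc (Suc j))))"
      by (rule pascal_add[OF step.IH]) (use bonferroni_step[of i x] step.hyps(1) j in simp)
    ultimately show ?case unfolding pascal_real by (simp only:)
  qed (simp add: binomial_eq_0)
qed (simp add: binomial_eq_0)

text \<open>Double counting of pairs of a map and an \<open>m\<close>-set of vertices that it sends
  to \<open>u\<close>: each eligible \<open>m\<close>-set fits \<open>r ^ (card V - m)\<close>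
  maps.\<close>

lemma sum_binomial_indeg:
  assumes fin: "finite V" and N: "\<And>v. v \<in> V \<Longrightarrow> finite (N v) \<and> card (N v) = r"
    and u: "card {v \<in> V. u \<in> N v} = r" and r: "r \<ge> 1"
  shows "(\<Sum>f\<in>PiE V N. real (indeg V f u choose m)) = real (r choose m) / real r ^ m * real r ^ card V"
proof -
  let ?U = "{v \<in> V. u \<in> N v}"
  let ?M = "{A. A \<subseteq> ?U \<and> card A = m}"
  have fP: "finite (PiE V N)" using fin N by (intro finite_PiE) auto
  have fU: "finite ?U" using fin by simp
  have fM: "finite ?M" using fU by simp
  have "(\<Sum>f\<in>PiE V N. indeg V f u choose m) = (\<Sum>f\<in>PiE V N. card {A \<in> ?M. \<forall>v\<in>A. f v = u})"
  proof (rule sum.cong)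
    fix f assume f: "f \<in> PiE V N"
    have "u \<in> N v" if "v \<in> V" "f v = u" for v using PiE_mem[OF f that(1)] that(2) by simp
    then have "{A \<in> ?M. \<forall>v\<in>A. f v = u} = {A. A \<subseteq> {v \<in> V. f v = u} \<and> card A = m}"
      by blast
    then show "indeg V f u choose m = card {A \<in> ?M. \<forall>v\<in>A. f v = u}"
      using n_subsets[of "{v \<in> V. f v = u}" m] fin by (simp add: indeg_def)
  qed simp
  also have "\<dots> = card (SIGMA f:PiE V N. {A \<in> ?M. \<forall>v\<in>A. f v = u})"
    by (intro card_SigmaI[symmetric] ballI fP finite_subset[OF _ fM]) auto
  also have "\<dots> = card (SIGMA A:?M. {f \<in> PiE V N. \<forall>v\<in>A. f v = u})"
    by (rule bij_betw_same_card[of "\<lambda>(f, A). (A, f)"]) (auto simp: bij_betw_def inj_on_def image_def)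
  also have "\<dots> = (\<Sum>A\<in>?M. card {f \<in> PiE V N. \<forall>v\<in>A. f v = u})"
    using fP fM by (intro card_SigmaI) auto
  also have "\<dots> = (\<Sum>A\<in>?M. r ^ (card V - m))"
  proof (rule sum.cong)
    fix A assume A: "A \<in> ?M"
    have "{f \<in> PiE V N. \<forall>v\<in>A. f v = u} = PiE V (\<lambda>v. if v \<in> A then {u} else N v)"
      using A by (auto simp: PiE_def Pi_def split: if_splits)
    then have "card {f \<in> PiE V N. \<forall>v\<in>A. f v = u} = (\<Prod>v\<in>V. card (if v \<in> A then {u} else N v))"
      using card_PiE[OF fin] by simp
    also have "\<dots> = (\<Prod>v\<in>V. if v \<in> V - A then r else 1)" using N by (intro prod.cong) auto
    also have "\<dots> = (\<Prod>v\<in>V \<inter> (V - A). r)" by (rule prod.inter_restrict[OF fin, symmetric])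
    also have "\<dots> = r ^ card (V - A)" by (simp add: Int_absorb1)
    also have "card (V - A) = card V - m"
      using A fU by (subst card_Diff_subset) (auto intro: finite_subset)
    finally show "card {f \<in> PiE V N. \<forall>v\<in>A. f v = u} = r ^ (card V - m)" .
  qed simp
  also have "\<dots> = (r choose m) * r ^ (card V - m)" using n_subsets[OF fU, of m] u by simp
  finally have eq: "(\<Sum>f\<in>PiE V N. indeg V f u choose m) = (r choose m) * r ^ (card V - m)" .
  have "(\<Sum>f\<in>PiE V N. real (indeg V f u choose m)) = real ((r choose m) * r ^ (card V - m))"
    unfolding eq[symmetric] by simp
  also have "\<dots> = real (r choose m) / real r ^ m * real r ^ card V"
  proof (cases "m \<le> r")
    case True
    have "r \<le> card V" using u fin card_mono[of V ?U] by auto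
    then have "real r ^ (card V - m) = real r ^ card V / real r ^ m"
      using True r by (intro power_diff) auto
    then show ?thesis by (simp only: of_nat_mult of_nat_power times_divide_eq_left times_divide_eq_right)
  qed (simp add: binomial_eq_0)
  finally show ?thesis .
qed

text \<open>The right side of \<open>bonferroni_excess\<close> in expectation: under a uniform map
  the in-degree is binomial with parameters \<open>r\<close> and \<open>1 / r\<close>, and its
  \<open>m\<close>-th binomial moment is \<open>(r choose m) / r ^ m\<close>.\<close>

definition excess_mean :: "nat \<Rightarrow> nat \<Rightarrow> real" where
  "excess_mean j r = real (r choose Suc j) / real r ^ Suc j
    - real j * (real (r choose Suc (Suc j)) / real r ^ Suc (Suc j))
    + real j * real (Suc j) / 2 * (real (r choose Suc (Suc (Suc j))) / real r ^ Suc (Suc (Suc j)))"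

lemma sum_excess_le:
  assumes fin: "finite V" and N: "\<And>v. v \<in> V \<Longrightarrow> finite (N v) \<and> card (N v) = r"
    and u: "\<And>u. u \<in> V \<Longrightarrow> card {v \<in> V. u \<in> N v} = r" and r: "r \<ge> 1" and j: "j \<ge> 1"
  shows "(\<Sum>f\<in>PiE V N. \<Sum>u\<in>V. real (indeg V f u - j)) \<le> real (card V) * (excess_mean j r * real r ^ card V)"
proof -
  have "(\<Sum>f\<in>PiE V N. \<Sum>u\<in>V. real (indeg V f u - j)) = (\<Sum>u\<in>V. \<Sum>f\<in>PiE V N. real (indeg V f u - j))"
    by (rule sum.swap)
  also have "\<dots> \<le> (\<Sum>u\<in>V. excess_mean j r * real r ^ card V)"
  proof (rule sum_mono)
    fix u assume uV: "u \<in> V"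
    have S: "(\<Sum>f\<in>PiE V N. real (indeg V f u choose m)) = real (r choose m) / real r ^ m * real r ^ card V" for m
      by (rule sum_binomial_indeg[OF fin N u[OF uV] r])
    have "(\<Sum>f\<in>PiE V N. real (indeg V f u - j)) \<le> (\<Sum>f\<in>PiE V N. real (indeg V f u choose Suc j)
      - real j * real (indeg V f u choose Suc (Suc j)) + real j * real (Suc j) / 2 * real (indeg V f u choose Suc (Suc (Suc j))))"
      using j by (intro sum_mono bonferroni_excess)
    also have "\<dots> = (\<Sum>f\<in>PiE V N. real (indeg V f u choose Suc j))
      - real j * (\<Sum>f\<in>PiE V N. real (indeg V f u choose Suc (Suc j)))
      + real j * real (Suc j) / 2 * (\<Sum>f\<in>PiE V N. real (indeg V f u choose Suc (Suc (Suc j))))"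
      by (simp only: sum.distrib sum_subtractf sum_distrib_left)
    also have "\<dots> = excess_mean j r * real r ^ card V"
      by (simp only: S excess_mean_def ring_distribs left_diff_distrib mult.assoc)
    finally show "(\<Sum>f\<in>PiE V N. real (indeg V f u - j)) \<le> excess_mean j r * real r ^ card V" .
  qed
  finally show ?thesis by simp
qed

text \<open>From the fibre over each \<open>u\<close> exactly its surplus over \<open>j\<close> is
  dropped.\<close>

lemma solvable_single:
  assumes fin: "finite V" and f: "\<And>v. v \<in> V \<Longrightarrow> f v \<in> V" and ex: "(\<Sum>u\<in>V. indeg V f u - j) \<le> d"
  shows "solvable V 1 j d (\<lambda>v. (\<lambda>_. f v))"
proof -
  have "\<exists>B. B \<subseteq> {v \<in> V. f v = u} \<and> card B = indeg V f u - j" for u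
    using obtain_subset_with_card_n[of "indeg V f u - j" "{v \<in> V. f v = u}"] by (auto simp: indeg_def)
  then obtain B where B: "\<And>u. B u \<subseteq> {v \<in> V. f v = u}" "\<And>u. card (B u) = indeg V f u - j" by metis
  have fB: "finite (B u)" for u using B(1)[of u] fin by (auto intro: finite_subset)
  let ?D = "\<Union>u\<in>V. B u"
  have "card ?D \<le> (\<Sum>u\<in>V. card (B u))" by (rule card_UN_le[OF fin])
  then have "card ?D \<le> d" using ex B(2) by simp
  moreover have "indeg (V - ?D) f u \<le> j" for u
  proof (cases "u \<in> V")
    case True
    have "{v \<in> V - ?D. f v = u} \<subseteq> {v \<in> V. f v = u} - B u" using True by auto
    then have "indeg (V - ?D) f u \<le> card ({v \<in> V. f v = u} - B u)"
      unfolding indeg_def using fin by (intro card_mono) auto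
    also have "\<dots> = indeg V f u - (indeg V f u - j)"
      using card_Diff_subset[OF fB B(1)] B(2) by (simp add: indeg_def)
    finally show ?thesis by simp
  next
    case False
    then have "{v \<in> V - ?D. f v = u} = {}" using f by auto
    then show ?thesis unfolding indeg_def by (simp only: card.empty)
  qed
  moreover have "?D \<subseteq> V" using B(1) by blast
  ultimately show ?thesis unfolding solvable_def by blast
qed

text \<open>Markov's inequality for the total excess. The excess is an integer, so failure means at
  least \<open>d + 1\<close>.\<close>

lemma card_solvable_single_ge:
  assumes fin: "finite V" and N: "\<And>v. v \<in> V \<Longrightarrow> N v \<subseteq> V \<and> card (N v) = r"
    and u: "\<And>u. u \<in> V \<Longrightarrow> card {v \<in> V. u \<in> N v} = r" and r: "r \<ge> 1" and j: "j \<ge> 1"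
  shows "real (card {h \<in> configs V N 1. solvable V 1 j d h})
    \<ge> (1 - real (card V) * excess_mean j r / (real d + 1)) * real r ^ card V"
proof -
  have fN: "finite (N v)" if "v \<in> V" for v using N[OF that] fin finite_subset by blast
  have N': "finite (N v) \<and> card (N v) = r" if "v \<in> V" for v using fN N that by auto
  have fP: "finite (PiE V N)" using fin fN by (intro finite_PiE) auto
  have fc: "finite (configs V N 1)" unfolding configs_def using fin fN by (intro finite_PiE) auto
  let ?X = "\<lambda>f. \<Sum>u\<in>V. indeg V f u - j"
  let ?A = "{f \<in> PiE V N. ?X f \<le> d}" and ?B = "{f \<in> PiE V N. \<not> ?X f \<le> d}"
  have "real (card ?B) * (real d + 1) = (\<Sum>f\<in>?B. real d + 1)" by simp
  also have "\<dots> \<le> (\<Sum>f\<in>?B. real (?X f))"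
  proof (rule sum_mono)
    fix f assume "f \<in> ?B"
    then have "Suc d \<le> ?X f" by simp
    then have "real (Suc d) \<le> real (?X f)" by (rule of_nat_mono)
    then show "real d + 1 \<le> real (?X f)" by (simp only: of_nat_Suc add.commute)
  qed
  also have "\<dots> \<le> (\<Sum>f\<in>PiE V N. real (?X f))" using fP by (intro sum_mono2) (auto intro!: sum_nonneg)
  also have "\<dots> = (\<Sum>f\<in>PiE V N. \<Sum>u\<in>V. real (indeg V f u - j))" by simp
  also have "\<dots> \<le> real (card V) * (excess_mean j r * real r ^ card V)"
    by (rule sum_excess_le[OF fin N' u r j])
  finally have B: "real (card ?B) \<le> real (card V) * (excess_mean j r * real r ^ card V) / (real d + 1)"
    by (simp add: field_simps)
  have "PiE V N = ?A \<union> ?B" by blast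
  then have "card (PiE V N) = card (?A \<union> ?B)" by (rule arg_cong)
  also have "\<dots> \<le> card ?A + card ?B" by (rule card_Un_le)
  finally have "real (card (PiE V N)) \<le> real (card ?A + card ?B)" by (rule of_nat_mono)
  moreover have "card (PiE V N) = r ^ card V" using card_PiE[OF fin, of N] N by simp
  ultimately have AB: "real r ^ card V \<le> real (card ?A) + real (card ?B)" by simp
  let ?e = "\<lambda>f. \<lambda>v\<in>V. \<lambda>i\<in>{..<1::nat}. f v"
  have "card ?A \<le> card {h \<in> configs V N 1. solvable V 1 j d h}"
  proof (rule card_inj_on_le[of ?e])
    show "inj_on ?e ?A"
    proof (rule inj_onI)
      fix f g assume f: "f \<in> ?A" and g: "g \<in> ?A" and eq: "?e f = ?e g"
      have P: "f \<in> PiE V N" "g \<in> PiE V N" using f g by auto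
      have "f v = g v" if "v \<in> V" for v
        using fun_cong[OF fun_cong[OF eq, of v], of 0] that by simp
      then show "f = g" using P by (intro PiE_ext)
    qed
    show "?e ` ?A \<subseteq> {h \<in> configs V N 1. solvable V 1 j d h}"
    proof (rule image_subsetI)
      fix f assume f: "f \<in> ?A"
      have P: "f \<in> PiE V N" using f by simp
      have fV: "f v \<in> V" if "v \<in> V" for v using PiE_mem[OF P that] N[OF that] by blast
      have "?e f \<in> configs V N 1" unfolding configs_def using PiE_mem[OF P] by auto
      moreover have "solvable V 1 j d (\<lambda>v. (\<lambda>_. f v))" by (rule solvable_single[OF fin fV]) (use f in auto)
      then have "solvable V 1 j d (?e f)" by (auto simp: solvable_def)
      ultimately show "?e f \<in> {h \<in> configs V N 1. solvable V 1 j d h}" by blast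
    qed
    show "finite {h \<in> configs V N 1. solvable V 1 j d h}" using fc by simp
  qed
  then have "real (card ?A) \<le> real (card {h \<in> configs V N 1. solvable V 1 j d h})" by (rule of_nat_mono)
  then show ?thesis using AB B by (simp add: algebra_simps)
qed

section \<open>A small skeleton of low degree\<close>

locale dense_regular =
  fixes V :: "'a set" and E :: "'a set set" and r k :: nat
  assumes G: "simple_graph V E" and conn: "connected_graph V E"
    and deg: "\<And>v. v \<in> V \<Longrightarrow> card (nbrs E v) = r"
    and dens: "card V \<le> (k + 1) * r" and k3: "k \<ge> 3"
begin

lemma finV: "finite V"
  using G by (simp add: simple_graph_def)

lemma fin_nbrs [simp]: "finite (nbrs E v)"
  using finite_nbrs[OF G] .

lemma nbrs_V: "nbrs E v \<subseteq> V"
  using nbrs_subset[OF G] by blast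

lemma nbrs_src: "u \<in> nbrs E v \<Longrightarrow> v \<in> V"
  using nbrs_V[of u] nbrs_sym[of u E v] by blast

text \<open>The classes are nonempty unions of components of the graph without \<open>S\<close>;
  they need not be connected themselves.\<close>

definition labelling :: "'a set \<Rightarrow> ('a \<Rightarrow> nat) \<Rightarrow> nat \<Rightarrow> bool" where
  "labelling S lab q \<longleftrightarrow> S \<subseteq> V \<and> lab ` (V - S) = {..<q} \<and>
     (\<forall>u\<in>V - S. \<forall>v\<in>V - S. v \<in> nbrs E u \<longrightarrow> lab u = lab v)"

definition part :: "'a set \<Rightarrow> ('a \<Rightarrow> nat) \<Rightarrow> nat \<Rightarrow> 'a set" where
  "part S lab i = {v \<in> V - S. lab v = i}"

lemma nbrs_part:
  assumes "labelling S lab q" "v \<in> part S lab i"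
  shows "nbrs E v \<subseteq> part S lab i \<union> S"
  using assms nbrs_V[of v] unfolding labelling_def part_def by fastforce

lemma part_deficit:
  assumes l: "labelling S lab q" and v: "v \<in> part S lab i"
  shows "r + 1 \<le> card (part S lab i) + card (nbrs E v \<inter> S)"
proof -
  have fp: "finite (part S lab i)" using finV by (simp add: part_def)
  have "nbrs E v \<subseteq> (part S lab i - {v}) \<union> (nbrs E v \<inter> S)"
    using nbrs_part[OF l v] nbrs_subset[OF G, of v] by blast
  then have "card (nbrs E v) \<le> card ((part S lab i - {v}) \<union> (nbrs E v \<inter> S))"
    using fp by (intro card_mono) auto
  also have "\<dots> \<le> card (part S lab i - {v}) + card (nbrs E v \<inter> S)" by (rule card_Un_le)
  finally show ?thesis using deg[of v] v fp card_Diff_singleton[OF v] card_gt_0_iff[of "part S lab i"]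
    by (auto simp: part_def)
qed

lemma part_large:
  assumes l: "labelling S lab q" and i: "i < q"
  shows "r + 1 \<le> card (part S lab i) + card S"
proof -
  have "i \<in> lab ` (V - S)" using l i by (simp add: labelling_def)
  then obtain v where v: "v \<in> part S lab i" by (auto simp: part_def)
  have "finite S" using l finV finite_subset by (auto simp: labelling_def)
  then have "card (nbrs E v \<inter> S) \<le> card S" by (intro card_mono) auto
  then show ?thesis using part_deficit[OF l v] by simp
qed

lemma sum_nbrs_swap:
  assumes "S \<subseteq> V"
  shows "(\<Sum>v\<in>V. card (nbrs E v \<inter> S)) = card S * r"
proof -
  have fS: "finite S" using assms finV finite_subset by blast
  have "(\<Sum>v\<in>V. card (nbrs E v \<inter> S)) = card (SIGMA v:V. nbrs E v \<inter> S)"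
    using finV by (intro card_SigmaI[symmetric]) auto
  also have "\<dots> = card (SIGMA s:S. nbrs E s)"
    by (rule bij_betw_same_card[of "\<lambda>(v, s). (s, v)"])
      (auto simp: bij_betw_def inj_on_def image_def nbrs_sym intro: nbrs_src)
  also have "\<dots> = (\<Sum>s\<in>S. card (nbrs E s))" using fS by (intro card_SigmaI) auto
  also have "\<dots> = (\<Sum>s\<in>S. r)" using assms deg by (intro sum.cong) auto
  finally show ?thesis by simp
qed

text \<open>Deleting few vertices leaves at most \<open>k\<close> components: a component of size \<open>r + 1 - c\<close> sends
  at least \<open>c\<close> edges to \<open>S\<close> from each of its vertices, so regularity bounds the sum of all the
  \<open>c\<close> by the size of \<open>S\<close>, and \<open>k + 1\<close> components would not fit into \<open>V\<close>.\<close>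

lemma labelling_bound:
  assumes l: "labelling S lab q" and small: "(card S + 1)\<^sup>2 \<le> r"
  shows "q \<le> k"
proof (rule ccontr)
  assume "\<not> q \<le> k"
  then have q: "k < q" by simp
  let ?C = "part S lab" and ?s = "card S"
  define c where "c = (\<lambda>i. r + 1 - card (?C i))"
  have SV: "S \<subseteq> V" using l by (simp add: labelling_def)
  have fS: "finite S" using SV finV finite_subset by blast
  have fC: "finite (?C i)" for i using finV by (simp add: part_def)
  have disj: "?C i \<inter> ?C j = {}" if "i \<noteq> j" for i j using that by (auto simp: part_def)
  have large: "r + 1 - ?s \<le> card (?C i)" if "i \<le> k" for i using part_large[OF l, of i] that q by simp
  have "(r + 1 - ?s) * (\<Sum>i\<le>k. c i) = (\<Sum>i\<le>k. (r + 1 - ?s) * c i)" by (simp add: sum_distrib_left)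
  also have "\<dots> \<le> (\<Sum>i\<le>k. \<Sum>v\<in>?C i. card (nbrs E v \<inter> S))"
  proof (rule sum_mono)
    fix i assume i: "i \<in> {..k}"
    have "(r + 1 - ?s) * c i \<le> card (?C i) * c i" using large i by (intro mult_right_mono) auto
    also have "\<dots> = (\<Sum>v\<in>?C i. c i)" by simp
    also have "\<dots> \<le> (\<Sum>v\<in>?C i. card (nbrs E v \<inter> S))"
    proof (rule sum_mono)
      fix v assume "v \<in> ?C i"
      then show "c i \<le> card (nbrs E v \<inter> S)" using part_deficit[OF l, of v i] by (simp add: c_def)
    qed
    finally show "(r + 1 - ?s) * c i \<le> (\<Sum>v\<in>?C i. card (nbrs E v \<inter> S))" .
  qed
  also have "\<dots> = (\<Sum>v\<in>(\<Union>i\<le>k. ?C i). card (nbrs E v \<inter> S))"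
    using fC disj by (intro sum.UNION_disjoint[symmetric]) auto
  also have "\<dots> \<le> (\<Sum>v\<in>V. card (nbrs E v \<inter> S))"
    using finV by (intro sum_mono2) (auto simp: part_def)
  also have "\<dots> = ?s * r" by (rule sum_nbrs_swap[OF SV])
  finally have le: "(r + 1 - ?s) * (\<Sum>i\<le>k. c i) \<le> ?s * r" .
  have sr: "?s * ?s + 2 * ?s + 1 \<le> r" using small by (simp add: power2_eq_square)
  \<comment> \<open>With a sum of at least \<open>?s + 1\<close>, the left side of \<open>le\<close>
    would exceed the right by at least \<open>r + 1 - ?s * ?s\<close>, which is positive.\<close>
  have cs: "(\<Sum>i\<le>k. c i) \<le> ?s"
  proof (rule ccontr)
    assume "\<not> ?thesis"
    then have "(r + 1 - ?s) * (?s + 1) \<le> (r + 1 - ?s) * (\<Sum>i\<le>k. c i)" by (intro mult_left_mono) auto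
    with le have "(r + 1 - ?s) * (?s + 1) \<le> ?s * r" by simp
    moreover obtain b where b: "r = ?s * ?s + 2 * ?s + 1 + b" using sr le_Suc_ex by blast
    moreover have "r + 1 - ?s = ?s * ?s + ?s + 2 + b" using b by simp
    ultimately show False by (simp add: algebra_simps)
  qed
  have "(k + 1) * (r + 1) = (\<Sum>i\<le>k. r + 1)" by simp
  also have "\<dots> \<le> (\<Sum>i\<le>k. card (?C i) + c i)" by (intro sum_mono) (auto simp: c_def)
  also have "\<dots> = (\<Sum>i\<le>k. card (?C i)) + (\<Sum>i\<le>k. c i)" by (rule sum.distrib)
  also have "(\<Sum>i\<le>k. card (?C i)) = card (\<Union>i\<le>k. ?C i)"
    using fC disj by (intro card_UN_disjoint[symmetric]) auto
  also have "card (\<Union>i\<le>k. ?C i) \<le> card (V - S)"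
    using finV by (intro card_mono) (auto simp: part_def)
  also have "card (V - S) = card V - ?s" using card_Diff_subset[OF fS SV] .
  finally have "(k + 1) * (r + 1) \<le> card V - ?s + (\<Sum>i\<le>k. c i)" by simp
  also have "\<dots> \<le> card V" using cs card_mono[OF finV SV] by simp
  finally show False using dens by simp
qed

text \<open>Nonempty unions of components of the graph induced on \<open>W\<close>; connectedness
  says that \<open>W\<close> is the only one.\<close>

definition closed_in :: "'a set \<Rightarrow> 'a set \<Rightarrow> bool" where
  "closed_in W Z \<longleftrightarrow> Z \<subseteq> W \<and> Z \<noteq> {} \<and> (\<forall>u\<in>Z. nbrs E u \<inter> W \<subseteq> Z)"

text \<open>With \<open>q\<close> maximal, a set \<open>Y\<close> disconnecting one of the parts could be added to \<open>S\<close>.\<close>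

lemma robust_labelling:
  assumes small: "(k * L + 1)\<^sup>2 \<le> r" and L: "L \<ge> 1"
  obtains S lab q where "labelling S lab q" "card S \<le> k * L" "1 \<le> q" "q \<le> k"
    "\<And>i Y Z. i < q \<Longrightarrow> Y \<subseteq> V \<Longrightarrow> card Y \<le> L \<Longrightarrow> closed_in (part S lab i - Y) Z \<Longrightarrow> Z = part S lab i - Y"
proof -
  \<comment> \<open>Each new class costs at most \<open>L\<close> deleted vertices. Thus
    \<open>S\<close> never outgrows the range of \<open>labelling_bound\<close>, and the maximum
    exists.\<close>
  let ?Q = "{q. 1 \<le> q \<and> q \<le> k \<and> (\<exists>S lab. labelling S lab q \<and> card S \<le> (q - 1) * L)}"
  have "lab ` (V - {}) = {..<1}" if "lab = (\<lambda>_ :: 'a. 0 :: nat)" for lab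
    using that conn by (auto simp: connected_graph_def)
  then have "labelling {} (\<lambda>_. 0) 1" unfolding labelling_def by blast
  then have ex: "\<exists>S lab. labelling S lab 1 \<and> card S \<le> (1 - 1) * L"
    by (intro exI[of _ "{}"] exI[of _ "\<lambda>_. 0"]) simp
  have one: "1 \<in> ?Q"
  proof (intro CollectI conjI)
    show "1 \<le> k" using k3 by simp
  qed (rule order_refl, rule ex)
  have fQ: "finite ?Q" by (rule finite_subset[of _ "{..k}"]) auto
  have "Max ?Q \<in> ?Q" by (rule Max_in[OF fQ]) (use one in blast)
  define q where "q = Max ?Q"
  obtain S lab where l: "labelling S lab q" and S: "card S \<le> (q - 1) * L" and q: "1 \<le> q" "q \<le> k"
    using \<open>Max ?Q \<in> ?Q\<close> unfolding q_def by blast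
  have "(q - 1) * L \<le> k * L" using q by (intro mult_right_mono) auto
  then have SkL: "card S \<le> k * L" by (rule order_trans[OF S])
  have "Z = part S lab i - Y"
    if i: "i < q" and Y: "Y \<subseteq> V" "card Y \<le> L" and Z: "closed_in (part S lab i - Y) Z" for i Y Z
  proof (rule ccontr)
    assume ne: "Z \<noteq> part S lab i - Y"
    have Zs: "Z \<subseteq> part S lab i - Y" "Z \<noteq> {}" and Zc: "\<And>u. u \<in> Z \<Longrightarrow> nbrs E u \<inter> (part S lab i - Y) \<subseteq> Z"
      using Z by (auto simp: closed_in_def)
    define lab' where "lab' = (\<lambda>v. if v \<in> Z then q else lab v)"
    have SV: "S \<subseteq> V" and img: "lab ` (V - S) = {..<q}"
      and adj: "\<And>u v. u \<in> V - S \<Longrightarrow> v \<in> V - S \<Longrightarrow> v \<in> nbrs E u \<Longrightarrow> lab u = lab v"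
      using l unfolding labelling_def by blast+
    have "lab' ` (V - (S \<union> Y)) = {..<Suc q}"
    proof (intro equalityI subsetI)
      fix x assume "x \<in> lab' ` (V - (S \<union> Y))"
      then show "x \<in> {..<Suc q}" using img by (auto simp: lab'_def less_Suc_eq)
    next
      fix x assume x: "x \<in> {..<Suc q}"
      consider "x = q" | "x = i" | "x < q" "x \<noteq> i" using x i by fastforce
      then show "x \<in> lab' ` (V - (S \<union> Y))"
      proof cases
        case 1
        obtain z where "z \<in> Z" using Zs by blast
        then have "z \<in> V - (S \<union> Y)" "lab' z = x" using Zs 1 by (auto simp: part_def lab'_def)
        then show ?thesis by blast
      next
        case 2
        obtain z where "z \<in> part S lab i - Y" "z \<notin> Z" using Zs ne by blast
        then have "z \<in> V - (S \<union> Y)" "lab' z = x" using 2 by (auto simp: part_def lab'_def)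
        then show ?thesis by blast
      next
        case 3
        \<comment> \<open>The classes other than \<open>i\<close> have more than \<open>L\<close>
          elements, so \<open>Y\<close> cannot use one of them up.\<close>
        have "r + 1 \<le> card (part S lab x) + card S" by (rule part_large[OF l 3(1)])
        moreover have "card S + L < r + 1"
        proof -
          have "L \<le> k * L" using k3 by simp
          then have "card S + L \<le> 2 * (k * L)" using SkL by linarith
          also have "\<dots> \<le> (k * L + 1)\<^sup>2" by (simp add: power2_eq_square)
          finally show ?thesis using small by simp
        qed
        ultimately have "card Y < card (part S lab x)" using Y by simp
        then have "\<not> part S lab x \<subseteq> Y" using finite_subset[OF Y(1) finV] card_mono by (metis not_le)
        then obtain z where "z \<in> part S lab x" "z \<notin> Y" by blast
        moreover have "z \<notin> Z" using calculation Zs 3 by (auto simp: part_def)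
        ultimately have "z \<in> V - (S \<union> Y)" "lab' z = x" by (auto simp: part_def lab'_def)
        then show ?thesis by blast
      qed
    qed
    moreover have "lab' u = lab' v" if u: "u \<in> V - (S \<union> Y)" and v: "v \<in> V - (S \<union> Y)" and uv: "v \<in> nbrs E u" for u v
    proof -
      have eq: "lab u = lab v" using adj[of u v] u v uv by blast
      have *: "y \<in> Z" if "x \<in> Z" "y \<in> V - (S \<union> Y)" "y \<in> nbrs E x" "lab x = lab y" for x y
      proof -
        have "x \<in> part S lab i" using Zs(1) that(1) by blast
        then have "y \<in> part S lab i - Y" using that(2,4) by (simp add: part_def)
        then show ?thesis using Zc[OF that(1)] that(3) by blast
      qed
      have "u \<in> Z \<longleftrightarrow> v \<in> Z" using *[of u v] *[of v u] u v uv eq nbrs_sym[of v E u] by auto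
      then show ?thesis using eq by (simp add: lab'_def)
    qed
    ultimately have l': "labelling (S \<union> Y) lab' (Suc q)" using SV Y unfolding labelling_def by blast
    have "card (S \<union> Y) \<le> card S + card Y" by (rule card_Un_le)
    also have "\<dots> \<le> (q - 1) * L + L" using S Y by simp
    also have "\<dots> = q * L" using q by (cases q) auto
    finally have c: "card (S \<union> Y) \<le> q * L" .
    also have "q * L \<le> k * L" using q by simp
    finally have "(card (S \<union> Y) + 1)\<^sup>2 \<le> (k * L + 1)\<^sup>2" by (intro power_mono) auto
    then have "Suc q \<le> k" using labelling_bound[OF l'] small by linarith
    then have "Suc q \<in> ?Q" using l' c by auto
    then have "Suc q \<le> q" unfolding q_def by (rule Max_ge[OF fQ])
    then show False by simp
  qed
  then show ?thesis using that l SkL q by blast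
qed

end

section \<open>Short paths through prescribed vertices\<close>

inductive upath :: "'a set set \<Rightarrow> 'a set \<Rightarrow> 'a set set \<Rightarrow> 'a \<Rightarrow> bool" for E where
  upath_start: "upath E {u} {} u"
| upath_step: "upath E X T e \<Longrightarrow> v \<notin> X \<Longrightarrow> {e, v} \<in> E \<Longrightarrow> upath E (insert v X) (insert {e, v} T) v"

lemma upath_end: "upath E X T e \<Longrightarrow> e \<in> X"
  by (induction rule: upath.induct) auto

lemma upath_subset: "upath E X T e \<Longrightarrow> T \<subseteq> E"
  by (induction rule: upath.induct) auto

lemma upath_tree: "upath E X T e \<Longrightarrow> tree_graph X T"
proof (induction rule: upath.induct)
  case (upath_step X T e v)
  then show ?case using tree_graph_pendant[of X T e v] upath_end by metis
qed (rule tree_graph_singleton)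

lemma upath_degree:
  "upath E X T e \<Longrightarrow> graph_degree T e \<le> 1 \<and> (\<forall>x. graph_degree T x \<le> 2)"
proof (induction rule: upath.induct)
  case (upath_start u)
  then show ?case by (simp add: graph_degree_def)
next
  case (upath_step X T e v)
  have "v \<notin> f" if "f \<in> T" for f
    using upath_tree[OF upath_step(1)] that upath_step(2) by (auto simp: tree_graph_def simple_graph_def)
  then have "graph_degree T v = 0" by (rule graph_degree_zero)
  then have v: "graph_degree (insert {e, v} T) v \<le> 1"
    using graph_degree_insert_le[of "{e, v}" T v] by simp
  moreover have "graph_degree (insert {e, v} T) x \<le> 2" for x
  proof -
    consider "x = v" | "x = e" | "x \<noteq> v" "x \<noteq> e" by blast
    then show ?thesis
    proof cases
      case 1 then show ?thesis using v by simp
    next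
      case 2 then show ?thesis using graph_degree_insert_le[of "{e, v}" T e] upath_step.IH by simp
    next
      case 3 then show ?thesis using upath_step.IH by (simp add: graph_degree_insert_other)
    qed
  qed
  ultimately show ?case by blast
qed

text \<open>Balls around \<open>u\<close> in the graph induced on \<open>W\<close>.\<close>

fun layer :: "'a set set \<Rightarrow> 'a set \<Rightarrow> 'a \<Rightarrow> nat \<Rightarrow> 'a set" where
  "layer E W u 0 = {u}"
| "layer E W u (Suc d) = layer E W u d \<union> {v \<in> W. \<exists>x\<in>layer E W u d. v \<in> nbrs E x}"

lemma layer_sub: "u \<in> W \<Longrightarrow> layer E W u d \<subseteq> W"
  by (induction d) auto

lemma layer_source: "u \<in> layer E W u d"
  by (induction d) auto

lemma layer_next: "x \<in> layer E W u d \<Longrightarrow> y \<in> W \<Longrightarrow> y \<in> nbrs E x \<Longrightarrow> y \<in> layer E W u (Suc d)"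
  by auto

text \<open>As long as the layers grow, every third one brings in a whole neighbourhood that is disjoint
  from the earlier layers.\<close>

lemma layer_diameter:
  assumes fin: "finite W" and u: "u \<in> W"
    and conn: "\<And>Z. Z \<subseteq> W \<Longrightarrow> Z \<noteq> {} \<Longrightarrow> (\<And>x. x \<in> Z \<Longrightarrow> nbrs E x \<inter> W \<subseteq> Z) \<Longrightarrow> Z = W"
    and deg: "\<And>x. x \<in> W \<Longrightarrow> \<delta> \<le> card (nbrs E x \<inter> W)" and m: "card W < m * \<delta>"
  shows "layer E W u (3 * m) = W"
proof -
  let ?R = "layer E W u"
  have stable: "?R d = W" if "?R (Suc d) = ?R d" for d
  proof (rule conn)
    show "?R d \<subseteq> W" by (rule layer_sub[OF u])
    show "?R d \<noteq> {}" using layer_source[of u E W d] by blast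
    fix x assume "x \<in> ?R d"
    then have "nbrs E x \<inter> W \<subseteq> ?R (Suc d)" by auto
    then show "nbrs E x \<inter> W \<subseteq> ?R d" using that by simp
  qed
  have full: "?R (Suc d) = W" if "?R d = W" for d using that by auto
  have "?R (3 * j) = W \<or> j * \<delta> \<le> card (?R (3 * j))" for j
  proof (induction j)
    case (Suc j)
    have 3: "3 * Suc j = Suc (Suc (Suc (3 * j)))" by simp
    show ?case
    proof (cases "?R (Suc (3 * j)) = W")
      case True
      then have "?R (3 * Suc j) = W" unfolding 3 using full by blast
      then show ?thesis ..
    next
      case False
      then have nW: "?R (3 * j) \<noteq> W" using full by blast
      have "?R (Suc (Suc (3 * j))) \<noteq> ?R (Suc (3 * j))" using stable False by blast
      \<comment> \<open>\<open>x\<close> is at distance exactly \<open>3 * j + 2\<close>: its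
        neighbours in \<open>W\<close> lie in the ball of radius \<open>3 * j + 3\<close>, but none
        in that of radius \<open>3 * j\<close>.\<close>
      then obtain x where x: "x \<in> ?R (Suc (Suc (3 * j)))" "x \<notin> ?R (Suc (3 * j))" by auto
      have xW: "x \<in> W" using x layer_sub[OF u] by blast
      have "nbrs E x \<inter> W \<subseteq> ?R (3 * Suc j)" unfolding 3 using layer_next[OF x(1)] by blast
      moreover have "nbrs E x \<inter> W \<inter> ?R (3 * j) = {}"
      proof (rule ccontr)
        assume "\<not> ?thesis"
        then obtain y where "y \<in> nbrs E x" "y \<in> ?R (3 * j)" by blast
        then have "x \<in> ?R (Suc (3 * j))" using layer_next xW nbrs_sym by metis
        then show False using x by blast
      qed
      moreover have "?R (3 * j) \<subseteq> ?R (3 * Suc j)" unfolding 3 by auto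
      moreover have fR: "finite (?R d)" for d using layer_sub[OF u] fin finite_subset by blast
      ultimately have "card (nbrs E x \<inter> W) + card (?R (3 * j)) \<le> card (?R (3 * Suc j))"
        using card_Un_disjoint[of "nbrs E x \<inter> W" "?R (3 * j)"] fin
          card_mono[OF fR, of "(nbrs E x \<inter> W) \<union> ?R (3 * j)" "3 * Suc j"] by auto
      then show ?thesis using Suc nW deg[OF xW] by simp
    qed
  qed simp
  from this[of m] show ?thesis using m card_mono[OF fin layer_sub[OF u, of E "3 * m"]] by auto
qed

text \<open>Follows a shortest route from \<open>e\<close>. A vertex is added only when its layer
  first contains it, so it is new to the path.\<close>

lemma upath_extend:
  assumes "upath E X T e" "X \<inter> W \<subseteq> {e}" "v \<in> layer E W e d"
  shows "\<exists>X' T'. upath E X' T' v \<and> X \<subseteq> X' \<and> X' \<subseteq> X \<union> layer E W e d \<and> card X' \<le> card X + d"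
  using assms(3)
proof (induction d arbitrary: v)
  case 0
  then show ?case using assms(1) by auto
next
  case (Suc d)
  show ?case
  proof (cases "v \<in> layer E W e d")
    case True
    from Suc.IH[OF this] show ?thesis by force
  next
    case False
    then obtain x where x: "v \<in> W" "x \<in> layer E W e d" "v \<in> nbrs E x" using Suc.prems by auto
    obtain X' T' where X': "upath E X' T' x" "X \<subseteq> X'" "X' \<subseteq> X \<union> layer E W e d" "card X' \<le> card X + d"
      using Suc.IH[OF x(2)] by blast
    have "v \<noteq> e" using False layer_source by metis
    then have v: "v \<notin> X'" using X' False assms(2) x by blast
    have "upath E (insert v X') (insert {x, v} T') v"
      using X'(1) v x(3) by (intro upath_step) (simp_all add: nbrs_def)
    moreover have "card (insert v X') \<le> Suc (card X')" by (rule card_insert_le_m1) auto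
    moreover have "insert v X' \<subseteq> X \<union> layer E W e (Suc d)" using X' Suc.prems by auto
    moreover have "X \<subseteq> insert v X'" using X' by blast
    ultimately show ?thesis using X'(4) by (intro exI[of _ "insert v X'"] exI[of _ "insert {x, v} T'"]) auto
  qed
qed

text \<open>The elements of \<open>A\<close> are visited one at a time. Before each extension,
  \<open>F\<close> and the path except for its end are removed; these are at most \<open>L\<close>
  vertices, so the remainder is connected and its diameter is at most \<open>3 * m\<close> by
  \<open>layer_diameter\<close>.\<close>

lemma upath_through:
  assumes fin: "finite C" and F: "finite F"
    and conn: "\<And>Y Z. finite Y \<Longrightarrow> card Y \<le> L \<Longrightarrow> Z \<subseteq> C - Y \<Longrightarrow> Z \<noteq> {} \<Longrightarrow>
      (\<And>x. x \<in> Z \<Longrightarrow> nbrs E x \<inter> (C - Y) \<subseteq> Z) \<Longrightarrow> Z = C - Y"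
    and deg: "\<And>x. x \<in> C \<Longrightarrow> \<delta> + L \<le> card (nbrs E x \<inter> C)" and m: "card C < m * \<delta>"
    and A: "finite A" "A \<noteq> {}" "A \<subseteq> C - F" and L: "card F + 1 + card A * (3 * m) \<le> L"
  shows "\<exists>X T e. upath E X T e \<and> A \<subseteq> X \<and> X \<subseteq> C - F \<and> card X \<le> 1 + card A * (3 * m)"
  using A L
proof (induction A rule: finite_ne_induct)
  case (singleton a)
  then show ?case by (intro exI[of _ "{a}"] exI[of _ "{}"] exI[of _ a]) (auto intro: upath_start)
next
  case (insert a A)
  have "card F + 1 + card A * (3 * m) \<le> L" using insert by auto
  then obtain X T e where X: "upath E X T e" "A \<subseteq> X" "X \<subseteq> C - F" "card X \<le> 1 + card A * (3 * m)"
    using insert.IH insert.prems by auto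
  have cA: "card (insert a A) = Suc (card A)" using insert by simp
  show ?case
  proof (cases "a \<in> X")
    case True
    then show ?thesis using X cA by (intro exI[of _ X] exI[of _ T] exI[of _ e]) auto
  next
    case False
    define Y where "Y = F \<union> (X - {e})"
    have fX: "finite X" using X fin finite_subset by blast
    have fY: "finite Y" using fX F by (simp add: Y_def)
    have "card Y \<le> card F + card (X - {e})" unfolding Y_def by (rule card_Un_le)
    also have "\<dots> \<le> card F + card X" using fX by (simp add: card_mono)
    finally have cY: "card Y \<le> L" using X(4) insert.prems(2) cA by simp
    have eC: "e \<in> C - Y" using upath_end[OF X(1)] X(3) by (auto simp: Y_def)
    have aW: "a \<in> C - Y" using insert.prems False by (auto simp: Y_def)
    have "layer E (C - Y) e (3 * m) = C - Y"
    proof (rule layer_diameter[OF _ eC])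
      show "Z = C - Y" if "Z \<subseteq> C - Y" "Z \<noteq> {}" "\<And>x. x \<in> Z \<Longrightarrow> nbrs E x \<inter> (C - Y) \<subseteq> Z" for Z
        by (rule conn[OF fY cY that])
      show "\<delta> \<le> card (nbrs E x \<inter> (C - Y))" if "x \<in> C - Y" for x
      proof -
        have "nbrs E x \<inter> (C - Y) = (nbrs E x \<inter> C) - Y" by blast
        then show ?thesis using deg[of x] that cY diff_card_le_card_Diff[OF fY, of "nbrs E x \<inter> C"] by simp
      qed
      show "card (C - Y) < m * \<delta>" using m card_mono[OF fin, of "C - Y"] by simp
    qed (use fin in simp)
    then have al: "a \<in> layer E (C - Y) e (3 * m)" using aW by simp
    have "X \<inter> (C - Y) \<subseteq> {e}" by (auto simp: Y_def)
    from upath_extend[OF X(1) this al] obtain X' T' where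
      X': "upath E X' T' a" "X \<subseteq> X'" "X' \<subseteq> X \<union> layer E (C - Y) e (3 * m)" "card X' \<le> card X + 3 * m" by blast
    have "X' \<subseteq> C - F" using X'(3) layer_sub[OF eC, of E "3 * m"] X(3) unfolding Y_def by blast
    moreover have "insert a A \<subseteq> X'" using upath_end[OF X'(1)] X(2) X'(2) by blast
    moreover have "card X' \<le> 1 + card (insert a A) * (3 * m)" using X'(4) X(4) cA by simp
    ultimately show ?thesis using X'(1) by blast
  qed
qed

section \<open>Joining classes and hitting neighbourhoods\<close>

text \<open>A tree on the classes is grown from class 0, with one edge of the graph kept for each of
  its edges. Only the number of edges in \<open>J\<close> matters later: it bounds their degrees at
  every vertex.\<close>

lemma class_tree:
  assumes conn: "connected_graph V E" and G: "simple_graph V E" and cls: "cls ` V = {..<q :: nat}" and m: "1 \<le> m" "m \<le> q"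
  shows "\<exists>I J. I \<subseteq> {..<q} \<and> card I = m \<and> 0 \<in> I \<and> J \<subseteq> E \<and> finite J \<and> card J \<le> m - 1 \<and>
    (\<forall>i\<in>I. (0, i) \<in> {(cls u, cls v) | u v. {u, v} \<in> J}\<^sup>*)"
  using m
proof (induction m rule: dec_induct)
  case base
  then show ?case by (intro exI[of _ "{0}"] exI[of _ "{}"]) auto
next
  case (step m)
  then obtain I J where I: "I \<subseteq> {..<q}" "card I = m" "0 \<in> I" and J: "J \<subseteq> E" "finite J" "card J \<le> m - 1"
    and reach: "\<And>i. i \<in> I \<Longrightarrow> (0, i) \<in> {(cls u, cls v) | u v. {u, v} \<in> J}\<^sup>*" by force
  let ?R = "\<lambda>J. {(cls u, cls v) | u v. {u, v} \<in> J}"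
  have "\<not> {..<q} \<subseteq> I"
  proof
    assume "{..<q} \<subseteq> I"
    then have "card {..<q} \<le> card I" using I(1) by (intro card_mono) (auto intro: finite_subset)
    then show False using I(2) step.prems by simp
  qed
  then obtain j where j: "j < q" "j \<notin> I" by auto
  then obtain y where y: "y \<in> V" "cls y = j" using cls by (metis imageE lessThan_iff)
  obtain x where x: "x \<in> V" "cls x = 0" using cls I by (metis imageE subsetD)
  have "(x, y) \<in> (adj E)\<^sup>*" using conn x y by (auto simp: connected_graph_adj)
  then obtain a b where ab: "{a, b} \<in> E" "cls a \<in> I" "cls b \<notin> I"
    using connected_cut_edge[of x y E "{v. cls v \<in> I}"] x y I j by auto
  have bV: "b \<in> V" using ab G by (auto simp: simple_graph_def)
  let ?I = "insert (cls b) I" and ?J = "insert {a, b} J"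
  have fI: "finite I" using I(1) finite_subset by blast
  have mono: "(?R J)\<^sup>* \<subseteq> (?R ?J)\<^sup>*" by (rule rtrancl_mono) blast
  have "(0, i) \<in> (?R ?J)\<^sup>*" if "i \<in> ?I" for i
  proof (cases "i \<in> I")
    case True then show ?thesis using reach mono by blast
  next
    case False
    have "(0, cls a) \<in> (?R ?J)\<^sup>*" using reach[OF ab(2)] mono by blast
    moreover have "(cls a, cls b) \<in> ?R ?J" by blast
    ultimately show ?thesis using that False by (auto intro: rtrancl_into_rtrancl)
  qed
  moreover have "?I \<subseteq> {..<q}" using I(1) bV cls by blast
  moreover have "card ?I = Suc m" using I(2) ab(3) fI by simp
  moreover have "card ?J \<le> Suc m - 1"
    by (rule card_insert_le_m1) (use J(3) step.hyps(1) in auto)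
  ultimately show ?case using I(3) J(1,2) ab(1)
    by (intro exI[of _ ?I] exI[of _ ?J]) auto
qed

text \<open>By averaging, some vertex lies in the sets \<open>N v\<close> of at least a fraction
  \<open>1 / c\<close> of the vertices \<open>v\<close> not yet hit.\<close>

lemma greedy_hitting:
  assumes fin: "finite V" and N: "\<And>v. v \<in> V \<Longrightarrow> N v \<subseteq> V \<and> card V \<le> c * card (N v)" and c: "c \<ge> 1"
  shows "\<exists>A. A \<subseteq> V \<and> card A \<le> t \<and> real (card {v \<in> V. N v \<inter> A = {}}) \<le> real (card V) * (1 - 1 / real c) ^ t"
proof (induction t)
  case 0
  have "{v \<in> V. N v \<inter> {} = {}} = V" by auto
  then show ?case by (intro exI[of _ "{}"]) simp
next
  case (Suc t)
  then obtain A where A: "A \<subseteq> V" "card A \<le> t" and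
    le: "real (card {v \<in> V. N v \<inter> A = {}}) \<le> real (card V) * (1 - 1 / real c) ^ t" by blast
  define U where "U = {v \<in> V. N v \<inter> A = {}}"
  have fU: "finite U" "U \<subseteq> V" using fin by (auto simp: U_def)
  have fN: "finite (N v)" if "v \<in> V" for v using N[OF that] fin finite_subset by blast
  show ?case
  proof (cases "U = {}")
    case True
    have z: "card {v \<in> V. N v \<inter> A = {}} = 0" using True unfolding U_def by (simp only: card.empty)
    have "0 \<le> 1 - 1 / real c" using c by simp
    then have "0 \<le> real (card V) * (1 - 1 / real c) ^ Suc t" by (intro mult_nonneg_nonneg zero_le_power) auto
    then have "real (card {v \<in> V. N v \<inter> A = {}}) \<le> real (card V) * (1 - 1 / real c) ^ Suc t"
      by (simp only: z of_nat_0)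
    moreover have "card A \<le> Suc t" using A(2) by simp
    ultimately show ?thesis using A(1) by blast
  next
    case False
    have "\<exists>x\<in>V. card U \<le> c * card {v \<in> U. x \<in> N v}"
    proof (rule ccontr)
      assume "\<not> ?thesis"
      then have lt: "c * card {v \<in> U. x \<in> N v} < card U" if "x \<in> V" for x using that by force
      have ne: "V \<noteq> {}" using False fU by auto
      have "card U * card V = (\<Sum>v\<in>U. card V)" by simp
      also have "\<dots> \<le> (\<Sum>v\<in>U. c * card (N v))" using N fU by (intro sum_mono) auto
      also have "\<dots> = c * (\<Sum>v\<in>U. card (N v))" by (simp add: sum_distrib_left)
      also have "(\<Sum>v\<in>U. card (N v)) = card (SIGMA v:U. N v)"
        using fU fN by (intro card_SigmaI[symmetric]) auto
      also have "\<dots> = card (SIGMA x:V. {v \<in> U. x \<in> N v})"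
        by (rule bij_betw_same_card[of "\<lambda>(v, x). (x, v)"])
          (use N fU in \<open>auto simp: bij_betw_def inj_on_def image_def\<close>)
      also have "\<dots> = (\<Sum>x\<in>V. card {v \<in> U. x \<in> N v})" using fin fU by (intro card_SigmaI) auto
      also have "c * (\<Sum>x\<in>V. card {v \<in> U. x \<in> N v}) = (\<Sum>x\<in>V. c * card {v \<in> U. x \<in> N v})"
        by (simp add: sum_distrib_left)
      also have "\<dots> < (\<Sum>x\<in>V. card U)" using lt fin ne by (intro sum_strict_mono) auto
      finally show False by simp
    qed
    then obtain x where x: "x \<in> V" "card U \<le> c * card {v \<in> U. x \<in> N v}" by blast
    let ?U = "{v \<in> V. N v \<inter> insert x A = {}}"
    have "?U = U - {v \<in> U. x \<in> N v}" by (auto simp: U_def)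
    then have "card ?U = card U - card {v \<in> U. x \<in> N v}"
      using fU by (simp add: card_Diff_subset)
    then have "real (card ?U) = real (card U) - real (card {v \<in> U. x \<in> N v})"
      using fU by (simp add: of_nat_diff card_mono)
    moreover have "real (card U) \<le> real c * real (card {v \<in> U. x \<in> N v})"
      using of_nat_mono[OF x(2), where 'a = real] by simp
    then have "real (card U) / real c \<le> real (card {v \<in> U. x \<in> N v})"
      using c by (simp add: divide_le_eq mult.commute)
    ultimately have "real (card ?U) \<le> real (card U) * (1 - 1 / real c)" by (simp add: algebra_simps)
    also have "\<dots> \<le> real (card V) * (1 - 1 / real c) ^ t * (1 - 1 / real c)"
      using le c by (intro mult_right_mono) (auto simp: U_def)
    finally have "real (card ?U) \<le> real (card V) * (1 - 1 / real c) ^ Suc t" by (simp add: mult_ac)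
    moreover have "card (insert x A) \<le> Suc t" using A(2) card_insert_le_m1[of "Suc t" A x] by simp
    ultimately show ?thesis using A(1) x(1) by (intro exI[of _ "insert x A"]) auto
  qed
qed

text \<open>\<open>M\<close> rounds of greedy hitting, each avoiding \<open>F\<close> and the
  earlier rounds. The subtracted term in the hypothesis is the size of what is avoided.\<close>

lemma multi_hitting:
  assumes fin: "finite V" and F: "finite F"
    and N: "\<And>v. v \<in> V \<Longrightarrow> N v \<subseteq> V \<and> card V \<le> c * (card (N v) - (card F + M * t))" and c: "c \<ge> 1"
    and t: "real (card V) * (1 - 1 / real c) ^ t < 1"
  shows "\<exists>A. A \<subseteq> V - F \<and> card A \<le> M * t \<and> (\<forall>v\<in>V. M \<le> card (N v \<inter> A))"
  using N
proof (induction M)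
  case 0
  then show ?case by (intro exI[of _ "{}"]) auto
next
  case (Suc M)
  have "card V \<le> c * (card (N v) - (card F + M * t))" if "v \<in> V" for v
  proof -
    have "card V \<le> c * (card (N v) - (card F + Suc M * t))" using Suc.prems[OF that] by blast
    also have "\<dots> \<le> c * (card (N v) - (card F + M * t))" by (intro mult_left_mono) auto
    finally show ?thesis .
  qed
  then obtain A where A: "A \<subseteq> V - F" "card A \<le> M * t" and h: "\<And>v. v \<in> V \<Longrightarrow> M \<le> card (N v \<inter> A)"
    using Suc.IH Suc.prems by (metis (no_types, lifting))
  have fA: "finite A" using A(1) fin finite_subset by (metis finite_Diff)
  let ?N = "\<lambda>v. N v - (F \<union> A)"
  have "?N v \<subseteq> V \<and> card V \<le> c * card (?N v)" if v: "v \<in> V" for v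
  proof
    show "?N v \<subseteq> V" using Suc.prems[OF v] by blast
    have "card (F \<union> A) \<le> card F + M * t" using card_Un_le[of F A] A(2) by linarith
    then have "card (N v) - (card F + Suc M * t) \<le> card (?N v)"
      using diff_card_le_card_Diff[of "F \<union> A" "N v"] F fA by simp
    then have "c * (card (N v) - (card F + Suc M * t)) \<le> c * card (?N v)" by (intro mult_left_mono) auto
    moreover have "card V \<le> c * (card (N v) - (card F + Suc M * t))" using Suc.prems[OF v] by blast
    ultimately show "card V \<le> c * card (?N v)" by linarith
  qed
  then obtain B where B: "B \<subseteq> V" "card B \<le> t" "real (card {v \<in> V. ?N v \<inter> B = {}}) \<le> real (card V) * (1 - 1 / real c) ^ t"
    using greedy_hitting[OF fin _ c, of ?N t] by blast
  have "card {v \<in> V. ?N v \<inter> B = {}} = 0" using B(3) t by linarith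
  then have hit: "?N v \<inter> B \<noteq> {}" if "v \<in> V" for v using that fin by auto
  have fB: "finite B" using B fin finite_subset by blast
  let ?A = "A \<union> (B - (F \<union> A))"
  have "Suc M \<le> card (N v \<inter> ?A)" if v: "v \<in> V" for v
  proof -
    obtain b where b: "b \<in> N v" "b \<notin> F \<union> A" "b \<in> B" using hit[OF v] by blast
    have "card (insert b (N v \<inter> A)) = Suc (card (N v \<inter> A))" using b fA by simp
    moreover have "card (insert b (N v \<inter> A)) \<le> card (N v \<inter> ?A)"
      using b fA fB by (intro card_mono) auto
    ultimately show ?thesis using h[OF v] by simp
  qed
  moreover have "card ?A \<le> Suc M * t"
    using card_Un_le[of A "B - (F \<union> A)"] A(2) B(2) card_mono[OF fB, of "B - (F \<union> A)"] by auto
  moreover have "?A \<subseteq> V - F" using A(1) B(1) by blast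
  ultimately show ?case by blast
qed

context dense_regular
begin

text \<open>\<open>K\<close> is a spanning tree of a graph \<open>H\<close> made of one path per
  class, the edges \<open>J\<close> joining the classes, and an edge from each end \<open>v\<close>
  of \<open>J\<close> to a private vertex \<open>a v\<close> on a path. Degrees in \<open>H\<close>:
  at most \<open>(q - 1) + 1 \<le> k\<close> at the ends of \<open>J\<close>, at most
  \<open>2 + 1 \<le> k\<close> at the vertices \<open>a v\<close>, and at most 2 at other path
  vertices. As \<open>A\<close> avoids both special kinds, its elements have an edge to
  spare.\<close>

lemma skeleton:
  assumes M: "M \<ge> 1" and sq: "(k * L + 1)\<^sup>2 \<le> r" and lin: "4 * (k + 1) * L \<le> r"
    and L: "3 * k + (M * t + 2 * k) * (3 * (2 * k + 3)) \<le> L"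
    and t: "real (card V) * (1 - 1 / real (2 * (k + 1))) ^ t < 1"
  obtains X K A where "X \<subseteq> V" "card X \<le> L" "K \<subseteq> E" "tree_graph X K" "A \<subseteq> X"
    "\<And>x. x \<in> X \<Longrightarrow> graph_degree K x \<le> k" "\<And>x. x \<in> A \<Longrightarrow> Suc (graph_degree K x) \<le> k"
    "\<And>v. v \<in> V \<Longrightarrow> M \<le> card (nbrs E v \<inter> A)"
proof -
  let ?D = "3 * (2 * k + 3)"
  have "4 * k \<le> 3 * k + (M * t + 2 * k) * ?D" by (simp add: algebra_simps)
  then have L4: "4 * k \<le> L" using L by linarith
  have Mt: "M * t \<le> L" using L by (simp add: algebra_simps)
  have kLL: "4 * (k * L) + 4 * L \<le> r" using lin by (simp add: algebra_simps)
  have k1: "1 \<le> k" using k3 by simp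
  have L1: "1 \<le> L" using L4 k1 by linarith
  obtain S lab q where l: "labelling S lab q" and S: "card S \<le> k * L" and q: "1 \<le> q" "q \<le> k" and
    rob: "\<And>i Y Z. i < q \<Longrightarrow> Y \<subseteq> V \<Longrightarrow> card Y \<le> L \<Longrightarrow> closed_in (part S lab i - Y) Z \<Longrightarrow> Z = part S lab i - Y"
    using robust_labelling[OF sq L1] by blast
  let ?C = "part S lab"
  have SV: "S \<subseteq> V" and img: "lab ` (V - S) = {..<q}" using l by (auto simp: labelling_def)
  have fS: "finite S" using SV finV finite_subset by blast
  have fC: "finite (?C i)" and CV: "?C i \<subseteq> V - S" for i using finV by (auto simp: part_def)
  have Cdisj: "?C i \<inter> ?C j = {}" if "i \<noteq> j" for i j using that by (auto simp: part_def)
  have Cdeg: "r - k * L \<le> card (nbrs E v \<inter> ?C i)" if v: "v \<in> ?C i" for v i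
  proof -
    have "nbrs E v - S \<subseteq> nbrs E v \<inter> ?C i" using nbrs_part[OF l v] by blast
    then have "card (nbrs E v - S) \<le> card (nbrs E v \<inter> ?C i)" by (intro card_mono) auto
    moreover have "card (nbrs E v) - card S \<le> card (nbrs E v - S)" by (rule diff_card_le_card_Diff[OF fS])
    moreover have "card (nbrs E v) = r" using deg CV v by blast
    ultimately show ?thesis using S by linarith
  qed
  \<comment> \<open>\<open>W\<close> will have at most \<open>2 * k\<close> elements, which must be
    avoided and also need distinct neighbours: \<open>4 * k\<close> suffices. A vertex of
    \<open>S\<close> gets its class by pigeonhole.\<close>
  have "\<exists>i<q. 4 * k \<le> card (nbrs E v \<inter> ?C i) \<and> (v \<in> V - S \<longrightarrow> i = lab v)" if v: "v \<in> V" for v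
  proof (cases "v \<in> S")
    case False
    then have "v \<in> ?C (lab v)" "lab v < q" using v img by (auto simp: part_def)
    then show ?thesis using Cdeg[of v "lab v"] kLL L4 by (intro exI[of _ "lab v"]) linarith
  next
    case True
    have "\<exists>i<q. 4 * k \<le> card (nbrs E v \<inter> ?C i)"
    proof (rule ccontr)
      assume neg: "\<not> ?thesis"
      have "nbrs E v \<subseteq> S \<union> (\<Union>i<q. nbrs E v \<inter> ?C i)"
        using nbrs_V[of v] img by (fastforce simp: part_def)
      then have "card (nbrs E v) \<le> card (S \<union> (\<Union>i<q. nbrs E v \<inter> ?C i))"
        using fS by (intro card_mono) auto
      also have "\<dots> \<le> card S + card (\<Union>i<q. nbrs E v \<inter> ?C i)" by (rule card_Un_le)
      also have "card (\<Union>i<q. nbrs E v \<inter> ?C i) \<le> (\<Sum>i<q. card (nbrs E v \<inter> ?C i))"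
        by (rule card_UN_le) simp
      also have "\<dots> \<le> (\<Sum>i<q. 4 * k)" using neg by (intro sum_mono) force
      also have "\<dots> = q * (4 * k)" by simp
      also have "\<dots> \<le> k * L" using q L4 by (intro mult_mono) auto
      finally show False using deg[OF v] S kLL L1 by linarith
    qed
    then show ?thesis using True by blast
  qed
  then have "\<forall>v\<in>V. \<exists>i. i < q \<and> 4 * k \<le> card (nbrs E v \<inter> ?C i) \<and> (v \<in> V - S \<longrightarrow> i = lab v)" by blast
  then obtain cls where "\<forall>v\<in>V. cls v < q \<and> 4 * k \<le> card (nbrs E v \<inter> ?C (cls v)) \<and> (v \<in> V - S \<longrightarrow> cls v = lab v)"
    by (rule bchoice[THEN exE])
  then have cls: "\<And>v. v \<in> V \<Longrightarrow> cls v < q" "\<And>v. v \<in> V \<Longrightarrow> 4 * k \<le> card (nbrs E v \<inter> ?C (cls v))"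
    "\<And>v. v \<in> V - S \<Longrightarrow> cls v = lab v" by blast+
  have "lab ` (V - S) \<subseteq> cls ` V" using cls(3) by (metis DiffD1 image_eqI image_subsetI)
  then have clsV: "cls ` V = {..<q}" using cls(1) img by auto
  obtain I J where "I \<subseteq> {..<q}" "card I = q" and J: "J \<subseteq> E" "finite J" "card J \<le> q - 1" and
    reachI: "\<forall>i\<in>I. (0, i) \<in> {(cls u, cls v) | u v. {u, v} \<in> J}\<^sup>*"
    using class_tree[OF conn G clsV q(1) order_refl] by blast
  then have "I = {..<q}" by (metis card_lessThan card_subset_eq finite_lessThan)
  then have reach: "(0, i) \<in> {(cls u, cls v) | u v. {u, v} \<in> J}\<^sup>*" if "i < q" for i using reachI that by blast
  define W where "W = \<Union>J"
  have JV: "e \<subseteq> V" "card e = 2" if "e \<in> J" for e using that J G by (auto simp: simple_graph_def)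
  have WV: "W \<subseteq> V" using JV by (auto simp: W_def)
  have fW: "finite W" using WV finV finite_subset by blast
  have "card W \<le> (\<Sum>e\<in>J. card e)" unfolding W_def by (rule card_Union_le_sum_card)
  also have "\<dots> = 2 * card J" using JV by simp
  finally have cW: "card W \<le> 2 * k" using J(3) q by linarith
  have "1 ^ card W \<le> card {g \<in> PiE W (\<lambda>v. nbrs E v \<inter> ?C (cls v) - W). inj_on g W}"
  proof (rule card_inj_PiE_ge[OF fW])
    fix v assume v: "v \<in> W"
    have "card (nbrs E v \<inter> ?C (cls v)) - card W \<le> card (nbrs E v \<inter> ?C (cls v) - W)"
      by (rule diff_card_le_card_Diff[OF fW])
    then show "1 + card W \<le> card (nbrs E v \<inter> ?C (cls v) - W) + 1" using cls(2)[of v] v WV cW by force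
  qed simp
  then have "{g \<in> PiE W (\<lambda>v. nbrs E v \<inter> ?C (cls v) - W). inj_on g W} \<noteq> {}"
    by (metis card.empty not_one_le_zero power_one)
  then obtain a where aP: "a \<in> PiE W (\<lambda>v. nbrs E v \<inter> ?C (cls v) - W)" and ainj: "inj_on a W" by blast
  have a: "a v \<in> nbrs E v" "a v \<in> ?C (cls v)" "a v \<notin> W" if "v \<in> W" for v using PiE_mem[OF aP that] by auto
  define F where "F = S \<union> W \<union> a ` W"
  have fF: "finite F" using fS fW by (simp add: F_def)
  have "card F \<le> card S + card W + card (a ` W)"
    unfolding F_def using card_Un_le[of "S \<union> W" "a ` W"] card_Un_le[of S W] by linarith
  then have cF: "card F \<le> k * L + 4 * k" using S cW card_image_le[OF fW, of a] by linarith
  have "\<exists>A. A \<subseteq> V - F \<and> card A \<le> M * t \<and> (\<forall>v\<in>V. M \<le> card (nbrs E v \<inter> A))"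
  proof (rule multi_hitting[OF finV fF _ _ t])
    fix v assume v: "v \<in> V"
    have "card F + M * t \<le> k * L + L + L" using cF Mt L4 by linarith
    then have "r \<le> 2 * (card (nbrs E v) - (card F + M * t))" using deg[OF v] kLL by linarith
    then have "(k + 1) * r \<le> (k + 1) * (2 * (card (nbrs E v) - (card F + M * t)))" by (rule mult_left_mono) simp
    then show "nbrs E v \<subseteq> V \<and> card V \<le> 2 * (k + 1) * (card (nbrs E v) - (card F + M * t))"
      using dens nbrs_V by (simp add: algebra_simps)
  qed simp
  then obtain A where A: "A \<subseteq> V - F" "card A \<le> M * t" "\<And>v. v \<in> V \<Longrightarrow> M \<le> card (nbrs E v \<inter> A)" by blast
  have fA: "finite A" using A(1) finV finite_subset by (metis finite_Diff)
  define T where "T = (\<lambda>i. (A \<union> a ` W) \<inter> ?C i)"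
  have fT: "finite (T i)" for i using fC by (simp add: T_def)
  have cAW: "card (A \<union> a ` W) \<le> M * t + 2 * k"
    using card_Un_le[of A "a ` W"] A(2) card_image_le[OF fW, of a] cW by linarith
  have "\<exists>X P e. upath E X P e \<and> T i \<subseteq> X \<and> X \<subseteq> ?C i - W \<and> card X \<le> 1 + card (T i) * ?D" if i: "i < q" for i
  proof (rule upath_through[OF fC fW])
    show "Z = ?C i - Y" if Y: "finite Y" "card Y \<le> L" and Z: "Z \<subseteq> ?C i - Y" "Z \<noteq> {}"
      "\<And>x. x \<in> Z \<Longrightarrow> nbrs E x \<inter> (?C i - Y) \<subseteq> Z" for Y Z
    proof -
      have eq: "?C i - Y = ?C i - (Y \<inter> V)" using CV by blast
      have "closed_in (?C i - (Y \<inter> V)) Z" unfolding closed_in_def eq[symmetric] using Z by blast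
      moreover have "card (Y \<inter> V) \<le> L" using Y card_mono[OF Y(1), of "Y \<inter> V"] by simp
      ultimately show ?thesis using rob[OF i] eq by blast
    qed
    show "(r - k * L - L) + L \<le> card (nbrs E x \<inter> ?C i)" if "x \<in> ?C i" for x
      using Cdeg[OF that] kLL by linarith
    \<comment> \<open>Degrees stay at least \<open>r / 2\<close> after deletions and
      \<open>card V \<le> (k + 1) * r\<close>, so \<open>2 * k + 3\<close> is large enough for
      \<open>m\<close> in \<open>upath_through\<close>.\<close>
    have "r \<le> 2 * (r - k * L - L)" using kLL by linarith
    then have "(2 * k + 3) * r \<le> 2 * ((2 * k + 3) * (r - k * L - L))"
      using mult_left_mono[of r "2 * (r - k * L - L)" "2 * k + 3"] by (simp add: mult_ac)
    moreover have "?C i \<subseteq> V" using CV by blast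
    then have "card (?C i) \<le> card V" by (rule card_mono[OF finV])
    moreover have "2 * ((k + 1) * r) < (2 * k + 3) * r" using kLL L1 by (simp add: algebra_simps)
    ultimately show "card (?C i) < (2 * k + 3) * (r - k * L - L)" using dens by linarith
    show "T i \<noteq> {}"
    proof -
      have "i \<in> lab ` (V - S)" using img i by simp
      then obtain v where v: "v \<in> ?C i" by (auto simp: part_def)
      have "1 \<le> card (nbrs E v \<inter> A)" using A(3)[of v] M v CV by fastforce
      then have "nbrs E v \<inter> A \<noteq> {}" by auto
      then obtain x where x: "x \<in> nbrs E v" "x \<in> A" by blast
      then have "x \<notin> S" using A(1) by (auto simp: F_def)
      then show ?thesis using x nbrs_part[OF l v] by (auto simp: T_def)
    qed
    show "T i \<subseteq> ?C i - W" using A(1) a(3) by (auto simp: T_def F_def)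
    have "card (T i) \<le> card (A \<union> a ` W)" using fA fW by (intro card_mono) (auto simp: T_def)
    then have "card (T i) * ?D \<le> (M * t + 2 * k) * ?D" using cAW by (intro mult_right_mono) auto
    then show "card W + 1 + card (T i) * ?D \<le> L" using L cW k1 by linarith
  qed (rule fT)
  then obtain Xs P es where path: "\<And>i. i < q \<Longrightarrow> upath E (Xs i) (P i) (es i)" "\<And>i. i < q \<Longrightarrow> T i \<subseteq> Xs i"
    "\<And>i. i < q \<Longrightarrow> Xs i \<subseteq> ?C i - W" "\<And>i. i < q \<Longrightarrow> card (Xs i) \<le> 1 + card (T i) * ?D" by metis
  define H where "H = (\<Union>i<q. P i) \<union> J \<union> (\<lambda>v. {v, a v}) ` W"
  define X where "X = (\<Union>i<q. Xs i) \<union> W"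
  have XV: "X \<subseteq> V" using path(3) CV WV by (fastforce simp: X_def)
  have PX: "e \<subseteq> Xs i" if "e \<in> P i" "i < q" for e i
    using upath_tree[OF path(1)[OF that(2)]] that(1) by (auto simp: tree_graph_def simple_graph_def)
  have aX: "a v \<in> Xs (cls v)" "cls v < q" if "v \<in> W" for v
  proof -
    show c: "cls v < q" using cls(1) that WV by blast
    show "a v \<in> Xs (cls v)" using path(2)[OF c] a(2)[OF that] that by (auto simp: T_def)
  qed
  have HE: "H \<subseteq> E" using upath_subset[OF path(1)] J(1) a(1) by (fastforce simp: H_def nbrs_def)
  have HX: "e \<subseteq> X" if "e \<in> H" for e
    using that PX aX by (fastforce simp: H_def X_def W_def)
  have sH: "simple_graph X H" using HX HE G finite_subset[OF XV finV] by (auto simp: simple_graph_def)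
  have q0: "0 < q" using q by simp
  obtain x0 where x0: "x0 \<in> Xs 0" using upath_end[OF path(1)[OF q0]] by blast
  have inX: "(x, y) \<in> (adj H)\<^sup>*" if "x \<in> Xs i" "y \<in> Xs i" "i < q" for x y i
  proof -
    have "(x, y) \<in> (adj (P i))\<^sup>*"
      using upath_tree[OF path(1)[OF that(3)]] that by (auto simp: tree_graph_def connected_graph_adj)
    moreover have "P i \<subseteq> H" using that(3) by (auto simp: H_def)
    ultimately show ?thesis using adj_mono by blast
  qed
  have cH: "(x, y) \<in> (adj H)\<^sup>*" if "{x, y} \<in> H" for x y using that by (auto simp: adj_def)
  have aH: "{v, a v} \<in> H" if "v \<in> W" for v using that by (auto simp: H_def)
  have all: "(\<forall>x\<in>Xs j. (x0, x) \<in> (adj H)\<^sup>*) \<and> (\<forall>v\<in>W. cls v = j \<longrightarrow> (x0, v) \<in> (adj H)\<^sup>*)" if j: "j < q" for j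
  proof -
    have vW: "(x0, v) \<in> (adj H)\<^sup>*" if "\<forall>x\<in>Xs (cls v). (x0, x) \<in> (adj H)\<^sup>*" "v \<in> W" for v
    proof -
      have "(x0, a v) \<in> (adj H)\<^sup>*" using that aX by blast
      moreover have "(a v, v) \<in> (adj H)\<^sup>*" using cH[OF aH[OF that(2)]] by (rule adj_rtrancl_sym)
      ultimately show ?thesis by (rule rtrancl_trans)
    qed
    \<comment> \<open>From the path of one class to the next: through \<open>a u\<close> to
      \<open>u\<close>, along an edge of \<open>J\<close> to \<open>v\<close>, and on to
      \<open>a v\<close>.\<close>
    have "(\<forall>x\<in>Xs j. (x0, x) \<in> (adj H)\<^sup>*)" using reach[OF j] j
    proof (induction rule: rtrancl_induct)
      case base
      then show ?case using inX[OF x0] by blast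
    next
      case (step j j')
      then obtain u v where uv: "j = cls u" "j' = cls v" "{u, v} \<in> J" by blast
      have W: "u \<in> W" "v \<in> W" using uv by (auto simp: W_def)
      have "(x0, u) \<in> (adj H)\<^sup>*" using vW[OF _ W(1)] step.IH aX(2)[OF W(1)] uv by blast
      moreover have "(u, v) \<in> (adj H)\<^sup>*" using uv by (intro cH) (auto simp: H_def)
      moreover have "(v, a v) \<in> (adj H)\<^sup>*" by (rule cH[OF aH[OF W(2)]])
      ultimately have "(x0, a v) \<in> (adj H)\<^sup>*" by (meson rtrancl_trans)
      then show ?case using inX[OF aX(1)[OF W(2)] _ aX(2)[OF W(2)]] uv by (meson rtrancl_trans)
    qed
    then show ?thesis using vW by blast
  qed
  have "connected_graph X H"
  proof (rule connected_graphI_root)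
    show "x0 \<in> X" using x0 q by (auto simp: X_def)
    fix v assume "v \<in> X"
    then consider i where "i < q" "v \<in> Xs i" | "v \<in> W" by (auto simp: X_def)
    then show "(x0, v) \<in> (adj H)\<^sup>*"
    proof cases
      case 1 then show ?thesis using all by blast
    next
      case 2 then show ?thesis using all[OF aX(2)[OF 2]] by blast
    qed
  qed
  then obtain K where K: "K \<subseteq> H" "tree_graph X K" using spanning_tree_exists[OF sH] by blast
  have fH: "finite H" by (rule finite_edges[OF sH])
  have dW: "graph_degree H v \<le> k" if v: "v \<in> W" for v
  proof -
    have "{e \<in> H. v \<in> e} \<subseteq> insert {v, a v} J"
    proof
      fix e assume e: "e \<in> {e \<in> H. v \<in> e}"
      then consider i where "i < q" "e \<in> P i" | "e \<in> J" | w where "w \<in> W" "e = {w, a w}" by (auto simp: H_def)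
      then show "e \<in> insert {v, a v} J"
      proof cases
        case 1
        then show ?thesis using PX path(3) e v by blast
      next
        case 3
        then show ?thesis using e v a(3) by auto
      qed simp
    qed
    then have "graph_degree H v \<le> card (insert {v, a v} J)"
      unfolding graph_degree_def using J(2) by (intro card_mono) auto
    also have "\<dots> \<le> Suc (card J)" by (rule card_insert_le_m1) auto
    finally show ?thesis using J(3) q by linarith
  qed
  have dX: "graph_degree H x \<le> 2 + card {w \<in> W. a w = x}" if x: "x \<in> Xs i" "i < q" for x i
  proof -
    have "{e \<in> H. x \<in> e} \<subseteq> {e \<in> P i. x \<in> e} \<union> (\<lambda>w. {w, a w}) ` {w \<in> W. a w = x}"
    proof
      fix e assume e: "e \<in> {e \<in> H. x \<in> e}"
      have xW: "x \<notin> W" using x path(3) by blast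
      consider j where "j < q" "e \<in> P j" | "e \<in> J" | w where "w \<in> W" "e = {w, a w}" using e by (auto simp: H_def)
      then show "e \<in> {e \<in> P i. x \<in> e} \<union> (\<lambda>w. {w, a w}) ` {w \<in> W. a w = x}"
      proof cases
        case 1
        have "x \<in> ?C j" using PX[OF 1(2,1)] path(3)[OF 1(1)] e by blast
        moreover have "x \<in> ?C i" using x path(3) by blast
        ultimately have "j = i" using Cdisj by blast
        then show ?thesis using 1 e by blast
      next
        case 2
        then show ?thesis using xW e by (auto simp: W_def)
      next
        case 3
        then show ?thesis using xW e by auto
      qed
    qed
    moreover have "finite (P i)" using upath_subset[OF path(1)[OF x(2)]] finite_edges[OF G] finite_subset by blast
    ultimately have "graph_degree H x \<le> card ({e \<in> P i. x \<in> e} \<union> (\<lambda>w. {w, a w}) ` {w \<in> W. a w = x})"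
      unfolding graph_degree_def using fW by (intro card_mono) auto
    also have "\<dots> \<le> card {e \<in> P i. x \<in> e} + card ((\<lambda>w. {w, a w}) ` {w \<in> W. a w = x})" by (rule card_Un_le)
    also have "card {e \<in> P i. x \<in> e} \<le> 2" using upath_degree[OF path(1)[OF x(2)]] by (simp add: graph_degree_def)
    also have "card ((\<lambda>w. {w, a w}) ` {w \<in> W. a w = x}) \<le> card {w \<in> W. a w = x}" using fW by (intro card_image_le) auto
    finally show ?thesis by simp
  qed
  have KH: "graph_degree K x \<le> graph_degree H x" for x by (rule graph_degree_mono[OF fH K(1)])
  have AXs: "\<exists>i<q. x \<in> Xs i" if x: "x \<in> A" for x
  proof -
    have xV: "x \<in> V - S" using x A(1) by (auto simp: F_def)
    then have i: "lab x < q" "x \<in> ?C (lab x)" using img by (auto simp: part_def)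
    then show ?thesis using path(2)[OF i(1)] x by (auto simp: T_def)
  qed
  show ?thesis
  proof (rule that[of X K A])
    show "X \<subseteq> V" by (rule XV)
    show "K \<subseteq> E" using K HE by blast
    show "tree_graph X K" by (rule K)
    show "A \<subseteq> X" using AXs by (auto simp: X_def)
    show "M \<le> card (nbrs E v \<inter> A)" if "v \<in> V" for v by (rule A(3)[OF that])
    show "Suc (graph_degree K x) \<le> k" if x: "x \<in> A" for x
    proof -
      obtain i where i: "i < q" "x \<in> Xs i" using AXs[OF x] by blast
      have "x \<notin> a ` W" using x A(1) by (auto simp: F_def)
      then have "{w \<in> W. a w = x} = {}" by blast
      then have "graph_degree H x \<le> 2 + card ({} :: 'a set)" using dX[OF i(2,1)] by (simp only:)
      then show ?thesis using KH[of x] k3 by simp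
    qed
    show "graph_degree K x \<le> k" if xX: "x \<in> X" for x
    proof -
      consider i where "i < q" "x \<in> Xs i" | "x \<in> W" using xX by (auto simp: X_def)
      then show ?thesis
      proof cases
        case 1
        have "card {w \<in> W. a w = x} \<le> Suc 0"
          using card_le_Suc0_iff_eq[of "{w \<in> W. a w = x}"] fW ainj by (auto simp: inj_on_def)
        then show ?thesis using dX[OF 1(2,1)] KH[of x] k3 by linarith
      next
        case 2
        then show ?thesis using dW[OF 2] KH[of x] by linarith
      qed
    qed
    show "card X \<le> L"
    proof -
      have fXs: "finite (Xs i)" if "i < q" for i using path(3)[OF that] fC finite_subset by blast
      have "card X \<le> card (\<Union>i<q. Xs i) + card W" unfolding X_def by (rule card_Un_le)
      also have "card (\<Union>i<q. Xs i) \<le> (\<Sum>i<q. card (Xs i))" by (rule card_UN_le) simp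
      also have "\<dots> \<le> (\<Sum>i<q. 1 + card (T i) * ?D)" using path(4) by (intro sum_mono) auto
      also have "\<dots> = q + (\<Sum>i<q. card (T i)) * ?D" by (simp only: sum.distrib sum_distrib_right sum_constant card_lessThan) simp
      also have "(\<Sum>i<q. card (T i)) = card (\<Union>i<q. T i)"
        using fT Cdisj by (intro card_UN_disjoint[symmetric]) (auto simp: T_def)
      also have "\<dots> \<le> card (A \<union> a ` W)" using fA fW by (intro card_mono) (auto simp: T_def)
      also have "\<dots> \<le> M * t + 2 * k" by (rule cAW)
      finally have "card X \<le> q + (M * t + 2 * k) * ?D + card W" by simp
      then show ?thesis using cW q L by linarith
    qed
  qed
qed

end

section \<open>The counting inequality\<close>

context dense_regular
begin

text \<open>A chain of comparisons: solvable configurations, partial maps, \<open>start\<close>,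
  \<open>good\<close>, attached forests, bounded-degree trees. The left side is the resulting lower
  bound for \<open>card start\<close>.\<close>

lemma count_inequality:
  assumes X: "X \<subseteq> V" "K \<subseteq> E" "tree_graph X K" "A \<subseteq> X"
    and dg: "\<And>x. x \<in> X \<Longrightarrow> graph_degree K x \<le> k" "\<And>x. x \<in> A \<Longrightarrow> Suc (graph_degree K x) \<le> k"
    and hit: "\<And>v. v \<in> V \<Longrightarrow> M \<le> card (nbrs E v \<inter> A)"
    and solv: "p * real r ^ (t * card V) \<le> real (card {h \<in> configs V (nbrs E) t. solvable V t (k - 2) d0 h})"
    and d: "d0 + (k - 2) * card X \<le> d" "d + card X \<le> card V"
    and room: "h + s + d + m + card X \<le> r" and h: "h > 0" and M: "card V < s * Suc M" and t: "t \<ge> 1"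
  shows "p * real r ^ card V * (real (r - card X - d) / real r) ^ d / (real t ^ card V * real r ^ card X * real (card V choose d))
    \<le> (1 + real s / real h) ^ card V * (real (bounded_tree_count k V E) * real r ^ M)
      + 2 ^ card V * (real s / real h) ^ m * real r ^ card V"
proof -
  let ?n = "card V" and ?x = "card X"
  define U where "U = V - X"
  define N where "N = (\<lambda>v. nbrs E v - X)"
  define NA where "NA = (\<lambda>v. nbrs E v \<inter> A)"
  have r1: "r \<ge> 1" using room h by simp
  have finU: "finite U" and UV: "U \<subseteq> V" using finV by (auto simp: U_def)
  have finX: "finite X" using X(1) finV finite_subset by blast
  have cU: "card U = ?n - ?x" unfolding U_def by (rule card_Diff_subset[OF finX X(1)])
  have NU: "N v \<subseteq> U" for v using nbrs_V by (auto simp: N_def U_def)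
  have cN: "r - ?x \<le> card (N v)" "card (N v) \<le> r" if "v \<in> U" for v
    using diff_card_le_card_Diff[OF finX, of "nbrs E v"] card_mono[OF fin_nbrs, of "nbrs E v - X" v]
      deg[of v] that UV by (auto simp: N_def)
  have red: "redirection U N d m s h"
  proof
    show "h + s + d + m \<le> card (N v)" if "v \<in> U" for v using cN(1)[OF that] room by linarith
  qed (use finU NU h in auto)
  interpret redirection U N "Suc (k - 2)" d m s h by (rule red)
  let ?P = "card (partials U N (k - 2) d)" and ?S = "card start" and ?Q = "r - ?x - d"
  have kk: "Suc (k - 2) = k - 1" using k3 by simp
  have "card {h \<in> configs V (nbrs E) t. solvable V t (k - 2) d0 h}
    \<le> ?P * ((t * r ^ (t - 1)) ^ ?n * r ^ (?x + d))"
    unfolding U_def N_def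
  proof (rule card_solvable_le[OF finV _ X(1) d(1) _ t])
    show "finite (nbrs E v) \<and> card (nbrs E v) = r" if "v \<in> V" for v using deg[OF that] by simp
    show "d \<le> card (V - X)" using cU d(2) by (simp add: U_def)
  qed
  then have "real (card {h \<in> configs V (nbrs E) t. solvable V t (k - 2) d0 h})
    \<le> real (?P * ((t * r ^ (t - 1)) ^ ?n * r ^ (?x + d)))" by (rule of_nat_mono)
  also have "\<dots> = real ?P * ((real t * real r ^ (t - 1)) ^ ?n * real r ^ (?x + d))" by simp
  finally have 1: "p * real r ^ (t * ?n) \<le> real ?P * ((real t * real r ^ (t - 1)) ^ ?n * real r ^ (?x + d))"
    using solv by linarith
  have "?P * ?Q ^ d \<le> ?S * (card U choose d)"
  proof (rule partials_le_start[OF red])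
    show "?Q + d \<le> card (N v) + 1" if "v \<in> U" for v using cN(1)[OF that] room by linarith
  qed
  also have "\<dots> \<le> ?S * (?n choose d)" using cU by (intro mult_left_mono binomial_right_mono) auto
  finally have "real (?P * ?Q ^ d) \<le> real (?S * (?n choose d))" by (rule of_nat_mono)
  then have 2: "real ?P * real ?Q ^ d \<le> real ?S * real (?n choose d)" by simp
  have "real (card (PiE U N)) \<le> real r ^ ?n"
  proof -
    have "card (PiE U N) = (\<Prod>v\<in>U. card (N v))" by (rule card_PiE[OF finU])
    also have "\<dots> \<le> (\<Prod>v\<in>U. r)" using cN(2) by (intro prod_mono) auto
    also have "\<dots> = r ^ card U" by simp
    also have "\<dots> \<le> r ^ ?n" using r1 cU by (intro power_increasing) auto
    finally have "real (card (PiE U N)) \<le> real (r ^ ?n)" by (rule of_nat_mono)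
    then show ?thesis by simp
  qed
  note cP = this
  have "card good \<le> card (attached_forests U N A NA (Suc (k - 2))) * r ^ M"
  proof (rule card_good_le)
    show "A \<inter> U = {}" using X(4) by (auto simp: U_def)
    show "NA v \<subseteq> A \<and> finite (NA v)" for v by (auto simp: NA_def)
    show "card U < s * Suc M" using cU M by linarith
    show "M \<le> card (NA v)" if "v \<in> U" for v using hit[of v] that UV by (auto simp: NA_def)
  qed (use cN(2) r1 in auto)
  also have "card (attached_forests U N A NA (Suc (k - 2))) \<le> bounded_tree_count k V E"
    unfolding kk U_def
  proof (rule card_attached_forests_le[OF G X _ dg])
    show "1 \<le> k" using k3 by simp
    show "N v \<subseteq> nbrs E v - X" for v by (simp add: N_def)
    show "NA v \<subseteq> nbrs E v \<inter> A" for v by (simp add: NA_def)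
  qed
  finally have "real (card good) \<le> real (bounded_tree_count k V E * r ^ M)" by (intro of_nat_mono) simp
  then have cg: "real (card good) \<le> real (bounded_tree_count k V E) * real r ^ M" by simp
  have th: "\<theta> = real s / real h" by (rule \<theta>_def)
  have th0: "0 \<le> real s / real h" by simp
  have "real ?S \<le> (1 + real s / real h) ^ card U * real (card good) + 2 ^ card U * (real s / real h) ^ m * real (card (PiE U N))"
    using start_le_good unfolding th .
  also have "\<dots> \<le> (1 + real s / real h) ^ ?n * (real (bounded_tree_count k V E) * real r ^ M)
      + 2 ^ ?n * (real s / real h) ^ m * real r ^ ?n"
  proof -
    have "(1 + real s / real h) ^ card U \<le> (1 + real s / real h) ^ ?n"
      using cU th0 by (intro power_increasing) auto
    moreover have "(2 :: real) ^ card U \<le> 2 ^ ?n" using cU by (intro power_increasing) auto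
    ultimately show ?thesis using th0 by (intro add_mono mult_mono cg cP order_refl) auto
  qed
  finally have 3: "real ?S \<le> (1 + real s / real h) ^ ?n * (real (bounded_tree_count k V E) * real r ^ M)
      + 2 ^ ?n * (real s / real h) ^ m * real r ^ ?n" .
  have rpos: "real r > 0" using r1 by simp
  have Cpos: "real (?n choose d) > 0" using d(2) by simp
  have tpos: "real t > 0" using t by simp
  \<comment> \<open>Both sides share the factor \<open>r ^ (t' * ?n)\<close>, the freedom of the
    proposals not selected.\<close>
  obtain t' where t': "t = Suc t'" using t by (cases t) auto
  have "(p * real r ^ (t * ?n)) * real ?Q ^ d
    \<le> (real ?P * ((real t * real r ^ (t - 1)) ^ ?n * real r ^ (?x + d))) * real ?Q ^ d"
    by (intro mult_right_mono[OF 1]) simp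
  also have "\<dots> = (real ?P * real ?Q ^ d) * ((real t * real r ^ (t - 1)) ^ ?n * real r ^ (?x + d))" by simp
  also have "\<dots> \<le> (real ?S * real (?n choose d)) * ((real t * real r ^ (t - 1)) ^ ?n * real r ^ (?x + d))"
    by (intro mult_right_mono[OF 2]) simp
  finally have "p * real r ^ (t * ?n) * real ?Q ^ d
    \<le> real ?S * real (?n choose d) * ((real t * real r ^ (t - 1)) ^ ?n * real r ^ (?x + d))" .
  also have "\<dots> = real r ^ (t' * ?n) * (real ?S * (real t ^ ?n * real r ^ ?x * real (?n choose d)) * real r ^ d)"
    by (simp add: t' power_mult_distrib power_mult[symmetric] power_add mult_ac)
  also have "p * real r ^ (t * ?n) * real ?Q ^ d = real r ^ (t' * ?n) * (p * real r ^ ?n * real ?Q ^ d)"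
    by (simp add: t' power_add mult_ac)
  finally have "p * real r ^ ?n * real ?Q ^ d \<le> real ?S * (real t ^ ?n * real r ^ ?x * real (?n choose d)) * real r ^ d"
    using rpos by simp
  then have "p * real r ^ ?n * (real ?Q / real r) ^ d / (real t ^ ?n * real r ^ ?x * real (?n choose d)) \<le> real ?S"
    using rpos Cpos tpos by (simp add: power_divide divide_le_eq mult_ac)
  then show ?thesis using 3 by linarith
qed

end

text \<open>A single term of the binomial expansion of \<open>(y + (1 - y)) ^ n\<close>.\<close>

lemma binomial_entropy:
  fixes y :: real
  assumes "0 \<le> y" "y \<le> 1"
  shows "real (n choose d) * (y ^ d * (1 - y) ^ (n - d)) \<le> 1"
proof (cases "d \<le> n")
  case True
  have "(\<Sum>i\<le>n. real (n choose i) * y ^ i * (1 - y) ^ (n - i)) = (y + (1 - y)) ^ n"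
    by (rule binomial_ring[symmetric])
  moreover have "real (n choose d) * y ^ d * (1 - y) ^ (n - d) \<le> (\<Sum>i\<le>n. real (n choose i) * y ^ i * (1 - y) ^ (n - i))"
    using True assms by (intro member_le_sum) auto
  ultimately show ?thesis by (simp add: mult.assoc)
qed (simp add: binomial_eq_0)

section \<open>Asymptotics\<close>

text \<open>Bound for the size of the skeleton: it exceeds the logarithmic size required, its square
  is still \<open>o(n)\<close>, and \<open>n\<close> to this power is subexponential.\<close>

definition margin :: "nat \<Rightarrow> nat" where
  "margin n = nat \<lfloor>real n powr (1/4)\<rfloor>"

lemma margin_le: "real (margin n) \<le> real n powr (1/4)"
  by (simp add: margin_def)

lemma margin_ge: "real (margin n) \<ge> real n powr (1/4) - 1"
  unfolding margin_def by linarith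

lemma eventually_powr_exp_le:
  fixes g M C :: real
  assumes "g > 0" "C > 0"
  shows "\<forall>\<^sub>F n in sequentially. real n powr (real n powr (1/4) + M) * exp (- (g * real n)) \<le> C"
proof -
  have "(\<lambda>n::nat. real n powr (real n powr (1/4) + M) * exp (- (g * real n))) \<longlonglongrightarrow> 0"
    using assms(1) by real_asymp
  then have "\<forall>\<^sub>F n in sequentially. real n powr (real n powr (1/4) + M) * exp (- (g * real n)) < C"
    using assms(2) by (rule order_tendstoD)
  then show ?thesis by eventually_elim simp
qed

lemma eventually_powr_power_le:
  fixes a M C :: real
  assumes "0 < a" "a < 1" "C > 0"
  shows "\<forall>\<^sub>F n in sequentially. real n powr (real n powr (1/4) + M) * a ^ n \<le> C"
proof -
  have eq: "a ^ n = exp (- ((- ln a) * real n))" for n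
    using assms by (simp add: exp_of_nat_mult[symmetric] exp_ln mult.commute)
      (metis exp_ln exp_of_nat_mult)
  show ?thesis unfolding eq using assms by (intro eventually_powr_exp_le) auto
qed

text \<open>Common to all \<open>k\<close>: \<open>x n\<close> values are dropped, a fraction
  \<open>p\<close> of the configurations is solvable, and \<open>b\<close> is the resulting rate per
  vertex. All remaining losses are at most \<open>(1 + \<theta>) ^ n\<close> times a subexponential
  factor.\<close>

lemma asymptotic_core:
  fixes k t :: nat and x b p \<delta> :: real
  assumes k: "k \<ge> 3" and b: "0 < b" and p: "0 < p" and t: "t \<ge> 1"
    and x: "0 < x" "(real k + 1) * x < 1" and \<delta>: "0 < \<delta>"
    and solv: "\<forall>\<^sub>F n in sequentially. \<forall>(V :: 'a set) E r. dense_regular V E r k \<and> card V = n \<longrightarrow>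
      p * real r ^ (t * n) \<le> real (card {h \<in> configs V (nbrs E) t.
        solvable V t (k - 2) (nat \<lfloor>x * real n\<rfloor> - (k - 2) * margin n) h})"
    and ent: "\<forall>\<^sub>F n in sequentially. \<forall>r X. n \<le> (k + 1) * r \<and> X \<le> margin n \<longrightarrow>
      b ^ n * (real t ^ n * real (n choose nat \<lfloor>x * real n\<rfloor>))
        \<le> (real (r - X - nat \<lfloor>x * real n\<rfloor>) / real r) ^ nat \<lfloor>x * real n\<rfloor>"
  shows "\<forall>\<^sub>F n in sequentially. \<forall>(V :: 'a set) E r. dense_regular V E r k \<and> card V = n \<longrightarrow>
      (1 - \<delta>) * (real r * b) \<le> root n (real (bounded_tree_count k V E))"
proof -
  \<comment> \<open>Ensures
    \<open>(1 - \<epsilon>) / (1 + \<epsilon>) \<ge> 1 - \<delta>\<close>.\<close>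
  define \<epsilon> where "\<epsilon> = min \<delta> 1 / 4"
  have eps: "0 < \<epsilon>" "\<epsilon> \<le> 1/4" "4 * \<epsilon> \<le> \<delta>" using \<delta> by (auto simp: \<epsilon>_def)
  define K where "K = real k + 1"
  have K: "K > 0" by (simp add: K_def)
  have k0: "real k > 0" using k by simp
  define \<kappa> where "\<kappa> = 1 - K * x"
  have kap: "0 < \<kappa>" using x by (simp add: \<kappa>_def K_def)
  \<comment> \<open>The slack \<open>1 / K - x\<close> equals \<open>8 * \<eta>\<close>;
    \<open>h\<close> and \<open>m\<close> take about \<open>\<eta> n\<close> each, and
    \<open>s\<close> takes about \<open>\<gamma> n \<le> \<eta> n\<close>.\<close>
  define \<eta> where "\<eta> = \<kappa> / (8 * K)"
  have eta: "0 < \<eta>" using kap K by (simp add: \<eta>_def)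
  \<comment> \<open>The second bound gives \<open>\<theta> ^ m \<le> (b / 8) ^ n\<close>, which
    makes the truncation term \<open>2 ^ n * \<theta> ^ m\<close> exponentially smaller than
    \<open>b ^ n\<close>.\<close>
  define \<theta> where "\<theta> = min \<epsilon> ((b / 8) powr (1 / \<eta>))"
  have th: "0 < \<theta>" "\<theta> \<le> \<epsilon>" using eps b by (auto simp: \<theta>_def)
  \<comment> \<open>The factor 2 leaves room for rounding in
    \<open>s / h \<le> \<theta>\<close>.\<close>
  define \<gamma> where "\<gamma> = \<eta> * \<theta> / 2"
  have gam: "0 < \<gamma>" "\<gamma> \<le> \<eta>" using eta th eps by (auto simp: \<gamma>_def field_simps)
  \<comment> \<open>The number of cycles that may survive, a constant since each lies in a component
    of size at least \<open>\<gamma> n\<close>.\<close>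
  define M where "M = Suc (nat \<lceil>1 / \<gamma>\<rceil>)"
  have M: "M \<ge> 1" "real M \<ge> 1 / \<gamma>" by (simp_all add: M_def) linarith
  define c where "c = 2 * (k + 1)"
  have c: "real c > 0" "c \<ge> 1" by (simp_all add: c_def)
  \<comment> \<open>Greedy hitting shrinks the unhit set by \<open>1 - 1 / c\<close> per step, so
    just over \<open>c * ln n\<close> steps hit everything.\<close>
  define T where "T = (\<lambda>n::nat. nat \<lfloor>real c * ln (real n)\<rfloor> + 1)"
  define \<rho> where "\<rho> = 1 / K - x - 2 * \<eta> - \<gamma>"
  have "1 / K - x = \<kappa> / K" using K by (simp add: \<kappa>_def field_simps)
  also have "\<dots> = 8 * \<eta>" using K by (simp add: \<eta>_def)
  finally have rho: "\<rho> > 0" using gam eta by (simp add: \<rho>_def)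
  have e1: "\<forall>\<^sub>F n::nat in sequentially. 3 * real k + (real M * (real c * ln (real n) + 1) + 2 * real k) * (3 * (2 * real k + 3)) \<le> real n powr (1/4) - 1"
    using c by real_asymp
  have e2: "\<forall>\<^sub>F n::nat in sequentially. (real k * real n powr (1/4) + 1)\<^sup>2 \<le> real n / K"
    using K k0 by real_asymp
  have e3: "\<forall>\<^sub>F n::nat in sequentially. 4 * K * real n powr (1/4) \<le> real n / K"
    using K by real_asymp
  have e4: "\<forall>\<^sub>F n::nat in sequentially. real n powr (1/4) + 2 \<le> \<rho> * real n"
    using rho by real_asymp
  have e5: "\<forall>\<^sub>F n::nat in sequentially. 1 + \<theta> \<le> \<gamma> * real n"
    using gam by real_asymp
  have e5': "\<forall>\<^sub>F n::nat in sequentially. 1 \<le> \<eta> * real n"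
    using eta by real_asymp
  have e6: "\<forall>\<^sub>F n::nat in sequentially. real k * real n powr (1/4) \<le> x * real n - 1"
    using x(1) k0 by real_asymp
  have e7: "\<forall>\<^sub>F n::nat in sequentially. real n powr (real n powr (1/4) + 0) * (1/4) ^ n \<le> p / 2"
    using p by (intro eventually_powr_power_le) auto
  have e8: "\<forall>\<^sub>F n::nat in sequentially. real n powr (real n powr (1/4) + real M) * (1 - \<epsilon>) ^ n \<le> p / 2"
    using p eps by (intro eventually_powr_power_le) auto
  show ?thesis
    using solv ent e1 e2 e3 e4 e5 e5' e6 e7 e8 eventually_ge_at_top[of 1]
  proof eventually_elim
    case (elim n)
    show ?case
    proof (intro allI impI)
      fix V :: "'a set" and E r
      assume "dense_regular V E r k \<and> card V = n"
      then have dr: "dense_regular V E r k" and n: "card V = n" by auto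
      interpret dense_regular V E r k by (rule dr)
      let ?q = "real n powr (1/4)" and ?L = "margin n"
      have n1: "n \<ge> 1" using elim(12) .
      have "V \<noteq> {}" using n n1 by auto
      then obtain v0 where v0: "v0 \<in> V" by blast
      have rn: "r \<le> n" using deg[OF v0] card_mono[OF finV nbrs_V[of v0]] n by simp
      have "real n \<le> real ((k + 1) * r)" using dens n of_nat_mono by blast
      then have nr: "real n / K \<le> real r" using K by (simp add: K_def divide_le_eq algebra_simps)
      have "0 < real n / K" using n1 K by simp
      then have r0: "real r > 0" using nr by linarith
      then have r1: "r \<ge> 1" by simp
      have Lq: "real ?L \<le> ?q" "?q - 1 \<le> real ?L" by (rule margin_le margin_ge)+
      have q0: "?q \<ge> 0" by simp
      have ln0: "0 \<le> ln (real n)" using n1 by simp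
      have Tle: "real (T n) \<le> real c * ln (real n) + 1" using ln0 c by (simp add: T_def)
      have Tgt: "real c * ln (real n) < real (T n)" using ln0 c by (simp add: T_def) linarith
      have sk1: "(k * ?L + 1)\<^sup>2 \<le> r"
      proof -
        have "(real k * real ?L + 1)\<^sup>2 \<le> (real k * ?q + 1)\<^sup>2" using Lq by (intro power_mono add_mono mult_left_mono) auto
        moreover have "real ((k * ?L + 1)\<^sup>2) = (real k * real ?L + 1)\<^sup>2" by simp
        ultimately have "real ((k * ?L + 1)\<^sup>2) \<le> real r" using elim(4) nr by linarith
        then show ?thesis by (simp only: of_nat_le_iff)
      qed
      have sk2: "4 * (k + 1) * ?L \<le> r"
      proof -
        have "4 * K * real ?L \<le> 4 * K * ?q" using Lq K by (intro mult_left_mono) auto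
        then have "real (4 * (k + 1) * ?L) \<le> real r" using elim(5) nr by (simp add: K_def algebra_simps)
        then show ?thesis by (simp only: of_nat_le_iff)
      qed
      have sk3: "3 * k + (M * T n + 2 * k) * (3 * (2 * k + 3)) \<le> ?L"
      proof -
        have "3 * real k + (real M * real (T n) + 2 * real k) * (3 * (2 * real k + 3))
          \<le> 3 * real k + (real M * (real c * ln (real n) + 1) + 2 * real k) * (3 * (2 * real k + 3))"
          using Tle by (intro add_mono mult_right_mono mult_left_mono) auto
        also have "\<dots> \<le> real ?L" using elim(3) Lq by linarith
        finally have "real (3 * k + (M * T n + 2 * k) * (3 * (2 * k + 3))) \<le> real ?L" by simp
        then show ?thesis by (simp only: of_nat_le_iff)
      qed
      have sk4: "real (card V) * (1 - 1 / real (2 * (k + 1))) ^ T n < 1"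
      proof -
        have "1 - 1 / real c \<le> exp (- (1 / real c))" using exp_ge_add_one_self[of "- (1 / real c)"] by simp
        then have "(1 - 1 / real c) ^ T n \<le> exp (- (1 / real c)) ^ T n"
          using c by (intro power_mono) auto
        also have "\<dots> = exp (- (real (T n) / real c))" by (simp add: exp_of_nat_mult[symmetric])
        also have "\<dots> < exp (- ln (real n))" using Tgt c by (simp add: less_divide_eq mult.commute)
        also have "\<dots> = 1 / real n" using n1 by (simp add: exp_minus inverse_eq_divide)
        finally show ?thesis using n n1 by (simp add: c_def less_divide_eq mult.commute)
      qed
      obtain X S A where X: "X \<subseteq> V" "card X \<le> ?L" "S \<subseteq> E" "tree_graph X S" "A \<subseteq> X"
        "\<And>x. x \<in> X \<Longrightarrow> graph_degree S x \<le> k" "\<And>x. x \<in> A \<Longrightarrow> Suc (graph_degree S x) \<le> k"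
        "\<And>v. v \<in> V \<Longrightarrow> M \<le> card (nbrs E v \<inter> A)"
        using skeleton[OF M(1) sk1 sk2 sk3 sk4] by metis
      define d where "d = nat \<lfloor>x * real n\<rfloor>"
      define m where "m = nat \<lceil>\<eta> * real n\<rceil>"
      define h where "h = nat \<lfloor>\<eta> * real n\<rfloor>"
      define s where "s = nat \<lceil>\<gamma> * real n\<rceil>"
      have en: "0 \<le> \<eta> * real n" "0 \<le> \<gamma> * real n" "0 \<le> x * real n" using eta gam x by auto
      have dle: "real d \<le> x * real n" "x * real n - 1 \<le> real d" using en unfolding d_def by linarith+
      have mle: "real m \<le> \<eta> * real n + 1" "\<eta> * real n \<le> real m" using en unfolding m_def by linarith+
      have hle: "real h \<le> \<eta> * real n" "\<eta> * real n - 1 \<le> real h" using en unfolding h_def by linarith+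
      have sle: "real s \<le> \<gamma> * real n + 1" "\<gamma> * real n \<le> real s" using en unfolding s_def by linarith+
      have h0: "h > 0" using elim(8) by (simp add: h_def)
      have kL: "(k - 2) * ?L \<le> d"
      proof -
        have "real ((k - 2) * ?L) \<le> real k * ?q"
          unfolding of_nat_mult using Lq k by (intro mult_mono) auto
        then have "real ((k - 2) * ?L) \<le> real d" using elim(9) dle by linarith
        then show ?thesis by (simp only: of_nat_le_iff)
      qed
      have room: "h + s + d + m + card X \<le> r"
      proof -
        have "real h + real s + real d + real m + real (card X) \<le>
          \<eta> * real n + (\<gamma> * real n + 1) + x * real n + (\<eta> * real n + 1) + ?q"
          using hle(1) sle(1) dle(1) mle(1) Lq(1) X(2) by linarith
        also have "\<dots> = (1 / K - \<rho>) * real n + 2 + ?q" by (simp add: \<rho>_def algebra_simps)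
        also have "\<dots> \<le> real n / K" using elim(6) by (simp add: algebra_simps)
        finally have "real (h + s + d + m + card X) \<le> real r" using nr by simp
        then show ?thesis by (simp only: of_nat_le_iff)
      qed
      have Ms: "card V < s * Suc M"
      proof -
        have "real n < \<gamma> * real n * (1 / \<gamma> + 1)" using gam n1 by (simp add: field_simps)
        also have "\<dots> \<le> real s * (real M + 1)" using sle(2) M(2) gam by (intro mult_mono) auto
        finally have "real (card V) < real (s * Suc M)" using n by (simp add: algebra_simps)
        then show ?thesis by (simp only: of_nat_less_iff)
      qed
      have ci: "p * real r ^ card V * (real (r - card X - d) / real r) ^ d / (real t ^ card V * real r ^ card X * real (card V choose d))
        \<le> (1 + real s / real h) ^ card V * (real (bounded_tree_count k V E) * real r ^ M)
          + 2 ^ card V * (real s / real h) ^ m * real r ^ card V"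
      proof (rule count_inequality[OF X(1,3,4,5,6,7,8) _ _ _ room h0 Ms t])
        show "p * real r ^ (t * card V) \<le> real (card {h \<in> configs V (nbrs E) t.
          solvable V t (k - 2) (d - (k - 2) * ?L) h})"
          using elim(1) dr n unfolding d_def by blast
        have "(k - 2) * card X \<le> (k - 2) * ?L" using X(2) by simp
        then show "d - (k - 2) * ?L + (k - 2) * card X \<le> d" using kL by linarith
        show "d + card X \<le> card V" using room rn n by linarith
      qed
      define B where "B = real (bounded_tree_count k V E)"
      have B0: "B \<ge> 0" by (simp add: B_def)
      have tp: "real t > 0" using t by simp
      have "d \<le> n" using room rn by linarith
      then have Cp: "real (n choose d) > 0" by simp
      have "b ^ n * (real t ^ n * real (n choose d)) \<le> (real (r - card X - d) / real r) ^ d"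
        using elim(2) dens n X(2) unfolding d_def by blast
      then have R: "b ^ n \<le> (real (r - card X - d) / real r) ^ d / (real t ^ n * real (n choose d))"
        using tp Cp by (simp add: le_divide_eq)
      have rX: "real r ^ card X \<le> real n powr ?q"
      proof -
        have "real r ^ card X \<le> real n ^ card X" using rn by (intro power_mono) auto
        also have "\<dots> = real n powr real (card X)" using n1 by (simp add: powr_realpow)
        also have "\<dots> \<le> real n powr ?q" using n1 Lq X(2) by (intro powr_mono) auto
        finally show ?thesis .
      qed
      have nq: "real n powr ?q > 0" using n1 by simp
      have "p * real r ^ n * b ^ n / real n powr ?q \<le> p * real r ^ n * b ^ n / real r ^ card X"
        using rX r0 b p nq by (intro divide_left_mono mult_pos_pos) auto
      also have "\<dots> \<le> p * real r ^ n * ((real (r - card X - d) / real r) ^ d / (real t ^ n * real (n choose d))) / real r ^ card X"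
        using R p r0 by (intro divide_right_mono mult_left_mono) auto
      also have "\<dots> = p * real r ^ n * (real (r - card X - d) / real r) ^ d / (real t ^ n * real r ^ card X * real (n choose d))"
        by (simp add: mult_ac)
      also have "\<dots> \<le> (1 + real s / real h) ^ n * (B * real r ^ M) + 2 ^ n * (real s / real h) ^ m * real r ^ n"
        using ci unfolding n B_def .
      finally have main: "p * real r ^ n * b ^ n / real n powr ?q
        \<le> (1 + real s / real h) ^ n * (B * real r ^ M) + 2 ^ n * (real s / real h) ^ m * real r ^ n" .
      have sh: "real s / real h \<le> \<theta>"
      proof -
        have "real s \<le> \<gamma> * real n + 1" by (rule sle)
        also have "\<dots> \<le> \<theta> * (\<eta> * real n - 1)" using elim(7) by (simp add: \<gamma>_def algebra_simps)
        also have "\<dots> \<le> \<theta> * real h" using hle th by (intro mult_left_mono) auto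
        finally show ?thesis using h0 by (simp add: divide_le_eq)
      qed
      have "(real s / real h) ^ m \<le> \<theta> ^ m" using sh by (intro power_mono) auto
      also have "\<dots> = \<theta> powr real m" using th by (simp add: powr_realpow)
      also have "\<dots> \<le> \<theta> powr (\<eta> * real n)" using th eps mle by (intro powr_mono') auto
      also have "\<dots> \<le> ((b / 8) powr (1 / \<eta>)) powr (\<eta> * real n)"
        using th eta by (intro powr_mono2) (auto simp: \<theta>_def)
      also have "\<dots> = (b / 8) ^ n" using eta b by (simp add: powr_powr powr_realpow)
      finally have "2 ^ n * (real s / real h) ^ m * real r ^ n \<le> 2 ^ n * (b / 8) ^ n * real r ^ n"
        by (intro mult_right_mono mult_left_mono) auto
      also have "\<dots> = real r ^ n * b ^ n * (1/4) ^ n" by (simp add: power_mult_distrib[symmetric] mult_ac)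
      also have "\<dots> \<le> real r ^ n * b ^ n * (p / 2 / real n powr ?q)"
        using elim(10) nq b by (intro mult_left_mono) (auto simp: le_divide_eq mult.commute)
      finally have err: "2 ^ n * (real s / real h) ^ m * real r ^ n \<le> p * real r ^ n * b ^ n / real n powr ?q / 2"
        by (simp add: mult_ac)
      have "(1 + real s / real h) ^ n * (B * real r ^ M) \<le> (1 + \<theta>) ^ n * (B * real n powr real M)"
      proof (intro mult_mono power_mono)
        have "real r ^ M \<le> real n ^ M" using rn by (intro power_mono) auto
        then show "real r ^ M \<le> real n powr real M" using n1 by (simp add: powr_realpow)
      qed (use sh B0 th in auto)
      then have "p * real r ^ n * b ^ n / real n powr ?q / 2 \<le> (1 + \<theta>) ^ n * (B * real n powr real M)"
        using main err by linarith
      then have "p / 2 * (real r * b) ^ n \<le> (1 + \<theta>) ^ n * B * real n powr (?q + real M)"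
        using nq by (simp add: field_simps power_mult_distrib powr_add)
      moreover have "real n powr (?q + real M) * (1 - \<epsilon>) ^ n * (real r * b) ^ n \<le> p / 2 * (real r * b) ^ n"
        using elim(11) b by (intro mult_right_mono) auto
      ultimately have "real n powr (?q + real M) * ((1 - \<epsilon>) ^ n * (real r * b) ^ n)
          \<le> real n powr (?q + real M) * ((1 + \<theta>) ^ n * B)"
        by (simp add: mult_ac)
      then have "(1 - \<epsilon>) ^ n * (real r * b) ^ n \<le> (1 + \<theta>) ^ n * B"
        using n1 by simp
      also have "\<dots> \<le> (1 + \<epsilon>) ^ n * B" using th B0 by (intro mult_right_mono power_mono) auto
      finally have fin: "((1 - \<epsilon>) / (1 + \<epsilon>) * (real r * b)) ^ n \<le> B"
        using eps by (simp add: power_mult_distrib power_divide divide_le_eq mult_ac)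
      have "1 - \<delta> \<le> (1 - \<epsilon>) / (1 + \<epsilon>)"
      proof -
        have "(1 - \<delta>) * (1 + \<epsilon>) \<le> (1 - 4 * \<epsilon>) * (1 + \<epsilon>)" using eps by (intro mult_right_mono) auto
        also have "\<dots> \<le> 1 - \<epsilon>" using eps by (simp add: algebra_simps)
        finally show ?thesis using eps by (simp add: le_divide_eq)
      qed
      then have "(1 - \<delta>) * (real r * b) \<le> (1 - \<epsilon>) / (1 + \<epsilon>) * (real r * b)"
        using b by (intro mult_right_mono) auto
      also have "\<dots> = root n (((1 - \<epsilon>) / (1 + \<epsilon>) * (real r * b)) ^ n)"
        using n1 eps b by (intro real_root_power_cancel[symmetric]) auto
      also have "\<dots> \<le> root n B" using fin n1 by (intro real_root_le_mono) auto
      finally show "(1 - \<delta>) * (real r * b) \<le> root n (real (bounded_tree_count k V E))" unfolding B_def .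
    qed
  qed
qed

section \<open>Estimates for the constants\<close>

lemma exp_one_ge: "5 / 2 \<le> exp (1 :: real)"
  using exp_lower_Taylor_quadratic[of "1 :: real"] by simp

lemma exp_one_tail:
  obtains t :: real where "t \<le> 1" "exp 1 = (\<Sum>i<m. 1 / fact i) + exp t / fact m"
proof -
  obtain t :: real where "\<bar>t\<bar> \<le> \<bar>1\<bar>" "exp 1 = (\<Sum>i<m. 1 ^ i / fact i) + exp t / fact m * 1 ^ m"
    using Maclaurin_exp_le[of 1 m] by blast
  then show ?thesis using that[of t] by simp
qed

lemma f_const_eq:
  assumes "k \<ge> 3"
  shows "f_const k = 1 - 1 / exp 1 * (\<Sum>i<k - 2. 1 / fact i)"
proof -
  have "{0..k - 3} = {..<k - 2}" using assms by auto
  then show ?thesis by (simp only: f_const_def)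
qed

lemma f_const_pos:
  assumes "k \<ge> 3"
  shows "f_const k > 0"
proof -
  obtain t :: real where "exp 1 = (\<Sum>i<k - 2. 1 / fact i) + exp t / fact (k - 2)"
    using exp_one_tail by blast
  then have "(\<Sum>i<k - 2. 1 / fact i) < exp (1 :: real)" by (metis divide_pos_pos exp_gt_zero fact_gt_zero less_add_same_cancel1)
  then show ?thesis unfolding f_const_eq[OF assms] by simp
qed

lemma g_const_pos: "g_const k > 0"
  by (simp add: g_const_def)

text \<open>The integer inequality behind \<open>saturated_bound\<close>, with
  \<open>j = k - 2\<close>. At \<open>j = 3\<close> it reads 450 < 600; at \<open>j = 2\<close>,
  that is \<open>k = 4\<close>, it fails.\<close>

lemma fact_ge_cubic: "j \<ge> 3 \<Longrightarrow> (j + 3) * (2 * (j + 2) * (j + 4) + 5) < 5 * (fact (j + 2) :: nat)"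
proof (induction j rule: dec_induct)
  case base
  show ?case by (simp add: eval_nat_numeral)
next
  case (step j)
  obtain i where i: "j = 3 + i" using step.hyps(1) le_Suc_ex by blast
  have "(Suc j + 3) * (2 * (Suc j + 2) * (Suc j + 4) + 5) \<le> (j + 3) * ((j + 3) * (2 * (j + 2) * (j + 4) + 5))"
    unfolding i by (simp add: algebra_simps)
  also have "\<dots> < (j + 3) * (5 * fact (j + 2))" using step.IH by simp
  also have "\<dots> = 5 * fact (Suc j + 2)" by (simp add: algebra_simps)
  finally show ?case .
qed

text \<open>\<open>f_const k\<close> is the probability that a Poisson variable of mean 1 is at
  least \<open>k - 2\<close>. Two terms of this tail are kept exactly, the rest is at most
  \<open>1 / fact k\<close>, and \<open>exp 1\<close> is replaced by 5/2.\<close>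

lemma saturated_bound:
  assumes "k \<ge> 5"
  shows "(real k + 1) * (f_const k + g_const k) < 1"
proof -
  define j where "j = k - 2"
  have k: "k = j + 2" "j \<ge> 3" using assms by (auto simp: j_def)
  define F where "F = (fact j :: real)"
  have F: "F > 0" by (simp add: F_def)
  have F1: "fact (k - 1) = (real j + 1) * F" using k by (simp add: F_def)
  have F2: "fact k = (real j + 2) * ((real j + 1) * F)" using k by (simp add: F_def add.commute)
  obtain t :: real where t: "t \<le> 1" "exp 1 = (\<Sum>i<k. 1 / fact i) + exp t / fact k"
    using exp_one_tail by blast
  have "(\<Sum>i<k. 1 / fact i) = (\<Sum>i<j. 1 / fact i) + 1 / F + 1 / ((real j + 1) * F)"
    using k by (simp add: F_def)
  then have e: "exp 1 - (\<Sum>i<j. 1 / fact i) = 1 / F + 1 / ((real j + 1) * F) + exp t / fact k"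
    using t(2) by simp
  have "f_const k = (exp 1 - (\<Sum>i<j. 1 / fact i)) / exp 1"
    using f_const_eq[of k] k by (simp add: diff_divide_distrib)
  also have "\<dots> = (1 / F + 1 / ((real j + 1) * F)) / exp 1 + exp t / exp 1 / fact k"
    unfolding e by (simp add: add_divide_distrib)
  also have "exp t / exp 1 / fact k \<le> 1 / fact k"
    using t(1) by (intro divide_right_mono) auto
  finally have fle: "f_const k \<le> (1 / F + 1 / ((real j + 1) * F)) / exp 1 + 1 / fact k" by simp
  have "g_const k = 2 / ((real j + 1) * F) / exp 1" by (simp add: g_const_def F1[simplified])
  moreover have "(1 / F + 3 / ((real j + 1) * F)) / exp 1
    = (1 / F + 1 / ((real j + 1) * F)) / exp 1 + 2 / ((real j + 1) * F) / exp 1"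
  proof -
    have three: "3 / D = 1 / D + 2 / D" for D :: real by (simp add: add_divide_distrib[symmetric])
    show ?thesis unfolding three by (simp only: add_divide_distrib add.assoc)
  qed
  ultimately have "f_const k + g_const k \<le> (1 / F + 3 / ((real j + 1) * F)) / exp 1 + 1 / fact k"
    using fle by linarith
  also have "(1 / F + 3 / ((real j + 1) * F)) / exp 1 \<le> (1 / F + 3 / ((real j + 1) * F)) / (5 / 2)"
    using exp_one_ge F by (intro divide_left_mono) auto
  also have "(1 / F + 3 / ((real j + 1) * F)) / (5 / 2) + 1 / fact k
    = (2 * (real j + 2) * (real j + 4) + 5) / (5 * fact k)"
    using F unfolding F2 by (simp add: divide_simps) (simp add: algebra_simps)
  finally have le: "f_const k + g_const k \<le> (2 * (real j + 2) * (real j + 4) + 5) / (5 * fact k)" by simp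
  have "real ((j + 3) * (2 * (j + 2) * (j + 4) + 5)) < real (5 * fact (j + 2))"
    using fact_ge_cubic[OF k(2)] by (simp only: of_nat_less_iff)
  then have "(real k + 1) * (2 * (real j + 2) * (real j + 4) + 5) < 5 * fact k"
    using k by (simp add: algebra_simps)
  then have "(real k + 1) * ((2 * (real j + 2) * (real j + 4) + 5) / (5 * fact k)) < 1"
    by (simp add: divide_less_eq)
  moreover have "(real k + 1) * (f_const k + g_const k) \<le> (real k + 1) * ((2 * (real j + 2) * (real j + 4) + 5) / (5 * fact k))"
    using le by (intro mult_left_mono) auto
  ultimately show ?thesis by linarith
qed

lemma g_const_4: "1 / 9 \<le> g_const 4" "g_const 4 \<le> 2 / 15"
  using exp_one_ge exp_le by (simp_all add: g_const_def eval_nat_numeral divide_simps)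

lemma tendsto_binomial_ratio:
  "(\<lambda>r. real (r choose m) / real r ^ m) \<longlonglongrightarrow> 1 / fact m"
proof (induction m)
  case (Suc m)
  have "(\<lambda>r. real (r choose m) / real r ^ m * ((real r - real m) / real r) / real (Suc m)) \<longlonglongrightarrow> 1 / fact m * 1 / real (Suc m)"
  proof (rule tendsto_divide[OF tendsto_mult[OF Suc] tendsto_const])
    show "(\<lambda>r. (real r - real m) / real r) \<longlonglongrightarrow> 1" by real_asymp
  qed auto
  moreover have "\<forall>\<^sub>F r in sequentially. real (r choose m) / real r ^ m * ((real r - real m) / real r) / real (Suc m) = real (r choose Suc m) / real r ^ Suc m"
    using eventually_ge_at_top[of "Suc m"]
  proof eventually_elim
    case (elim r)
    have "real (Suc m) * real (r choose Suc m) = real (r - m) * real (r choose m)"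
      unfolding of_nat_mult[symmetric] by (simp only: binomial_absorb_Suc)
    then have "real (Suc m) * real (r choose Suc m) = (real r - real m) * real (r choose m)"
      using elim by (simp add: of_nat_diff)
    moreover have "real r \<noteq> 0" using elim by simp
    ultimately show ?case by (simp add: divide_simps) (simp add: mult_ac)
  qed
  ultimately have "(\<lambda>r. real (r choose Suc m) / real r ^ Suc m) \<longlonglongrightarrow> 1 / fact m * 1 / real (Suc m)"
    by (rule Lim_transform_eventually)
  then show ?case by (simp add: mult.commute)
qed simp

text \<open>For an integer \<open>a\<close> and \<open>F = fact (a + 1)\<close> the left side is the
  limit of \<open>excess_mean a\<close>. Equality holds at \<open>a = 2\<close>; what matters is
  that 13/20 is below 2/3 and hence below \<open>2 / exp 1\<close>, the value of
  \<open>F * g_const (a + 2)\<close>.\<close>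

lemma excess_limit_bound:
  fixes a F :: real
  assumes "a \<ge> 2" "F > 0"
  shows "1 / F - a * (1 / ((a + 2) * F)) + a * (a + 1) / 2 * (1 / ((a + 3) * ((a + 2) * F))) \<le> 13 / 20 / F"
proof -
  have "1 - a / (a + 2) + a * (a + 1) / (2 * ((a + 2) * (a + 3))) = (4 * (a + 3) + a * (a + 1)) / (2 * ((a + 2) * (a + 3)))"
    using assms by (simp add: divide_simps)
  also have "\<dots> \<le> 13 / 20"
  proof -
    have "4 \<le> a * a" using mult_mono[of 2 a 2 a] assms by simp
    moreover have "13 * (2 * ((a + 2) * (a + 3))) - 20 * (4 * (a + 3) + a * (a + 1)) = 6 * (a * a) + 30 * a - 84"
      by (simp add: algebra_simps)
    ultimately have "20 * (4 * (a + 3) + a * (a + 1)) \<le> 13 * (2 * ((a + 2) * (a + 3)))"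
      using assms by linarith
    moreover have "0 < 2 * ((a + 2) * (a + 3))" using assms by simp
    ultimately show ?thesis by (simp add: divide_le_eq)
  qed
  finally have "(1 - a / (a + 2) + a * (a + 1) / (2 * ((a + 2) * (a + 3)))) / F \<le> 13 / 20 / F"
    using assms by (intro divide_right_mono) auto
  then show ?thesis by (simp add: diff_divide_distrib add_divide_distrib mult_ac)
qed

lemma excess_mean_limit_less:
  assumes "k \<ge> 4"
  shows "\<exists>G g'. 0 \<le> G \<and> G < g' \<and> g' < g_const k \<and> (\<forall>\<^sub>F r in sequentially. excess_mean (k - 2) r \<le> G)"
proof -
  define j where "j = k - 2"
  have j: "j \<ge> 2" "k - 1 = Suc j" using assms by (auto simp: j_def)
  define F where "F = (fact (Suc j) :: real)"
  have F: "F > 0" by (simp add: F_def)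
  define \<mu> where "\<mu> = 1 / fact (Suc j) - real j * (1 / fact (Suc (Suc j))) + real j * real (Suc j) / 2 * (1 / fact (Suc (Suc (Suc j)))) "
  have "excess_mean j \<longlonglongrightarrow> \<mu>"
    unfolding excess_mean_def[abs_def] \<mu>_def by (intro tendsto_intros tendsto_binomial_ratio)
  have f2: "fact (Suc (Suc j)) = (real j + 2) * F" unfolding fact_Suc[of "Suc j"] F_def by simp
  have f3: "fact (Suc (Suc (Suc j))) = (real j + 3) * ((real j + 2) * F)"
    unfolding fact_Suc[of "Suc (Suc j)"] f2 by simp
  have mu: "\<mu> \<le> 13 / 20 / F"
    using excess_limit_bound[of "real j" F] j F unfolding \<mu>_def f2 f3 F_def[symmetric] by (simp add: add.commute)
  \<comment> \<open>13/20 < 79/120 < 159/240 < 2/3: one gap absorbs the convergence in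
    \<open>r\<close>, the next makes Markov's bound nontrivial, the last absorbs the
    skeleton.\<close>
  define G where "G = 79 / 120 / F"
  define g' where "g' = 159 / 240 / F"
  have "13 / 20 / F < G" using F by (simp add: G_def divide_simps)
  then have "\<mu> < G" using mu by linarith
  then have "\<forall>\<^sub>F r in sequentially. excess_mean j r < G"
    using \<open>excess_mean j \<longlonglongrightarrow> \<mu>\<close> by (intro order_tendstoD)
  then have "\<forall>\<^sub>F r in sequentially. excess_mean j r \<le> G" by eventually_elim simp
  moreover have "0 \<le> G" "G < g'" using F by (simp_all add: G_def g'_def divide_simps)
  moreover have "g' < g_const k"
  proof -
    have "g' < 2 / 3 / F" using F by (simp add: g'_def divide_simps)
    also have "\<dots> \<le> 2 / exp 1 / F" using F exp_le by (intro divide_right_mono divide_left_mono) auto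
    also have "\<dots> = g_const k" unfolding g_const_def j(2) F_def by (simp del: fact_Suc)
    finally show ?thesis .
  qed
  ultimately show ?thesis unfolding j_def by blast
qed

section \<open>Entropy of the dropped set and solvability of random configurations\<close>

text \<open>Rounding \<open>x * n\<close> down to \<open>d\<close> does no harm: each unit missing
  from \<open>d\<close> replaces a factor \<open>w * x\<close> by \<open>1 - x\<close>, which is no
  smaller.\<close>

lemma entropy_power:
  fixes w x :: real
  assumes w: "0 < w" "w \<le> 1" and x: "0 < x" "x \<le> 1/2" and d: "real d \<le> x * real n" "d \<le> n"
  shows "(w powr x * (1 - x) powr (1 - x) * x powr x) ^ n \<le> w ^ d * (x ^ d * (1 - x) ^ (n - d))"
proof -
  have "(w powr x * (1 - x) powr (1 - x) * x powr x) ^ n = exp (real n * (x * ln w + (1 - x) * ln (1 - x) + x * ln x))"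
    using w x by (simp add: powr_def exp_add[symmetric] exp_of_nat_mult[symmetric])
  also have "\<dots> \<le> exp (real d * ln w + (real d * ln x + real (n - d) * ln (1 - x)))"
  proof (subst exp_le_cancel_iff)
    have "ln w \<le> 0" using w by simp
    moreover have "ln x \<le> ln (1 - x)" using x by simp
    ultimately have "0 \<le> (x * real n - real d) * (ln (1 - x) - ln x - ln w)"
      using d by (intro mult_nonneg_nonneg) auto
    then show "real n * (x * ln w + (1 - x) * ln (1 - x) + x * ln x) \<le> real d * ln w + (real d * ln x + real (n - d) * ln (1 - x))"
      using d(2) by (simp add: of_nat_diff algebra_simps)
  qed
  also have "\<dots> = w ^ d * (x ^ d * (1 - x) ^ (n - d))"
    using w x by (simp add: exp_add exp_of_nat_mult)
  finally show ?thesis .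
qed

text \<open>Since \<open>n \<le> (k + 1) * r\<close>, the skeleton and the \<open>x n\<close>
  dropped vertices occupy at most a fraction \<open>1 - w\<close> of \<open>r\<close>; the
  strictness of the bound on \<open>w\<close> absorbs the skeleton.\<close>

lemma eventually_entropy:
  fixes w x :: real
  assumes w: "0 < w" "w < 1 - (real k + 1) * x" and x: "0 < x" "x \<le> 1/2" and t: "t \<ge> 1"
  defines "b \<equiv> w powr x * (1 - x) powr (1 - x) * x powr x / real t"
  shows "\<forall>\<^sub>F n in sequentially. \<forall>r X. n \<le> (k + 1) * r \<and> X \<le> margin n \<longrightarrow>
      b ^ n * (real t ^ n * real (n choose nat \<lfloor>x * real n\<rfloor>))
        \<le> (real (r - X - nat \<lfloor>x * real n\<rfloor>) / real r) ^ nat \<lfloor>x * real n\<rfloor>"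
proof -
  define K where "K = real k + 1"
  have K: "K > 0" by (simp add: K_def)
  have "1 - w - K * x > 0" using w by (simp add: K_def)
  then have "\<forall>\<^sub>F n::nat in sequentially. K * real n powr (1/4) \<le> (1 - w - K * x) * real n"
    using K by real_asymp
  then show ?thesis using eventually_ge_at_top[of 1]
  proof eventually_elim
    case (elim n)
    show ?case
    proof (intro allI impI)
      fix r X assume rX: "n \<le> (k + 1) * r \<and> X \<le> margin n"
      define d where "d = nat \<lfloor>x * real n\<rfloor>"
      have "0 \<le> x * real n" using x by simp
      then have d: "real d \<le> x * real n" unfolding d_def by linarith
      also have "x * real n \<le> 1 * real n" using x by (intro mult_right_mono) auto
      finally have dn: "d \<le> n" by simp
      have "real n \<le> real ((k + 1) * r)" using rX by (simp only: of_nat_le_iff)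
      then have nr: "real n \<le> K * real r" by (simp add: K_def algebra_simps)
      then have r0: "real r > 0" using elim(2) K by (cases "r = 0") auto
      have Kx: "0 < K * x" using K x by simp
      have w1: "w \<le> 1" using w Kx by (simp add: K_def)
      have "K * (real X + real d) \<le> K * (real n powr (1/4) + x * real n)"
        using rX d margin_le[of n] K by (intro mult_left_mono add_mono) auto
      also have "\<dots> \<le> (1 - w) * real n" using elim(1) by (simp add: algebra_simps)
      also have "\<dots> \<le> (1 - w) * (K * real r)" using nr w1 by (intro mult_left_mono) auto
      finally have "K * (real X + real d) \<le> K * ((1 - w) * real r)" by (simp add: mult_ac)
      then have Xd: "real X + real d \<le> (1 - w) * real r" using K by simp
      have "(1 - w) * real r \<le> 1 * real r" using w by (intro mult_right_mono) auto
      then have "X + d \<le> r" using Xd by simp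
      then have "real (r - X - d) = real r - real X - real d" by (simp add: of_nat_diff)
      then have "w * real r \<le> real (r - X - d)" using Xd by (simp add: algebra_simps)
      then have wle: "w \<le> real (r - X - d) / real r" using r0 by (simp add: le_divide_eq)
      have "b ^ n * (real t ^ n * real (n choose d)) = (w powr x * (1 - x) powr (1 - x) * x powr x) ^ n * real (n choose d)"
        using t by (simp add: b_def power_divide)
      also have "\<dots> \<le> w ^ d * (x ^ d * (1 - x) ^ (n - d)) * real (n choose d)"
        by (intro mult_right_mono entropy_power w w1 x d dn) simp
      also have "\<dots> = w ^ d * (real (n choose d) * (x ^ d * (1 - x) ^ (n - d)))" by simp
      also have "\<dots> \<le> w ^ d * 1" using w x by (intro mult_left_mono binomial_entropy) auto
      also have "\<dots> \<le> (real (r - X - d) / real r) ^ d"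
        unfolding mult_1_right by (rule power_mono[OF wle]) (use w in simp)
      finally show "b ^ n * (real t ^ n * real (n choose nat \<lfloor>x * real n\<rfloor>))
        \<le> (real (r - X - nat \<lfloor>x * real n\<rfloor>) / real r) ^ nat \<lfloor>x * real n\<rfloor>" unfolding d_def .
    qed
  qed
qed

lemma (in dense_regular) nbrs_uniform:
  assumes "u \<in> V"
  shows "{v \<in> V. u \<in> nbrs E v} = nbrs E u"
  using nbrs_V[of u] nbrs_sym[of u E] by blast

lemma (in dense_regular) degree_pos: "r \<ge> 1"
proof -
  have "V \<noteq> {}" using conn by (simp add: connected_graph_def)
  then have "card V > 0" using finV by (simp add: card_gt_0_iff)
  then show ?thesis using dens by (cases r) auto
qed

text \<open>The expected total excess is at most \<open>G * n\<close>, and \<open>d + 1\<close> is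
  at least \<open>g' * n\<close>, so Markov's inequality succeeds with probability at least
  \<open>1 - G / g'\<close>.\<close>

lemma eventually_solvable_single:
  assumes k: "k \<ge> 4"
  shows "\<exists>p>0. \<forall>\<^sub>F n in sequentially. \<forall>(V :: 'a set) E r. dense_regular V E r k \<and> card V = n \<longrightarrow>
      p * real r ^ (1 * n) \<le> real (card {h \<in> configs V (nbrs E) 1.
        solvable V 1 (k - 2) (nat \<lfloor>g_const k * real n\<rfloor> - (k - 2) * margin n) h})"
proof -
  obtain G g' where Gg: "0 \<le> G" "G < g'" "g' < g_const k"
    and ev: "\<forall>\<^sub>F r in sequentially. excess_mean (k - 2) r \<le> G"
    using excess_mean_limit_less[OF k] by blast
  obtain R where R: "\<And>r. r \<ge> R \<Longrightarrow> excess_mean (k - 2) r \<le> G" using ev by (auto simp: eventually_sequentially)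
  define p where "p = 1 - G / g'"
  have p: "p > 0" using Gg by (simp add: p_def)
  have "g_const k - g' > 0" "real k > 0" using Gg k by auto
  then have "\<forall>\<^sub>F n::nat in sequentially. real k * real n powr (1/4) \<le> (g_const k - g') * real n"
    by real_asymp
  then have "\<forall>\<^sub>F n in sequentially. \<forall>(V :: 'a set) E r. dense_regular V E r k \<and> card V = n \<longrightarrow>
      p * real r ^ (1 * n) \<le> real (card {h \<in> configs V (nbrs E) 1.
        solvable V 1 (k - 2) (nat \<lfloor>g_const k * real n\<rfloor> - (k - 2) * margin n) h})"
    using eventually_ge_at_top[of "(k + 1) * R + 1"]
  proof eventually_elim
    case (elim n)
    show ?case
    proof (intro allI impI)
      fix V :: "'a set" and E r
      assume "dense_regular V E r k \<and> card V = n"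
      then have dr: "dense_regular V E r k" and n: "card V = n" by auto
      interpret dense_regular V E r k by (rule dr)
      define d where "d = nat \<lfloor>g_const k * real n\<rfloor> - (k - 2) * margin n"
      have "(k + 1) * R < (k + 1) * r" using elim(2) dens n by linarith
      then have exG: "excess_mean (k - 2) r \<le> G" using R[of r] by (simp only: nat_mult_less_cancel_disj) simp
      have n0: "real n > 0" using elim(2) by simp
      have "0 \<le> g_const k * real n" using g_const_pos[of k] by simp
      then have "g_const k * real n \<le> real (nat \<lfloor>g_const k * real n\<rfloor>) + 1" by linarith
      also have "\<dots> \<le> real (d + (k - 2) * margin n) + 1" by (simp add: d_def del: of_nat_add of_nat_mult)
      also have "real (d + (k - 2) * margin n) = real d + real (k - 2) * real (margin n)" by simp
      also have "real (k - 2) * real (margin n) \<le> real k * real n powr (1/4)"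
        using margin_le by (intro mult_mono) auto
      finally have d: "g' * real n \<le> real d + 1" using elim(1) by (simp add: algebra_simps)
      have g0: "0 < g' * real n" using Gg n0 by (intro mult_pos_pos) auto
      have "real n * excess_mean (k - 2) r / (real d + 1) \<le> real n * G / (real d + 1)"
        using exG by (intro divide_right_mono mult_left_mono) auto
      also have "\<dots> \<le> real n * G / (g' * real n)"
        using d g0 Gg n0 by (intro divide_left_mono mult_nonneg_nonneg mult_pos_pos) auto
      also have "\<dots> = G / g'" using n0 by simp
      finally have "p \<le> 1 - real (card V) * excess_mean (k - 2) r / (real d + 1)" by (simp add: p_def n)
      then have "p * real r ^ (1 * n) \<le> (1 - real (card V) * excess_mean (k - 2) r / (real d + 1)) * real r ^ card V"
        by (simp add: n mult_right_mono)
      also have "\<dots> \<le> real (card {h \<in> configs V (nbrs E) 1. solvable V 1 (k - 2) d h})"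
      proof (rule card_solvable_single_ge[OF finV _ _ degree_pos])
        show "nbrs E v \<subseteq> V \<and> card (nbrs E v) = r" if "v \<in> V" for v using nbrs_V deg[OF that] by blast
        show "card {v \<in> V. u \<in> nbrs E v} = r" if "u \<in> V" for u using nbrs_uniform[OF that] deg[OF that] by simp
        show "1 \<le> k - 2" using k by simp
      qed
      finally show "p * real r ^ (1 * n) \<le> real (card {h \<in> configs V (nbrs E) 1.
        solvable V 1 (k - 2) (nat \<lfloor>g_const k * real n\<rfloor> - (k - 2) * margin n) h})" unfolding d_def .
    qed
  qed
  then show ?thesis using p by blast
qed

text \<open>From \<open>4 ^ 7 = 16384\<close> and \<open>exp 1 \<ge> 27/10\<close>.\<close>

lemma ln_4_less: "ln 4 < (10 / 7 :: real)"
proof -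
  have "4 ^ 7 < (27 / 10 :: real) ^ 10" by (simp add: power_divide)
  also have "\<dots> \<le> exp 1 ^ 10"
  proof (rule power_mono)
    obtain t :: real where "exp 1 = (\<Sum>i<5. 1 / fact i) + exp t / fact 5" using exp_one_tail by blast
    moreover have "(\<Sum>i<5. 1 / fact i) = (65 / 24 :: real)" by (simp add: eval_nat_numeral)
    moreover have "exp t / fact 5 > 0" by simp
    ultimately show "27 / 10 \<le> exp (1 :: real)" by linarith
  qed simp
  also have "\<dots> = exp (10 / 7) ^ 7" by (simp add: exp_of_nat_mult[symmetric])
  finally have "4 < exp (10 / 7 :: real)" by (rule power_less_imp_less_base) simp
  then show ?thesis by (metis exp_gt_zero ln_exp ln_less_cancel_iff zero_less_numeral)
qed

text \<open>With \<open>d\<close> close to \<open>n / 7\<close> the failure probability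
  \<open>4 ^ n * exp (- 10 * d)\<close> decays exponentially, by \<open>ln_4_less\<close>.\<close>

lemma eventually_solvable_ten:
  "\<forall>\<^sub>F n in sequentially. \<forall>(V :: 'a set) E r. dense_regular V E r 3 \<and> card V = n \<longrightarrow>
      1 / 2 * real r ^ (10 * n) \<le> real (card {h \<in> configs V (nbrs E) 10.
        solvable V 10 (3 - 2) (nat \<lfloor>1 / 7 * real n\<rfloor> - (3 - 2) * margin n) h})"
proof -
  define c where "c = 10 / 7 - ln (4 :: real)"
  have c: "c > 0" using ln_4_less by (simp add: c_def)
  have "(\<lambda>n::nat. exp (- (c * real n) + 10 * real n powr (1/4) + 10)) \<longlonglongrightarrow> 0"
    using c by real_asymp
  then have "\<forall>\<^sub>F n::nat in sequentially. exp (- (c * real n) + 10 * real n powr (1/4) + 10) < 1 / 2"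
    by (rule order_tendstoD) simp
  then show ?thesis
  proof eventually_elim
    case (elim n)
    show ?case
    proof (intro allI impI)
      fix V :: "'a set" and E r
      assume "dense_regular V E r 3 \<and> card V = n"
      then have dr: "dense_regular V E r 3" and n: "card V = n" by auto
      interpret dense_regular V E r 3 by (rule dr)
      define d where "d = nat \<lfloor>1 / 7 * real n\<rfloor> - margin n"
      have "1 / 7 * real n \<le> real (nat \<lfloor>1 / 7 * real n\<rfloor>) + 1" by linarith
      also have "\<dots> \<le> real (d + margin n) + 1" by (simp add: d_def del: of_nat_add)
      also have "\<dots> \<le> real d + real n powr (1/4) + 1" using margin_le[of n] by simp
      finally have d: "real n / 7 - real n powr (1/4) - 1 \<le> real d" by simp
      have "4 ^ n * exp (- real (10 * d)) = exp (real n * ln 4 - 10 * real d)"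
        by (simp add: exp_diff exp_of_nat_mult exp_minus divide_inverse)
      also have "\<dots> \<le> exp (- (c * real n) + 10 * real n powr (1/4) + 10)"
        using d by (simp add: c_def algebra_simps)
      finally have "4 ^ card V * exp (- real (10 * d)) \<le> 1 / 2" using elim n by simp
      then have "1 / 2 * real r ^ (10 * n) \<le> (1 - 4 ^ card V * exp (- real (10 * d))) * real r ^ (10 * card V)"
        unfolding n by (intro mult_right_mono) auto
      also have "\<dots> \<le> real (card {h \<in> configs V (nbrs E) 10. solvable V 10 1 d h})"
      proof (rule card_solvable_one_ge[OF finV _ _ degree_pos])
        show "nbrs E v \<subseteq> V \<and> card (nbrs E v) = r" if "v \<in> V" for v using nbrs_V deg[OF that] by blast
        show "card {v \<in> V. u \<in> nbrs E v} \<le> r" if "u \<in> V" for u using nbrs_uniform[OF that] deg[OF that] by simp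
      qed
      finally show "1 / 2 * real r ^ (10 * n) \<le> real (card {h \<in> configs V (nbrs E) 10.
        solvable V 10 (3 - 2) (nat \<lfloor>1 / 7 * real n\<rfloor> - (3 - 2) * margin n) h})" by (simp add: d_def)
    qed
  qed
qed

lemma powr_self_ge: "0 \<le> y \<Longrightarrow> y \<le> 1 \<Longrightarrow> 0 < x \<Longrightarrow> x \<le> 1 \<Longrightarrow> x \<le> x powr y" for x y :: real
  using powr_mono'[of y 1 x] by simp

text \<open>The base 2/5 is just below \<open>1 - 4 / 7\<close>, the division by 10 pays for the ten
  proposals, and seventh powers make the inequality rational.\<close>

lemma z_const_3: "z_const 3 \<le> (2 / 5) powr (1 / 7) * (1 - 1 / 7) powr (1 - 1 / 7) * (1 / 7) powr (1 / 7) / real (10 :: nat)"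
proof -
  define y where "y = (2 / 5) powr (1 / 7) * (1 - 1 / 7) powr (1 - 1 / 7) * (1 / 7 :: real) powr (1 / 7)"
  have p: "((u :: real) powr v) ^ 7 = u powr (7 * v)" if "u > 0" for u v
    using that by (simp add: powr_def exp_of_nat_mult[symmetric])
  have y0: "y \<ge> 0" by (simp add: y_def)
  have "y ^ 7 = (2 / 5) * (6 / 7) ^ 6 * (1 / 7)"
    unfolding y_def power_mult_distrib by (simp add: p powr_numeral)
  moreover have "(494 / 1000 :: real) ^ 7 \<le> (2 / 5) * (6 / 7) ^ 6 * (1 / 7)" by (simp add: power_divide)
  ultimately have "(494 / 1000) ^ 7 \<le> y ^ 7" by simp
  then have "494 / 1000 \<le> y" using y0 by (simp add: power_mono_iff)
  then show ?thesis by (simp add: z_const_def y_def)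
qed

text \<open>The base 3/10 is below 1/3, a lower bound for \<open>1 - 5 * g_const 4\<close>. Crude
  bounds for the three factors already give 0.156.\<close>

lemma z_const_4: "z_const 4 \<le> (3 / 10) powr g_const 4 * (1 - g_const 4) powr (1 - g_const 4) * g_const 4 powr g_const 4"
proof -
  define g where "g = g_const 4"
  have g: "1 / 9 \<le> g" "g \<le> 2 / 15" using g_const_4 by (simp_all add: g_def)
  have a: "3 / 10 \<le> (3 / 10) powr g" using g by (intro powr_self_ge) auto
  have b: "13 / 15 \<le> (1 - g) powr (1 - g)" using powr_self_ge[of "1 - g" "1 - g"] g by simp
  have "3 / 5 \<le> (1 / 9 :: real) powr (2 / 15)"
  proof -
    have "((1 / 9 :: real) powr (2 / 15)) ^ 15 = (1 / 9) powr 2"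
      by (simp add: powr_def exp_of_nat_mult[symmetric])
    also have "\<dots> = 1 / 81" by (simp add: powr_numeral power2_eq_square)
    finally have "(3 / 5) ^ 15 \<le> ((1 / 9 :: real) powr (2 / 15)) ^ 15" by (simp add: power_divide)
    then show ?thesis by (subst (asm) power_mono_iff) auto
  qed
  also have "\<dots> \<le> (1 / 9) powr g" using g by (intro powr_mono') auto
  also have "\<dots> \<le> g powr g" using g by (intro powr_mono2) auto
  finally have "3 / 5 \<le> g powr g" .
  then have "3 / 10 * (13 / 15) * (3 / 5) \<le> (3 / 10) powr g * (1 - g) powr (1 - g) * g powr g"
    using a b by (intro mult_mono) auto
  then show ?thesis by (simp add: z_const_def g_def)
qed

lemma eventually_bound:
  assumes k: "k \<ge> 3" and \<delta>: "0 < \<delta>" "\<delta> \<le> 1"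
  shows "\<forall>\<^sub>F n in sequentially. \<forall>(V :: 'a set) E r. dense_regular V E r k \<and> card V = n \<longrightarrow>
      (1 - \<delta>) * (real r * z_const k) \<le> root n (real (bounded_tree_count k V E))"
proof -
  have mono: ?thesis if z: "z_const k \<le> b" and ev: "\<forall>\<^sub>F n in sequentially. \<forall>(V :: 'a set) E r. dense_regular V E r k \<and> card V = n \<longrightarrow>
      (1 - \<delta>) * (real r * b) \<le> root n (real (bounded_tree_count k V E))" for b
    using ev
  proof eventually_elim
    case (elim n)
    show ?case
    proof (intro allI impI)
      fix V :: "'a set" and E r
      assume "dense_regular V E r k \<and> card V = n"
      then have "(1 - \<delta>) * (real r * b) \<le> root n (real (bounded_tree_count k V E))" using elim by blast
      moreover have "(1 - \<delta>) * (real r * z_const k) \<le> (1 - \<delta>) * (real r * b)"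
        using z \<delta> by (intro mult_left_mono) auto
      ultimately show "(1 - \<delta>) * (real r * z_const k) \<le> root n (real (bounded_tree_count k V E))" by linarith
    qed
  qed
  show ?thesis
  proof (cases "k = 3")
    case True
    show ?thesis
    proof (rule mono)
      show "z_const k \<le> (2 / 5) powr (1 / 7) * (1 - 1 / 7) powr (1 - 1 / 7) * (1 / 7) powr (1 / 7) / real (10 :: nat)"
        using z_const_3 True by simp
      show "\<forall>\<^sub>F n in sequentially. \<forall>(V :: 'a set) E r. dense_regular V E r k \<and> card V = n \<longrightarrow>
        (1 - \<delta>) * (real r * ((2 / 5) powr (1 / 7) * (1 - 1 / 7) powr (1 - 1 / 7) * (1 / 7) powr (1 / 7) / real (10 :: nat)))
        \<le> root n (real (bounded_tree_count k V E))"
        unfolding True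
        by (rule asymptotic_core[OF _ _ _ _ _ _ \<delta>(1) eventually_solvable_ten eventually_entropy]) auto
    qed
  next
    case False
    then have k4: "k \<ge> 4" using k by simp
    define g where "g = g_const k"
    have g0: "g > 0" using g_const_pos by (simp add: g_def)
    \<comment> \<open>For \<open>k \<ge> 5\<close> the base in \<open>z_const\<close> itself serves
      as \<open>w\<close>: it is positive by \<open>saturated_bound\<close>, and
      \<open>f_const k > 0\<close> makes the upper bound strict.\<close>
    have "\<exists>w. 0 < w \<and> w < 1 - (real k + 1) * g \<and> z_const k \<le> w powr g * (1 - g) powr (1 - g) * g powr g"
    proof (cases "k = 4")
      case True
      have "3 / 10 < 1 - (real k + 1) * g" using g_const_4(2) True by (simp add: g_def)
      moreover have "z_const k \<le> (3 / 10) powr g * (1 - g) powr (1 - g) * g powr g"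
        using z_const_4 True by (simp add: g_def)
      ultimately show ?thesis by (intro exI[of _ "3 / 10"]) simp
    next
      case False
      then have "k \<ge> 5" using k4 by simp
      then have "0 < 1 - (real k + 1) * (f_const k + g)" using saturated_bound by (simp add: g_def)
      moreover have "1 - (real k + 1) * (f_const k + g) < 1 - (real k + 1) * g"
        using f_const_pos[OF k] by simp
      moreover have "z_const k = (1 - (real k + 1) * (f_const k + g)) powr g * (1 - g) powr (1 - g) * g powr g"
        using \<open>k \<ge> 5\<close> by (simp add: z_const_def g_def)
      ultimately show ?thesis by (intro exI[of _ "1 - (real k + 1) * (f_const k + g)"]) simp
    qed
    then obtain w where w: "0 < w" "w < 1 - (real k + 1) * g" and z: "z_const k \<le> w powr g * (1 - g) powr (1 - g) * g powr g" by blast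
    have kg: "(real k + 1) * g < 1" using w by simp
    have "2 * g \<le> (real k + 1) * g" using g0 k by (intro mult_right_mono) auto
    then have g2: "g \<le> 1 / 2" using kg by simp
    obtain p where p: "p > 0" and sv: "\<forall>\<^sub>F n in sequentially. \<forall>(V :: 'a set) E r. dense_regular V E r k \<and> card V = n \<longrightarrow>
      p * real r ^ (1 * n) \<le> real (card {h \<in> configs V (nbrs E) 1.
        solvable V 1 (k - 2) (nat \<lfloor>g_const k * real n\<rfloor> - (k - 2) * margin n) h})"
      using eventually_solvable_single[OF k4, where 'a = 'a] by blast
    show ?thesis
    proof (rule mono)
      show "z_const k \<le> w powr g * (1 - g) powr (1 - g) * g powr g / real (1 :: nat)" using z by simp
      show "\<forall>\<^sub>F n in sequentially. \<forall>(V :: 'a set) E r. dense_regular V E r k \<and> card V = n \<longrightarrow>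
        (1 - \<delta>) * (real r * (w powr g * (1 - g) powr (1 - g) * g powr g / real (1 :: nat)))
        \<le> root n (real (bounded_tree_count k V E))"
      proof (rule asymptotic_core[OF k _ p _ g0 kg \<delta>(1) sv[folded g_def] eventually_entropy])
        show "0 < w powr g * (1 - g) powr (1 - g) * g powr g / real (1 :: nat)"
          using w g0 g2 by simp
      qed (use w g0 g2 in auto)
    qed
  qed
qed

theorem theorem1p1:
  fixes k :: nat
  assumes "k \<ge> 3"
  shows "\<exists>\<epsilon> :: nat \<Rightarrow> real. \<epsilon> \<longlonglongrightarrow> 0 \<and>
    (\<forall>(V :: 'a set) (E :: 'a set set) (n :: nat) (r :: nat).
       simple_graph V E \<and> card V = n \<and> connected_graph V E \<and> regular_graph V E r \<and>
       real r \<ge> real n / (real k + 1) \<longrightarrow>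
       root n (real (bounded_tree_count k V E)) \<ge> (1 - \<epsilon> n) * (real r * z_const k))"
proof -
  define P where "P = (\<lambda>\<delta> n. \<forall>(V :: 'a set) E r. dense_regular V E r k \<and> card V = n \<longrightarrow>
    (1 - \<delta>) * (real r * z_const k) \<le> root n (real (bounded_tree_count k V E)))"
  define D where "D = (\<lambda>n. {\<delta>. 0 \<le> \<delta> \<and> P \<delta> n})"
  \<comment> \<open>One error term for all graphs with \<open>n\<close> vertices: the least constant
    that works for all of them, and 1 always works.\<close>
  define \<epsilon> where "\<epsilon> = (\<lambda>n. Inf (D n))"
  have one: "1 \<in> D n" for n by (auto simp: D_def P_def intro: real_root_ge_zero)
  have bdd: "bdd_below (D n)" for n by (rule bdd_belowI[of _ 0]) (simp add: D_def)
  have eps0: "0 \<le> \<epsilon> n" for n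
    unfolding \<epsilon>_def
  proof (rule cInf_greatest)
    show "D n \<noteq> {}" using one by blast
  qed (simp add: D_def)
  have "\<epsilon> \<longlonglongrightarrow> 0"
  proof (rule LIMSEQ_I)
    fix e :: real assume e: "0 < e"
    define \<delta> where "\<delta> = min 1 (e / 2)"
    have \<delta>: "0 < \<delta>" "\<delta> \<le> 1" "\<delta> < e" using e by (auto simp: \<delta>_def)
    have "\<forall>\<^sub>F n in sequentially. P \<delta> n" unfolding P_def by (rule eventually_bound[OF assms \<delta>(1,2)])
    then obtain N where N: "\<And>n. n \<ge> N \<Longrightarrow> P \<delta> n" by (auto simp: eventually_sequentially)
    have "norm (\<epsilon> n - 0) < e" if "n \<ge> N" for n
    proof -
      have "\<epsilon> n \<le> \<delta>" unfolding \<epsilon>_def using N[OF that] \<delta> by (intro cInf_lower bdd) (simp add: D_def)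
      then show ?thesis using eps0[of n] \<delta> by simp
    qed
    then show "\<exists>N. \<forall>n\<ge>N. norm (\<epsilon> n - 0) < e" by blast
  qed
  moreover have "(1 - \<epsilon> n) * (real r * z_const k) \<le> root n (real (bounded_tree_count k V E))"
    if V: "simple_graph V E" "card V = n" "connected_graph V E" "regular_graph V E r" "real n / (real k + 1) \<le> real r"
    for V :: "'a set" and E n r
  proof -
    have "real n \<le> real ((k + 1) * r)" using V(5) by (simp add: divide_le_eq algebra_simps)
    then have "card V \<le> (k + 1) * r" using V(2) by (simp only: of_nat_le_iff)
    then have dr: "dense_regular V E r k"
      using V assms graph_degree_nbrs[OF V(1)] by unfold_locales (auto simp: regular_graph_def)
    let ?c = "root n (real (bounded_tree_count k V E))" and ?z = "real r * z_const k"
    have c0: "0 \<le> ?c" by (cases "n = 0") (auto intro: real_root_ge_zero)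
    show ?thesis
    proof (cases "?z > 0")
      case True
      \<comment> \<open>For a fixed graph each element of \<open>D n\<close> is at least
        \<open>1 - ?c / ?z\<close>, so the infimum inherits the bound.\<close>
      have "1 - ?c / ?z \<le> \<epsilon> n"
        unfolding \<epsilon>_def
      proof (rule cInf_greatest)
        show "D n \<noteq> {}" using one by blast
        fix \<delta> assume "\<delta> \<in> D n"
        then have "(1 - \<delta>) * ?z \<le> ?c" using dr V(2) by (simp add: D_def P_def)
        then have "1 - \<delta> \<le> ?c / ?z" using True by (simp only: pos_le_divide_eq)
        then show "1 - ?c / ?z \<le> \<delta>" by linarith
      qed
      then have "1 - \<epsilon> n \<le> ?c / ?z" by linarith
      then show ?thesis using True by (simp only: pos_le_divide_eq)
    next
      case False
      have "\<epsilon> n \<le> 1" unfolding \<epsilon>_def by (intro cInf_lower bdd one)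
      then have "0 \<le> 1 - \<epsilon> n" by simp
      moreover have "?z \<le> 0" using False by linarith
      ultimately have "(1 - \<epsilon> n) * ?z \<le> 0" by (rule mult_nonneg_nonpos)
      then show ?thesis using c0 by linarith
    qed
  qed
  ultimately show ?thesis by blast
qed

end
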